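(* There is a constant $C_3>0$ such that if $G$ is a multigraph of maximum edge multiplicity $\mu\ge 1$ that is embeddable on a surface of Euler genus $g$, then $\operatorname{ch}_{a}(G) \le C_3 \sqrt{\mu}\,(g+1)^{1/4}$.
   Context: Graphs are finite multigraphs (parallel edges allowed). A $k$-list-assignment of $G=(V,E)$ is a map $L$ assigning to each vertex a set $L(v)$ of $k$ positive integers; an $L$-colouring is a map $c$ with $c(v)\in L(v)$ for all $v$. Given a labelling $\ell:E\to\mathbb{Z}^+$ of the edges, a (not necessarily proper) colouring $c$ is adapted to $\ell$ if no edge $e=uv$ has $c(u)=c(v)=\ell(e)$. $G$ is adaptably $k$-choosable if for every $k$-list-assignment $L$ and every labelling $\ell$ there is an $L$-colouring adapted to $\ell$; the adaptable choosability $\operatorname{ch}_a(G)$ is the least such $k$. *)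

theory Defs
  imports "HOL-Analysis.Analysis"
begin

section \<open>Multigraphs and adaptable choosability\<close>

record ('v, 'e) multigraph =
  verts :: "'v set"
  edges :: "'e set"
  ends :: "'e \<Rightarrow> 'v set"

text \<open>Parallel edges are allowed, loops are not: a loop has its own two ends equal, so a vertex
  with sufficiently many loops would defeat any bound of order \<open>sqrt \<mu>\<close>.\<close>

definition multigraph :: "('v, 'e) multigraph \<Rightarrow> bool" where
  "multigraph G \<longleftrightarrow> finite (verts G) \<and> finite (edges G) \<and>
     (\<forall>e\<in>edges G. ends G e \<subseteq> verts G \<and> card (ends G e) = 2)"

definition edge_multiplicity :: "('v, 'e) multigraph \<Rightarrow> 'e \<Rightarrow> nat" where
  "edge_multiplicity G e = card {f \<in> edges G. ends G f = ends G e}"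

text \<open>The inserted \<open>0\<close> is the value for edgeless graphs.\<close>

definition max_multiplicity :: "('v, 'e) multigraph \<Rightarrow> nat" where
  "max_multiplicity G = Max (insert 0 (edge_multiplicity G ` edges G))"

definition list_assignment :: "('v, 'e) multigraph \<Rightarrow> nat \<Rightarrow> ('v \<Rightarrow> nat set) \<Rightarrow> bool" where
  "list_assignment G k L \<longleftrightarrow>
     (\<forall>v\<in>verts G. finite (L v) \<and> card (L v) = k \<and> L v \<subseteq> {0<..})"

definition list_colouring :: "('v, 'e) multigraph \<Rightarrow> ('v \<Rightarrow> nat set) \<Rightarrow> ('v \<Rightarrow> nat) \<Rightarrow> bool" where
  "list_colouring G L c \<longleftrightarrow> (\<forall>v\<in>verts G. c v \<in> L v)"

definition edge_labelling :: "('v, 'e) multigraph \<Rightarrow> ('e \<Rightarrow> nat) \<Rightarrow> bool" where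
  "edge_labelling G l \<longleftrightarrow> (\<forall>e\<in>edges G. 0 < l e)"

definition adapted :: "('v, 'e) multigraph \<Rightarrow> ('e \<Rightarrow> nat) \<Rightarrow> ('v \<Rightarrow> nat) \<Rightarrow> bool" where
  "adapted G l c \<longleftrightarrow>
     \<not> (\<exists>e\<in>edges G. \<exists>u v. ends G e = {u, v} \<and> c u = l e \<and> c v = l e)"

definition adaptably_choosable :: "('v, 'e) multigraph \<Rightarrow> nat \<Rightarrow> bool" where
  "adaptably_choosable G k \<longleftrightarrow>
     (\<forall>L l. list_assignment G k L \<longrightarrow> edge_labelling G l \<longrightarrow>
        (\<exists>c. list_colouring G L c \<and> adapted G l c))"

definition ch_a :: "('v, 'e) multigraph \<Rightarrow> nat" where
  "ch_a G = (LEAST k. adaptably_choosable G k)"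

lemma adaptably_choosable_ch_a:
  assumes "multigraph G"
  shows "adaptably_choosable G (ch_a G)"
  unfolding ch_a_def
proof (rule LeastI)
  show "adaptably_choosable G (Suc (card (edges G)))"
    unfolding adaptably_choosable_def
  proof (intro allI impI)
    fix L :: "'a \<Rightarrow> nat set" and l :: "'b \<Rightarrow> nat"
    assume L: "list_assignment G (Suc (card (edges G))) L"
    have fin: "finite (edges G)"
      using assms by (simp add: multigraph_def)
    have "\<exists>a. a \<in> L v \<and> a \<notin> l ` edges G" if "v \<in> verts G" for v
    proof (rule ccontr)
      assume "\<not> ?thesis"
      then have "L v \<subseteq> l ` edges G" by blast
      then have "card (L v) \<le> card (l ` edges G)"
        using fin by (intro card_mono) auto
      also have "\<dots> \<le> card (edges G)" using fin by (rule card_image_le)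
      finally show False using L that by (simp add: list_assignment_def)
    qed
    then obtain c where c: "\<And>v. v \<in> verts G \<Longrightarrow> c v \<in> L v \<and> c v \<notin> l ` edges G"
      by metis
    have "adapted G l c"
      unfolding adapted_def
    proof clarify
      fix e u v
      assume e: "e \<in> edges G" "ends G e = {u, v}" "c u = l e"
      then have "u \<in> verts G" using assms by (auto simp: multigraph_def)
      then show False using c e by auto
    qed
    then show "\<exists>c. list_colouring G L c \<and> adapted G l c"
      using c by (auto simp: list_colouring_def)
  qed
qed

section \<open>Closed surfaces and their Euler genus\<close>

text \<open>A two-dimensional simplicial complex is given by its set of triangles. It triangulates a
  connected closed surface iff every edge lies in exactly two triangles and every vertex link,
  which then is a 2-regular graph, is connected (hence a cycle), and the complex is connected.\<close>

definition complex_edges :: "nat set set \<Rightarrow> nat set set" where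
  "complex_edges T = {e. card e = 2 \<and> (\<exists>t\<in>T. e \<subseteq> t)}"

definition closed_surface_complex :: "nat set set \<Rightarrow> bool" where
  "closed_surface_complex T \<longleftrightarrow>
     finite T \<and> T \<noteq> {} \<and> (\<forall>t\<in>T. card t = 3) \<and>
     (\<forall>e\<in>complex_edges T. card {t \<in> T. e \<subseteq> t} = 2) \<and>
     (\<forall>v x y. {v, x} \<in> complex_edges T \<longrightarrow> {v, y} \<in> complex_edges T \<longrightarrow>
        (x, y) \<in> {(a, b). {v, a, b} \<in> T}\<^sup>*) \<and>
     (\<forall>x\<in>\<Union>T. \<forall>y\<in>\<Union>T. (x, y) \<in> {(a, b). {a, b} \<in> complex_edges T}\<^sup>*)"

definition euler_characteristic :: "nat set set \<Rightarrow> int" where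
  "euler_characteristic T = int (card (\<Union>T)) - int (card (complex_edges T)) + int (card T)"

text \<open>The geometric realization, in barycentric coordinates.\<close>

definition polyhedron :: "nat set set \<Rightarrow> (nat \<Rightarrow> real) set" where
  "polyhedron T = {x. (\<forall>v. 0 \<le> x v) \<and> (\<exists>t\<in>T. (\<forall>v. v \<notin> t \<longrightarrow> x v = 0) \<and> (\<Sum>v\<in>t. x v) = 1)}"

text \<open>By Rado's theorem every connected compact 2-manifold without boundary is homeomorphic to
  such a polyhedron. The Euler genus is \<open>2 - \<chi>\<close>.\<close>

definition surface_of_euler_genus :: "'s topology \<Rightarrow> nat \<Rightarrow> bool" where
  "surface_of_euler_genus S g \<longleftrightarrow>
     (\<exists>T. closed_surface_complex T \<and> S homeomorphic_space (top_of_set (polyhedron T)) \<and>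
          int g = 2 - euler_characteristic T)"

text \<open>An embedding maps the vertices to distinct points and the edges to simple arcs joining their
  ends, such that the interior of an arc meets no vertex and no other arc. The arcs need not be
  tame, and the faces need not be discs.\<close>

definition embedding_on ::
  "('v, 'e) multigraph \<Rightarrow> 's topology \<Rightarrow> ('v \<Rightarrow> 's) \<Rightarrow> ('e \<Rightarrow> real \<Rightarrow> 's) \<Rightarrow> bool" where
  "embedding_on G S p \<gamma> \<longleftrightarrow>
     p ` verts G \<subseteq> topspace S \<and> inj_on p (verts G) \<and>
     (\<forall>e\<in>edges G. pathin S (\<gamma> e) \<and> inj_on (\<gamma> e) {0..1} \<and>
        {\<gamma> e 0, \<gamma> e 1} = p ` ends G e \<and>
        \<gamma> e ` {0<..<1} \<inter> p ` verts G = {}) \<and>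
     (\<forall>e\<in>edges G. \<forall>f\<in>edges G. e \<noteq> f \<longrightarrow> \<gamma> e ` {0<..<1} \<inter> \<gamma> f ` {0<..<1} = {})"

definition embeddable_on :: "('v, 'e) multigraph \<Rightarrow> 's topology \<Rightarrow> bool" where
  "embeddable_on G S \<longleftrightarrow> (\<exists>p \<gamma>. embedding_on G S p \<gamma>)"

end

theory Submission
  imports Defs
begin

text \<open>By Euler's inequality the simple graph underlying \<open>G\<close> has at most \<open>3 * n + 3 * g\<close> edges on any \<open>n\<close> of
  its vertices. With lists of size \<open>8 * q\<close>, where \<open>q\<close> is of order \<open>sqrt \<mu> * g powr (1/4)\<close>, vertices
  with fewer than \<open>8 * q\<close> neighbours can be coloured last. What remains has at most \<open>g\<close> vertices and
  \<open>6 * g\<close> edges up to multiplicity, hence only \<open>O(sqrt g)\<close> vertices of degree at least \<open>sqrt g\<close>. A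
  random bipartition of the colours leaves every list with at least \<open>q\<close> colours of each kind; the
  high-degree vertices use one kind and the others the second. Both induced subgraphs have maximum
  degree \<open>O(\<mu> * sqrt g) = O(q\<^sup>2)\<close>, for which lists of size \<open>q\<close> suffice by Rosenfeld's counting
  argument.

  Euler's inequality for arbitrary topological embeddings is obtained by exhibiting the graph as a
  minor of the 1-skeleton of a fine iterated barycentric subdivision of the surface.\<close>

section \<open>Minors of triangulated surfaces\<close>

text \<open>Arcs may be wild and faces need not be discs, so no face of the embedded graph is ever
  examined. Classes of triangles take their place, and Euler's formula is only used as a lower bound
  on the number of classes, which gluing gives without any topology. Continuity enters only through
  overlaps of open stars of a subdivision. Such overlaps turn an arc into a connected set of
  vertices rather than a path, which is why minors with connected sets in place of edges are the
  right target. On the colouring side, splitting the colours succeeds only for fewer than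
  \<open>7 ^ q / 2\<close> vertices, while the number of vertices of \<open>G\<close> is unbounded.
  Removing vertices with few neighbours comes first for this reason: what is left has at most
  \<open>g\<close> vertices, and \<open>g\<close> is at most \<open>q ^ 4\<close>. The degree
  threshold near \<open>sqrt g\<close> balances the two classes: high-degree vertices have few
  neighbours among themselves because there are few of them, the others because of the
  threshold.\<close>

definition skeleton :: "'a set set \<Rightarrow> 'a set set" where
  "skeleton T = {e. card e = 2 \<and> (\<exists>t\<in>T. e \<subseteq> t)}"

text \<open>The last clause says that the dual graph is connected. Vertex links are not constrained.\<close>

definition pseudosurface :: "'a set set \<Rightarrow> bool" where
  "pseudosurface T \<longleftrightarrow> finite T \<and> T \<noteq> {} \<and> (\<forall>t\<in>T. card t = 3) \<and>
     (\<forall>e\<in>skeleton T. card {t\<in>T. e \<subseteq> t} = 2) \<and>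
     (\<forall>U\<subseteq>T. U \<noteq> {} \<longrightarrow>
        (\<forall>e\<in>skeleton T. \<forall>t\<in>T. \<forall>t'\<in>T. e \<subseteq> t \<longrightarrow> e \<subseteq> t' \<longrightarrow> t \<in> U \<longrightarrow> t' \<in> U) \<longrightarrow> U = T)"

definition euler_char :: "'a set set \<Rightarrow> int" where
  "euler_char T = int (card (\<Union>T)) - int (card (skeleton T)) + int (card T)"

text \<open>\<open>C\<close> induces a connected subgraph, expressed by cuts instead of paths.\<close>

definition linked :: "'a set set \<Rightarrow> 'a set \<Rightarrow> bool" where
  "linked E C \<longleftrightarrow> (\<forall>Y\<subseteq>C. Y \<noteq> {} \<longrightarrow> Y \<noteq> C \<longrightarrow> (\<exists>x\<in>C - Y. \<exists>y\<in>Y. {x, y} \<in> E))"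

text \<open>Cycles modulo 2. They replace graph cycles throughout: a forest is an edge set without
  nonempty even subsets.\<close>

definition even_set :: "'a set set \<Rightarrow> bool" where
  "even_set Z \<longleftrightarrow> (\<forall>w. even (card {e\<in>Z. w \<in> e}))"

lemma pseudosurfaceD:
  assumes "pseudosurface T"
  shows "finite T" "T \<noteq> {}" "\<And>t. t \<in> T \<Longrightarrow> card t = 3" "\<And>t. t \<in> T \<Longrightarrow> finite t"
    "\<And>e. e \<in> skeleton T \<Longrightarrow> card {t\<in>T. e \<subseteq> t} = 2"
    "finite (\<Union>T)" "finite (skeleton T)"
proof -
  show *: "finite T" "T \<noteq> {}" "\<And>t. t \<in> T \<Longrightarrow> card t = 3"
    "\<And>e. e \<in> skeleton T \<Longrightarrow> card {t\<in>T. e \<subseteq> t} = 2"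
    using assms by (auto simp: pseudosurface_def)
  show fin: "\<And>t. t \<in> T \<Longrightarrow> finite t"
    using *(3) by (intro card_ge_0_finite) simp
  then show fU: "finite (\<Union>T)" using *(1) by (simp add: finite_Union)
  have "skeleton T \<subseteq> Pow (\<Union>T)" by (auto simp: skeleton_def)
  then show "finite (skeleton T)" by (rule finite_subset) (simp add: fU)
qed

lemma pseudosurface_connected:
  assumes "pseudosurface T" "U \<subseteq> T" "U \<noteq> {}"
    "\<And>e t t'. \<lbrakk>e \<in> skeleton T; t \<in> T; t' \<in> T; e \<subseteq> t; e \<subseteq> t'; t \<in> U\<rbrakk> \<Longrightarrow> t' \<in> U"
  shows "U = T"
  using assms(1)[unfolded pseudosurface_def, THEN conjunct2, THEN conjunct2, THEN conjunct2,
      THEN conjunct2, THEN spec, of U, THEN mp, OF assms(2), THEN mp, OF assms(3), THEN mp]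
    assms(4) by blast

text \<open>Count incident pairs of an edge and a triangle: two triangles at each edge, three edges
  in each triangle.\<close>

lemma skeleton_card_eq:
  assumes "pseudosurface T"
  shows "2 * card (skeleton T) = 3 * card T"
proof -
  note D = pseudosurfaceD[OF assms]
  have "(\<Sum>e\<in>skeleton T. card {t\<in>T. e \<subseteq> t}) = (\<Sum>t\<in>T. card {e\<in>skeleton T. e \<subseteq> t})"
    using D(1,7) by (intro sum_multicount_gen) auto
  moreover have "card {e\<in>skeleton T. e \<subseteq> t} = 3" if t: "t \<in> T" for t
  proof -
    have "{e\<in>skeleton T. e \<subseteq> t} = {e. e \<subseteq> t \<and> card e = 2}"
      using t by (auto simp: skeleton_def)
    then show ?thesis using n_subsets[OF D(4)[OF t], of 2] D(3)[OF t] by (simp add: choose_two)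
  qed
  ultimately show ?thesis using D(5) by simp
qed

text \<open>If no edge left \<open>Y\<close>, a triangle meeting \<open>Y\<close> would lie inside
  \<open>Y\<close>; such triangles are closed under adjacency across edges, so they would be all of
  \<open>T\<close>.\<close>

lemma pseudosurface_linked:
  assumes "pseudosurface T"
  shows "linked (skeleton T) (\<Union>T)"
  unfolding linked_def
proof (intro allI impI)
  fix Y assume Y: "Y \<subseteq> \<Union>T" "Y \<noteq> {}" "Y \<noteq> \<Union>T"
  show "\<exists>x\<in>\<Union>T - Y. \<exists>y\<in>Y. {x, y} \<in> skeleton T"
  proof (rule ccontr)
    assume neg: "\<not> ?thesis"
    have edge: "{x, y} \<in> skeleton T" if "t \<in> T" "x \<in> t" "y \<in> t" "x \<noteq> y" for t x y
      using that by (auto simp: skeleton_def)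
    have all: "t \<subseteq> Y" if "t \<in> T" "y \<in> t" "y \<in> Y" for t y
      using neg edge that by blast
    define U where "U = {t\<in>T. t \<inter> Y \<noteq> {}}"
    have "U = T"
    proof (rule pseudosurface_connected[OF assms])
      show "U \<subseteq> T" "U \<noteq> {}" using Y by (auto simp: U_def)
      fix e t t' assume e: "e \<in> skeleton T" "t \<in> T" "t' \<in> T" "e \<subseteq> t" "e \<subseteq> t'" "t \<in> U"
      then have "e \<noteq> {}" by (auto simp: skeleton_def)
      moreover obtain y where "y \<in> t" "y \<in> Y" using e(6) by (auto simp: U_def)
      then have "t \<subseteq> Y" using all[OF e(2)] by blast
      then have "e \<subseteq> Y" using e(4) by blast
      ultimately show "t' \<in> U" using e(3,5) by (auto simp: U_def)
    qed
    then show False using all Y by (auto simp: U_def)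
  qed
qed

section \<open>Boundaries modulo 2 and the count of faces\<close>

definition boundary :: "'a set set \<Rightarrow> 'a set set \<Rightarrow> 'a set set" where
  "boundary T U = {e\<in>skeleton T. card {t\<in>U. e \<subseteq> t} = 1}"

text \<open>The boundary of a boundary vanishes modulo 2: a triangle through \<open>w\<close> has
  exactly two edges at \<open>w\<close>, and since no edge lies in more than two triangles, an odd
  number of them means exactly one.\<close>

lemma even_set_boundary:
  assumes T: "pseudosurface T" and U: "U \<subseteq> T"
  shows "even_set (boundary T U)"
  unfolding even_set_def
proof
  fix w
  note D = pseudosurfaceD[OF T]
  have fU: "finite U" using D(1) U finite_subset by blast
  define S where "S = {e\<in>skeleton T. w \<in> e}"
  have fS: "finite S" using D(7) by (simp add: S_def)
  have "(\<Sum>e\<in>S. card {t\<in>U. e \<subseteq> t}) = (\<Sum>t\<in>U. card {e\<in>S. e \<subseteq> t})"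
    by (rule sum_multicount_gen) (use fU fS in auto)
  moreover have "even (card {e\<in>S. e \<subseteq> t})" if t: "t \<in> U" for t
  proof (cases "w \<in> t")
    case False
    then have "{e\<in>S. e \<subseteq> t} = {}" by (auto simp: S_def)
    then show ?thesis by (simp only: card.empty even_zero)
  next
    case True
    have ct: "card t = 3" "finite t" using t U D(3,4) by blast+
    have "{e\<in>S. e \<subseteq> t} = (\<lambda>x. {w, x}) ` (t - {w})"
      using True t U by (auto simp: S_def skeleton_def card_2_iff)
    moreover have "inj_on (\<lambda>x. {w, x}) (t - {w})"
      by (auto simp: inj_on_def doubleton_eq_iff)
    ultimately have "card {e\<in>S. e \<subseteq> t} = card (t - {w})"
      by (simp add: card_image)
    then show ?thesis using ct True by simp
  qed
  ultimately have ev: "even (\<Sum>e\<in>S. card {t\<in>U. e \<subseteq> t})"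
    by (simp add: dvd_sum)
  have le2: "card {t\<in>U. e \<subseteq> t} \<le> 2" if "e \<in> S" for e
  proof -
    have "card {t\<in>U. e \<subseteq> t} \<le> card {t\<in>T. e \<subseteq> t}"
      using D(1) U by (intro card_mono) auto
    then show ?thesis using D(5) that by (simp add: S_def)
  qed
  have odd: "odd (card {t\<in>U. e \<subseteq> t}) \<longleftrightarrow> card {t\<in>U. e \<subseteq> t} = 1" if "e \<in> S" for e
  proof -
    have "n \<le> 2 \<Longrightarrow> odd n \<longleftrightarrow> n = 1" for n :: nat by presburger
    then show ?thesis using le2[OF that] .
  qed
  have "even (card {e\<in>S. odd (card {t\<in>U. e \<subseteq> t})})"
    using ev even_sum_iff[OF fS, of "\<lambda>e. card {t\<in>U. e \<subseteq> t}"] by simp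
  also have "{e\<in>S. odd (card {t\<in>U. e \<subseteq> t})} = {e\<in>boundary T U. w \<in> e}"
    using odd by (auto simp: boundary_def S_def)
  finally show "even (card {e\<in>boundary T U. w \<in> e})" .
qed

text \<open>The classes are the fibres of \<open>r\<close>. Each \<open>d\<close> relates at most
  two elements, so imposing it merges at most two classes and loses at most one value of
  \<open>r\<close>. This avoids speaking of components of the dual graph.\<close>

lemma glue_classes:
  fixes T :: "'a set"
  assumes "finite D" "finite T" "\<And>d. d \<in> D \<Longrightarrow> \<exists>a b. {t\<in>T. R d t} = {a, b}"
  shows "\<exists>r::'a \<Rightarrow> 'a. card T \<le> card (r ` T) + card D \<and>
    (\<forall>d\<in>D. \<forall>t\<in>T. \<forall>t'\<in>T. R d t \<longrightarrow> R d t' \<longrightarrow> r t = r t')"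
  using assms(1,3)
proof (induction D)
  case empty
  show ?case by (intro exI[of _ id]) simp
next
  case (insert d D)
  then obtain r :: "'a \<Rightarrow> 'a" where r: "card T \<le> card (r ` T) + card D"
    "\<forall>d\<in>D. \<forall>t\<in>T. \<forall>t'\<in>T. R d t \<longrightarrow> R d t' \<longrightarrow> r t = r t'"
    by auto
  obtain a b where ab: "{t\<in>T. R d t} = {a, b}" using insert.prems by blast
  define r' where "r' = (\<lambda>s. if r s = r b then r a else r s)"
  have "r ` T \<subseteq> insert (r b) (r' ` T)" by (auto simp: r'_def)
  then have "card (r ` T) \<le> card (insert (r b) (r' ` T))"
    using assms(2) by (intro card_mono) auto
  also have "\<dots> \<le> Suc (card (r' ` T))" using assms(2) by (simp add: card_insert_if)
  finally have "card T \<le> card (r' ` T) + card (insert d D)"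
    using r(1) insert.hyps by simp
  moreover have "r' t = r' t'" if "d' \<in> insert d D" "t \<in> T" "t' \<in> T" "R d' t" "R d' t'" for d' t t'
  proof (cases "d' = d")
    case True
    then have "t \<in> {a, b}" "t' \<in> {a, b}" using that ab by auto
    then show ?thesis by (auto simp: r'_def)
  next
    case False
    then have "r t = r t'" using that r(2) by blast
    then show ?thesis by (simp add: r'_def)
  qed
  ultimately show ?case by blast
qed

text \<open>\<open>X\<close> is a spanning subgraph and \<open>Y\<close> its set of essential edges. Gluing triangles across the
  edges outside \<open>X\<close> leaves at least \<open>F - E + card X\<close> faces. If there are two or more, each has a
  nonempty boundary cycle in \<open>X\<close>, hence at least three edges of \<open>Y\<close>, each of which bounds at most
  two faces.\<close>

lemma euler_count:
  assumes T: "pseudosurface T" and X: "X \<subseteq> skeleton T" and Y: "Y \<subseteq> X"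
    and three: "\<And>Z. Z \<subseteq> X \<Longrightarrow> even_set Z \<Longrightarrow> Z \<noteq> {} \<Longrightarrow> 3 \<le> card (Z \<inter> Y)"
  shows "3 * (int (card T) - int (card (skeleton T)) + int (card X)) \<le> 2 * int (card Y) + 3"
proof -
  note D = pseudosurfaceD[OF T]
  have fX: "finite X" and fY: "finite Y" using finite_subset[OF X D(7)] finite_subset[OF Y] by auto
  define Q where "Q = skeleton T - X"
  have cQ: "int (card Q) = int (card (skeleton T)) - int (card X)"
    unfolding Q_def card_Diff_subset[OF fX X] using card_mono[OF D(7) X] by (rule of_nat_diff)
  have two: "\<exists>a b. {t\<in>T. e \<subseteq> t} = {a, b}" if "e \<in> skeleton T" for e
    using D(5)[OF that] unfolding card_2_iff by blast
  obtain r :: "'a set \<Rightarrow> 'a set" where r: "card T \<le> card (r ` T) + card Q"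
    "\<forall>d\<in>Q. \<forall>t\<in>T. \<forall>t'\<in>T. d \<subseteq> t \<longrightarrow> d \<subseteq> t' \<longrightarrow> r t = r t'"
  proof -
    have "finite Q" "\<And>d. d \<in> Q \<Longrightarrow> \<exists>a b. {t\<in>T. d \<subseteq> t} = {a, b}"
      using D(7) two by (simp_all add: Q_def)
    from glue_classes[OF this(1) D(1), of "\<lambda>d t. d \<subseteq> t", OF this(2)] that show thesis
      by blast
  qed
  define f where "f = card (r ` T)"
  have f: "int (card T) - int (card (skeleton T)) + int (card X) \<le> int f"
    using r(1) cQ by (simp add: f_def)
  have "3 * int f \<le> 2 * int (card Y) + 3"
  \<comment> \<open>A single face may have empty boundary and then yields no edges to count; the
    additive 3 in the bound pays for this case.\<close>
  proof (cases "f \<le> 1")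
    case True then show ?thesis by simp
  next
    case False
    define cl where "cl = (\<lambda>i. {t\<in>T. r t = i})"
    define bd where "bd = (\<lambda>i. boundary T (cl i))"
    have sub: "bd i \<subseteq> X" for i
    proof
      fix e assume "e \<in> bd i"
      then have e: "e \<in> skeleton T" "card {t\<in>cl i. e \<subseteq> t} = 1" by (auto simp: bd_def boundary_def)
      show "e \<in> X"
      proof (rule ccontr)
        assume "e \<notin> X"
        then have eQ: "e \<in> Q" using e by (simp add: Q_def)
        obtain t where t: "t \<in> cl i" "e \<subseteq> t"
          using e(2) by (auto simp: card_1_singleton_iff)
        have "r t' = i" if "t' \<in> T" "e \<subseteq> t'" for t'
          using r(2)[rule_format, OF eQ, of t t'] t that by (simp add: cl_def)
        then have "{t\<in>cl i. e \<subseteq> t} = {t\<in>T. e \<subseteq> t}"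
          unfolding cl_def by blast
        then show False using e D(5) by simp
      qed
    qed
    have ne: "bd i \<noteq> {}" if i: "i \<in> r ` T" for i
    proof
      assume emp: "bd i = {}"
      have "cl i = T"
      proof (rule pseudosurface_connected[OF T])
        show "cl i \<subseteq> T" "cl i \<noteq> {}" using i by (auto simp: cl_def)
        fix e t t' assume e: "e \<in> skeleton T" "t \<in> T" "t' \<in> T" "e \<subseteq> t" "e \<subseteq> t'" "t \<in> cl i"
        \<comment> \<open>With an empty boundary no edge has exactly one of its triangles in the
          class; an edge of \<open>t\<close> has at least one there, hence both.\<close>
        have "card {t\<in>cl i. e \<subseteq> t} \<noteq> 1" using emp e by (auto simp: bd_def boundary_def)
        moreover have "card {t\<in>cl i. e \<subseteq> t} \<noteq> 0" using e D(1) by (auto simp: cl_def)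
        ultimately have "card {t\<in>T. e \<subseteq> t} \<le> card {t\<in>cl i. e \<subseteq> t}"
          unfolding D(5)[OF e(1)] by simp
        then have "{t\<in>cl i. e \<subseteq> t} = {t\<in>T. e \<subseteq> t}"
          using D(1) by (intro card_seteq) (auto simp: cl_def)
        then show "t' \<in> cl i" using e(3,5) by blast
      qed
      then have "r ` T = {i}" using i by (auto simp: cl_def)
      then show False using False by (simp add: f_def)
    qed
    have "3 * f = (\<Sum>i\<in>r ` T. 3)" by (simp add: f_def)
    also have "\<dots> \<le> (\<Sum>i\<in>r ` T. card {y\<in>Y. y \<in> bd i})"
    proof (rule sum_mono)
      fix i assume i: "i \<in> r ` T"
      have "3 \<le> card (bd i \<inter> Y)"
        using three[OF sub _ ne[OF i]] even_set_boundary[OF T] by (auto simp: bd_def cl_def)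
      also have "bd i \<inter> Y = {y\<in>Y. y \<in> bd i}" by auto
      finally show "3 \<le> card {y\<in>Y. y \<in> bd i}" .
    qed
    also have "\<dots> = (\<Sum>y\<in>Y. card {i\<in>r ` T. y \<in> bd i})"
      by (rule sum_multicount_gen) (use D(1) fY in auto)
    also have "\<dots> \<le> (\<Sum>y\<in>Y. 2)"
    proof (rule sum_mono)
      fix y assume "y \<in> Y"
      then have y: "y \<in> skeleton T" using X Y by blast
      have "{i\<in>r ` T. y \<in> bd i} \<subseteq> r ` {t\<in>T. y \<subseteq> t}"
      proof
        fix i assume "i \<in> {i\<in>r ` T. y \<in> bd i}"
        then have "card {t\<in>cl i. y \<subseteq> t} = 1" by (auto simp: bd_def boundary_def)
        then obtain t where "t \<in> cl i" "y \<subseteq> t"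
          by (auto simp: card_1_singleton_iff)
        then show "i \<in> r ` {t\<in>T. y \<subseteq> t}" by (auto simp: cl_def)
      qed
      then have "card {i\<in>r ` T. y \<in> bd i} \<le> card (r ` {t\<in>T. y \<subseteq> t})"
        using D(1) by (intro card_mono) auto
      also have "\<dots> \<le> card {t\<in>T. y \<subseteq> t}" using D(1) by (intro card_image_le) auto
      finally show "card {i\<in>r ` T. y \<in> bd i} \<le> 2" using D(5)[OF y] by simp
    qed
    finally have "3 * f \<le> 2 * card Y" by simp
    then have "int (3 * f) \<le> int (2 * card Y)" by (simp only: of_nat_le_iff)
    then show ?thesis by simp
  qed
  moreover have "3 * (int (card T) - int (card (skeleton T)) + int (card X)) \<le> 3 * int f"
    using f by (intro mult_left_mono) auto
  ultimately show ?thesis by (rule order_trans[rotated])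
qed

section \<open>Minor models in the 1-skeleton\<close>

lemma linkedE:
  assumes "linked E C" "Y \<subseteq> C" "Y \<noteq> {}" "Y \<noteq> C"
  obtains x y where "x \<in> C - Y" "y \<in> Y" "{x, y} \<in> E"
  using assms unfolding linked_def by metis

text \<open>A minor model of the simple graph \<open>(V, A)\<close> in the 1-skeleton in which an edge is also represented
  by a connected set instead of a single edge.\<close>

locale minor_model =
  fixes T :: "'a set set" and V :: "'v set" and A :: "'v set set"
    and B :: "'v \<Rightarrow> 'a set" and M :: "'v set \<Rightarrow> 'a set"
  assumes surf: "pseudosurface T"
    and finV: "finite V" and V_ne: "V \<noteq> {}"
    and A_V: "e \<in> A \<Longrightarrow> e \<subseteq> V" and A2: "e \<in> A \<Longrightarrow> card e = 2"
    and B_T: "v \<in> V \<Longrightarrow> B v \<subseteq> \<Union>T" and B_ne: "v \<in> V \<Longrightarrow> B v \<noteq> {}"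
    and B_linked: "v \<in> V \<Longrightarrow> linked (skeleton T) (B v)"
    and M_T: "e \<in> A \<Longrightarrow> M e \<subseteq> \<Union>T" and M_linked: "e \<in> A \<Longrightarrow> linked (skeleton T) (M e)"
    and B_disj: "\<lbrakk>u \<in> V; v \<in> V; x \<in> B u; x \<in> B v\<rbrakk> \<Longrightarrow> u = v"
    and M_disj: "\<lbrakk>e \<in> A; f \<in> A; x \<in> M e; x \<in> M f\<rbrakk> \<Longrightarrow> e = f"
    and B_M: "\<lbrakk>v \<in> V; e \<in> A; x \<in> B v; x \<in> M e\<rbrakk> \<Longrightarrow> v \<in> e"
    and B_M_meet: "\<lbrakk>e \<in> A; v \<in> e\<rbrakk> \<Longrightarrow> B v \<inter> M e \<noteq> {}"
begin

text \<open>\<open>\<beta>\<close> assigns vertices of \<open>T\<close> to branch sets, and \<open>F\<close> consists of a spanning tree of each branch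
  set.\<close>

definition rooted_forest :: "('a \<Rightarrow> 'v option) \<Rightarrow> 'a set set \<Rightarrow> bool" where
  "rooted_forest \<beta> F \<longleftrightarrow>
     dom \<beta> \<subseteq> \<Union>T \<and> ran \<beta> \<subseteq> V \<and> F \<subseteq> skeleton T \<and>
     (\<forall>e\<in>F. \<exists>v. \<forall>x\<in>e. \<beta> x = Some v) \<and>
     card F + card V = card (dom \<beta>) \<and>
     (\<forall>Z\<subseteq>F. even_set Z \<longrightarrow> Z = {}) \<and>
     (\<forall>v\<in>V. \<exists>x\<in>B v. \<beta> x = Some v) \<and>
     (\<forall>x v. \<beta> x = Some v \<longrightarrow> (\<forall>u\<in>V. x \<in> B u \<longrightarrow> u = v) \<and> (\<forall>e\<in>A. x \<in> M e \<longrightarrow> v \<in> e))"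

lemma fin_verts: "finite (\<Union>T)"
  using pseudosurfaceD(6)[OF surf] .

lemma fin_skel: "finite (skeleton T)"
  using pseudosurfaceD(7)[OF surf] .

lemma rooted_forestD:
  assumes "rooted_forest \<beta> F"
  shows "dom \<beta> \<subseteq> \<Union>T" "ran \<beta> \<subseteq> V" "F \<subseteq> skeleton T"
    "\<And>e. e \<in> F \<Longrightarrow> \<exists>v. \<forall>x\<in>e. \<beta> x = Some v"
    "card F + card V = card (dom \<beta>)"
    "\<And>Z. Z \<subseteq> F \<Longrightarrow> even_set Z \<Longrightarrow> Z = {}"
    "\<And>v. v \<in> V \<Longrightarrow> \<exists>x\<in>B v. \<beta> x = Some v"
    "\<And>x v u. \<beta> x = Some v \<Longrightarrow> u \<in> V \<Longrightarrow> x \<in> B u \<Longrightarrow> u = v"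
    "\<And>x v e. \<beta> x = Some v \<Longrightarrow> e \<in> A \<Longrightarrow> x \<in> M e \<Longrightarrow> v \<in> e"
proof -
  note c1 = assms[unfolded rooted_forest_def]
  note c2 = c1[THEN conjunct2] note c3 = c2[THEN conjunct2] note c4 = c3[THEN conjunct2]
  note c5 = c4[THEN conjunct2] note c6 = c5[THEN conjunct2] note c7 = c6[THEN conjunct2]
  note c8 = c7[THEN conjunct2]
  show "dom \<beta> \<subseteq> \<Union>T" "ran \<beta> \<subseteq> V" "F \<subseteq> skeleton T" "card F + card V = card (dom \<beta>)"
    by (rule c1[THEN conjunct1] c2[THEN conjunct1] c3[THEN conjunct1] c5[THEN conjunct1])+
  show "\<exists>v. \<forall>x\<in>e. \<beta> x = Some v" if "e \<in> F" for e
    using c4[THEN conjunct1] that by (rule bspec)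
  show "Z = {}" if "Z \<subseteq> F" "even_set Z" for Z
    using c6[THEN conjunct1, THEN spec, THEN mp, THEN mp, OF that] .
  show "\<exists>x\<in>B v. \<beta> x = Some v" if "v \<in> V" for v
    using c7[THEN conjunct1] that by (rule bspec)
  show "u = v" if "\<beta> x = Some v" "u \<in> V" "x \<in> B u" for x v u
    using c8[THEN spec, THEN spec, THEN mp, OF that(1)] that by simp
  show "v \<in> e" if "\<beta> x = Some v" "e \<in> A" "x \<in> M e" for x v e
    using c8[THEN spec, THEN spec, THEN mp, OF that(1)] that by simp
qed

text \<open>Isolated roots: one chosen vertex of \<open>T\<close> from each branch set, and no
  edges.\<close>

lemma rooted_forest_initial: "\<exists>\<beta>. rooted_forest \<beta> {}"
proof -
  define b where "b = (\<lambda>v. SOME x. x \<in> B v)"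
  have b: "b v \<in> B v" if "v \<in> V" for v
    unfolding b_def using B_ne[OF that] by (simp add: some_in_eq)
  have inj: "inj_on b V"
    using b B_disj by (metis inj_onI)
  define \<beta> where "\<beta> = (\<lambda>x. if x \<in> b ` V then Some (inv_into V b x) else None)"
  have \<beta>b: "\<beta> (b v) = Some v" if "v \<in> V" for v
    using that inj by (simp add: \<beta>_def)
  have \<beta>D: "v \<in> V \<and> x = b v" if "\<beta> x = Some v" for x v
  proof -
    have "x \<in> b ` V" using that by (auto simp: \<beta>_def split: if_splits)
    then obtain u where "u \<in> V" "x = b u" by blast
    then show ?thesis using that \<beta>b by simp
  qed
  have dom: "dom \<beta> = b ` V" by (auto simp: \<beta>_def dom_def)
  have "rooted_forest \<beta> {}"
    unfolding rooted_forest_def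
  proof (intro conjI allI ballI impI)
    show "dom \<beta> \<subseteq> \<Union>T"
    proof
      fix x assume "x \<in> dom \<beta>"
      then obtain v where "v \<in> V" "x = b v" unfolding dom by blast
      then show "x \<in> \<Union>T" using b[of v] B_T[of v] by auto
    qed
    show "ran \<beta> \<subseteq> V" using \<beta>D by (auto simp: ran_def)
    show "card {} + card V = card (dom \<beta>)" using dom inj by (simp add: card_image)
    show "\<exists>x\<in>B v. \<beta> x = Some v" if "v \<in> V" for v using \<beta>b[OF that] b[OF that] by blast
    show "u = v" if "\<beta> x = Some v" "u \<in> V" "x \<in> B u" for x u v
      using \<beta>D[OF that(1)] that(2,3) b[of v] B_disj[of u v x] by simp
    show "v \<in> e" if "\<beta> x = Some v" "e \<in> A" "x \<in> M e" for x e v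
      using \<beta>D[OF that(1)] that(2,3) b[of v] B_M[of v e x] by simp
  qed auto
  then show ?thesis by blast
qed

text \<open>The new vertex \<open>x\<close> is a leaf, so \<open>{x, y}\<close> is the only edge at
  \<open>x\<close> and cannot belong to an even set; acyclicity is thus inherited. The conditions on
  \<open>B\<close> and \<open>M\<close> keep the class of \<open>x\<close> compatible with the
  model.\<close>

lemma rooted_forest_extend:
  assumes rf: "rooted_forest \<beta> F" and x: "x \<in> \<Union>T" "\<beta> x = None"
    and y: "\<beta> y = Some v" and xy: "{x, y} \<in> skeleton T"
    and xB: "\<And>u. u \<in> V \<Longrightarrow> x \<in> B u \<Longrightarrow> u = v"
    and xM: "\<And>e. e \<in> A \<Longrightarrow> x \<in> M e \<Longrightarrow> v \<in> e"
  shows "rooted_forest (\<beta>(x \<mapsto> v)) (insert {x, y} F)" "{x, y} \<notin> F"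
proof -
  note r = rooted_forestD[OF rf]
  have finF: "finite F" using r(3) fin_skel by (rule finite_subset)
  have xF: "x \<notin> e" if "e \<in> F" for e
    using r(4)[OF that] x(2) by force
  then show new: "{x, y} \<notin> F" by blast
  have ne: "x \<noteq> y" using x y by auto
  show "rooted_forest (\<beta>(x \<mapsto> v)) (insert {x, y} F)"
    unfolding rooted_forest_def
  proof (intro conjI allI ballI impI)
    show "dom (\<beta>(x \<mapsto> v)) \<subseteq> \<Union>T" using r(1) x by simp
    show "ran (\<beta>(x \<mapsto> v)) \<subseteq> V" using r(2) x y by (auto simp: ranI)
    show "insert {x, y} F \<subseteq> skeleton T" using r(3) xy by blast
    show "\<exists>v'. \<forall>z\<in>e. (\<beta>(x \<mapsto> v)) z = Some v'" if "e \<in> insert {x, y} F" for e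
    proof (cases "e = {x, y}")
      case True then show ?thesis using y ne by auto
    next
      case False
      then have "e \<in> F" using that by blast
      then show ?thesis using r(4)[of e] xF[of e] by (metis fun_upd_other)
    qed
    have "x \<notin> dom \<beta>" using x by auto
    moreover have "finite (dom \<beta>)" using r(1) fin_verts by (rule finite_subset)
    ultimately show "card (insert {x, y} F) + card V = card (dom (\<beta>(x \<mapsto> v)))"
      using r(5) new finF by simp
    show "Z = {}" if Z: "Z \<subseteq> insert {x, y} F" "even_set Z" for Z
    proof (cases "{x, y} \<in> Z")
      case False then show ?thesis using r(6) Z by blast
    next
      case True
      then have "{e\<in>Z. x \<in> e} = {{x, y}}" using Z(1) xF by blast
      moreover have "even (card {e\<in>Z. x \<in> e})" using Z(2) by (simp add: even_set_def)
      ultimately show ?thesis by simp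
    qed
    show "\<exists>z\<in>B u. (\<beta>(x \<mapsto> v)) z = Some u" if "u \<in> V" for u
      using r(7)[OF that] x(2) by (metis fun_upd_other option.distinct(1))
    show "u = w" if "(\<beta>(x \<mapsto> v)) z = Some w" "u \<in> V" "z \<in> B u" for z u w
      using that xB r(8) by (cases "z = x") auto
    show "w \<in> e" if "(\<beta>(x \<mapsto> v)) z = Some w" "e \<in> A" "z \<in> M e" for z e w
      using that xM r(9) by (cases "z = x") auto
  qed
qed

text \<open>Take a forest with the most edges. Wherever a linked set is only partly covered, some
  edge leads from a covered to an uncovered vertex and the forest could grow. The order matters:
  branch sets are shown to be covered first, then the sets \<open>M e\<close>, then all of
  \<open>T\<close>.\<close>

lemma rooted_forest_maximal:
  "\<exists>\<beta> F. rooted_forest \<beta> F \<and> dom \<beta> = \<Union>T \<and>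
     (\<forall>e\<in>A. \<forall>v\<in>e. \<exists>x\<in>M e. \<beta> x = Some v)"
proof -
  define P where "P = (\<lambda>n. \<exists>\<beta> F. rooted_forest \<beta> F \<and> card F = n)"
  obtain \<beta>0 where "rooted_forest \<beta>0 {}" using rooted_forest_initial by blast
  then have P0: "P 0" unfolding P_def by (intro exI[of _ \<beta>0] exI[of _ "{}"]) simp
  have bnd: "n \<le> card (skeleton T)" if n: "P n" for n
  proof -
    obtain \<beta> F where F: "rooted_forest \<beta> F" "card F = n" using n unfolding P_def by blast
    then show ?thesis using card_mono[OF fin_skel rooted_forestD(3)[OF F(1)]] by simp
  qed
  obtain n where n: "P n" "\<And>m. P m \<Longrightarrow> m \<le> n"
    using GreatestI_nat[of P, OF P0 bnd] Greatest_le_nat[of P, OF _ bnd] that by simp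
  then obtain \<beta> F where rf: "rooted_forest \<beta> F" and cF: "card F = n" by (auto simp: P_def)
  have finF: "finite F" using rooted_forestD(3)[OF rf] fin_skel by (rule finite_subset)
  have stuck: False if "x \<in> \<Union>T" "\<beta> x = None" "\<beta> y = Some v" "{x, y} \<in> skeleton T"
    "\<And>u. u \<in> V \<Longrightarrow> x \<in> B u \<Longrightarrow> u = v" "\<And>e. e \<in> A \<Longrightarrow> x \<in> M e \<Longrightarrow> v \<in> e" for x y v
  proof -
    note ext = rooted_forest_extend[OF rf that]
    have "P (card (insert {x, y} F))" unfolding P_def using ext(1) by blast
    then show False using n(2) ext(2) finF cF by fastforce
  qed
  note r = rooted_forestD(1,2,7,8,9)[OF rf]
  have B_dom: "\<beta> x = Some v" if v: "v \<in> V" and x: "x \<in> B v" for x v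
  proof -
    define Y where "Y = {x\<in>B v. \<beta> x \<noteq> None}"
    have "Y = B v"
    proof (rule ccontr)
      assume "Y \<noteq> B v"
      moreover have "Y \<subseteq> B v" "Y \<noteq> {}" using r(3)[OF v] by (auto simp: Y_def)
      ultimately obtain x y where xy: "x \<in> B v - Y" "y \<in> Y" "{x, y} \<in> skeleton T"
        using linkedE[OF B_linked[OF v]] by metis
      obtain w where w: "\<beta> y = Some w" using xy(2) by (auto simp: Y_def)
      then have "v = w" using r(4) v xy(2) by (auto simp: Y_def)
      then have yv: "\<beta> y = Some v" using w by simp
      have xBv: "x \<in> B v" using xy(1) by simp
      show False
      proof (rule stuck[OF _ _ yv xy(3)])
        show "x \<in> \<Union>T" "\<beta> x = None" using xy(1) B_T[OF v] by (auto simp: Y_def)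
        show "u = v" if "u \<in> V" "x \<in> B u" for u using B_disj[OF that(1) v that(2) xBv] .
        show "v \<in> e" if "e \<in> A" "x \<in> M e" for e using B_M[OF v that(1) xBv that(2)] .
      qed
    qed
    then obtain w where "\<beta> x = Some w" using x by (auto simp: Y_def)
    then show ?thesis using r(4) v x by blast
  qed
  \<comment> \<open>Branch sets being covered, an uncovered vertex of \<open>M e\<close> lies in
    none of them and may join the class of its neighbour, which is an end of
    \<open>e\<close>.\<close>
  have M_dom: "\<beta> x \<noteq> None" if e: "e \<in> A" and x: "x \<in> M e" for x e
  proof -
    define Y where "Y = {x\<in>M e. \<beta> x \<noteq> None}"
    obtain v where v: "v \<in> e" using A2[OF e] by fastforce
    have "Y = M e"
    proof (rule ccontr)
      assume "Y \<noteq> M e"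
      moreover have "Y \<subseteq> M e" by (auto simp: Y_def)
      moreover have "v \<in> V" using A_V[OF e] v by blast
      then have "Y \<noteq> {}" using B_M_meet[OF e v] B_dom[of v] by (auto simp: Y_def)
      ultimately obtain x y where xy: "x \<in> M e - Y" "y \<in> Y" "{x, y} \<in> skeleton T"
        using linkedE[OF M_linked[OF e]] by metis
      obtain w where w: "\<beta> y = Some w" using xy(2) by (auto simp: Y_def)
      have we: "w \<in> e" using r(5)[OF w e] xy(2) by (auto simp: Y_def)
      show False
      proof (rule stuck[OF _ _ w xy(3)])
        show "x \<in> \<Union>T" "\<beta> x = None" using xy M_T[OF e] by (auto simp: Y_def)
        show "u = w" if "u \<in> V" "x \<in> B u" for u
          using B_dom[OF that] xy(1) by (auto simp: Y_def)
        show "w \<in> f" if "f \<in> A" "x \<in> M f" for f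
          using M_disj[OF e that(1) _ that(2)] xy(1) we by auto
      qed
    qed
    then show ?thesis using x by (auto simp: Y_def)
  qed
  \<comment> \<open>An uncovered vertex now lies in no \<open>B u\<close> and in no
    \<open>M e\<close>, so both compatibility conditions hold vacuously.\<close>
  have "dom \<beta> = \<Union>T"
  proof (rule ccontr)
    assume "dom \<beta> \<noteq> \<Union>T"
    moreover have "dom \<beta> \<noteq> {}" using V_ne r(3) by fastforce
    ultimately obtain x y where xy: "x \<in> \<Union>T - dom \<beta>" "y \<in> dom \<beta>" "{x, y} \<in> skeleton T"
      using linkedE[OF pseudosurface_linked[OF surf] r(1)] by metis
    obtain w where w: "\<beta> y = Some w" using xy by auto
    have xn: "\<beta> x = None" using xy(1) by auto
    show False
    proof (rule stuck[OF _ xn w xy(3)])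
      show "x \<in> \<Union>T" using xy(1) by simp
      show "u = w" if "u \<in> V" "x \<in> B u" for u using B_dom[OF that] xn by simp
      show "w \<in> e" if "e \<in> A" "x \<in> M e" for e using M_dom[OF that] xn by simp
    qed
  qed
  moreover have "\<exists>x\<in>M e. \<beta> x = Some v" if ev: "e \<in> A" "v \<in> e" for e v
  proof -
    obtain x where "x \<in> B v" "x \<in> M e" using B_M_meet[OF ev] by blast
    moreover have "v \<in> V" using A_V[OF ev(1)] ev(2) by blast
    ultimately show ?thesis using B_dom by blast
  qed
  ultimately show ?thesis using rf by (intro exI[of _ \<beta>] exI[of _ F]) simp
qed

lemma edge_bound: "int (card A) \<le> 3 * int (card V) + 3 - 3 * euler_char T"
proof -
  obtain \<beta> F where rf: "rooted_forest \<beta> F" and dom: "dom \<beta> = \<Union>T"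
    and hit: "\<And>e v. e \<in> A \<Longrightarrow> v \<in> e \<Longrightarrow> \<exists>x\<in>M e. \<beta> x = Some v"
    using rooted_forest_maximal by metis
  note r = rooted_forestD(3,4,5,6,9)[OF rf]
  have "A \<subseteq> Pow V" by (rule subsetI, rule PowI, rule A_V)
  then have finA: "finite A" by (rule finite_subset) (simp add: finV)
  have finF: "finite F" using r(1) fin_skel by (rule finite_subset)
  \<comment> \<open>Every vertex of \<open>M e\<close> is in the class of one of the two ends, and
    both classes occur, so linkedness gives an edge where the class changes.\<close>
  have "\<exists>d. d \<in> skeleton T \<and> d \<subseteq> M e \<and> (\<lambda>x. the (\<beta> x)) ` d = e" if e: "e \<in> A" for e
  proof -
    obtain u v where uv: "e = {u, v}" "u \<noteq> v" using A2[OF e] by (auto simp: card_2_iff)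
    define Y where "Y = {x\<in>M e. \<beta> x = Some u}"
    obtain a b where "a \<in> M e" "\<beta> a = Some u" "b \<in> M e" "\<beta> b = Some v"
      using hit[OF e, of u] hit[OF e, of v] uv by auto
    then have "a \<in> Y" "b \<in> M e - Y" using uv(2) by (simp_all add: Y_def)
    then have "Y \<subseteq> M e" "Y \<noteq> {}" "Y \<noteq> M e" by (auto simp: Y_def)
    then obtain x y where xy: "x \<in> M e - Y" "y \<in> Y" "{x, y} \<in> skeleton T"
      using linkedE[OF M_linked[OF e]] by metis
    have "x \<in> dom \<beta>" unfolding dom using M_T[OF e] xy(1) by (metis DiffD1 subsetD)
    then obtain w where w: "\<beta> x = Some w" by auto
    then have "w \<in> e" "w \<noteq> u" using r(5)[OF _ e] xy(1) by (simp_all add: Y_def)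
    then have "w = v" using uv by blast
    moreover have "\<beta> y = Some u" "y \<in> M e" "x \<in> M e" using xy(1,2) by (simp_all add: Y_def)
    ultimately show ?thesis using xy(3) w uv by (intro exI[of _ "{x, y}"]) auto
  qed
  then obtain h where h: "\<And>e. e \<in> A \<Longrightarrow> h e \<in> skeleton T" "\<And>e. e \<in> A \<Longrightarrow> h e \<subseteq> M e"
    "\<And>e. e \<in> A \<Longrightarrow> (\<lambda>x. the (\<beta> x)) ` h e = e"
    by metis
  have h2: "card (h e) = 2" if "e \<in> A" for e using h(1)[OF that] by (simp add: skeleton_def)
  have h_dom: "h e \<subseteq> dom \<beta>" if "e \<in> A" for e unfolding dom by (rule subset_trans[OF h(2)[OF that] M_T[OF that]])
  have inj: "inj_on h A"
    by (rule inj_onI) (metis h(3))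
  have hF: "h e \<notin> F" if e: "e \<in> A" for e
  proof
    assume "h e \<in> F"
    then obtain v where "\<forall>x\<in>h e. \<beta> x = Some v" using r(2) by blast
    then have "e \<subseteq> {v}" using h(3)[OF e] by auto
    then have "card e \<le> card {v}" by (intro card_mono) auto
    then show False using A2[OF e] by simp
  qed
  have class_card: "card {x\<in>h e. \<beta> x = Some v} = (if v \<in> e then 1 else 0)" if e: "e \<in> A" for e v
  proof -
    have inj': "inj_on (\<lambda>x. the (\<beta> x)) (h e)"
      using h2[OF e] A2[OF e] h(3)[OF e] by (intro eq_card_imp_inj_on) (auto intro: card_ge_0_finite)
    have im: "(\<lambda>x. the (\<beta> x)) ` {x\<in>h e. \<beta> x = Some v} = e \<inter> {v}"
    proof
      show "(\<lambda>x. the (\<beta> x)) ` {x\<in>h e. \<beta> x = Some v} \<subseteq> e \<inter> {v}"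
      proof
        fix z assume "z \<in> (\<lambda>x. the (\<beta> x)) ` {x\<in>h e. \<beta> x = Some v}"
        then obtain x where "x \<in> h e" "\<beta> x = Some v" "z = v" by auto
        moreover from this have "v \<in> (\<lambda>x. the (\<beta> x)) ` h e" by (metis image_eqI option.sel)
        ultimately show "z \<in> e \<inter> {v}" using h(3)[OF e] by simp
      qed
      show "e \<inter> {v} \<subseteq> (\<lambda>x. the (\<beta> x)) ` {x\<in>h e. \<beta> x = Some v}"
      proof
        fix z assume z: "z \<in> e \<inter> {v}"
        then obtain x where x: "x \<in> h e" "z = the (\<beta> x)" using h(3)[OF e] by blast
        then have "\<beta> x = Some v" using h_dom[OF e] z by force
        then show "z \<in> (\<lambda>x. the (\<beta> x)) ` {x\<in>h e. \<beta> x = Some v}" using x by blast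
      qed
    qed
    have "card {x\<in>h e. \<beta> x = Some v} = card (e \<inter> {v})"
      unfolding im[symmetric] by (rule card_image[symmetric]) (rule inj_on_subset[OF inj'], blast)
    also have "\<dots> = (if v \<in> e then 1 else 0)" by simp
    finally show ?thesis .
  qed
  define X where "X = F \<union> h ` A"
  have disj: "F \<inter> h ` A = {}" using hF by blast
  have X: "X \<subseteq> skeleton T" using r(1) h(1) by (auto simp: X_def)
  have cX: "card X = card F + card A"
    unfolding X_def using disj finF finA inj by (simp add: card_Un_disjoint card_image)
  have three: "3 \<le> card (Z \<inter> h ` A)" if Z: "Z \<subseteq> X" "even_set Z" "Z \<noteq> {}" for Z
  proof -
    have finZ: "finite Z" using Z(1) X fin_skel by (meson finite_subset)
    define A' where "A' = {e\<in>A. h e \<in> Z}"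
    have A'A: "A' \<subseteq> A" by (auto simp: A'_def)
    have finA': "finite A'" using A'A finA by (rule finite_subset)
    have ZA: "Z \<inter> h ` A = h ` A'" by (auto simp: A'_def)
    have injA': "inj_on h A'" using inj A'A by (rule inj_on_subset)
    \<comment> \<open>Sum the degrees in \<open>Z\<close> over the class of \<open>v\<close>. Each
      degree is even; a forest edge lies within one class and contributes 0 or 2, while
      \<open>h e\<close> contributes 1 exactly when \<open>v \<in> e\<close>.\<close>
    have par: "even (card {e\<in>A'. v \<in> e})" for v
    proof -
      define Cv where "Cv = {x. \<beta> x = Some v}"
      have finC: "finite Cv" by (rule finite_subset[OF _ fin_verts]) (use dom in \<open>auto simp: Cv_def\<close>)
      have "(\<Sum>d\<in>Z. card {x\<in>Cv. x \<in> d}) = (\<Sum>x\<in>Cv. card {d\<in>Z. x \<in> d})"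
        by (rule sum_multicount_gen) (use finC finZ in auto)
      moreover have "even (\<Sum>x\<in>Cv. card {d\<in>Z. x \<in> d})"
        using Z(2) by (intro dvd_sum) (simp add: even_set_def)
      ultimately have ev: "even (\<Sum>d\<in>Z. card {x\<in>Cv. x \<in> d})" by simp
      have Cd: "{x\<in>Cv. x \<in> d} = {x\<in>d. \<beta> x = Some v}" for d by (auto simp: Cv_def)
      have evF: "even (card {x\<in>Cv. x \<in> d})" if d: "d \<in> F" for d
      proof -
        obtain u where u: "\<forall>x\<in>d. \<beta> x = Some u" using r(2)[OF d] by blast
        have d2: "card d = 2" using r(1) d by (auto simp: skeleton_def)
        have "{x\<in>d. \<beta> x = Some v} = (if u = v then d else {})" using u by auto
        then show ?thesis unfolding Cd using d2 by simp
      qed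
      have split: "Z = (Z \<inter> F) \<union> h ` A'" using Z(1) ZA by (auto simp: X_def)
      have "(\<Sum>d\<in>Z. card {x\<in>Cv. x \<in> d})
          = (\<Sum>d\<in>Z \<inter> F. card {x\<in>Cv. x \<in> d}) + (\<Sum>d\<in>h ` A'. card {x\<in>Cv. x \<in> d})"
        by (subst split, rule sum.union_disjoint) (use finZ finA' disj A'A in auto)
      moreover have "even (\<Sum>d\<in>Z \<inter> F. card {x\<in>Cv. x \<in> d})"
        using evF by (intro dvd_sum) auto
      ultimately have "even (\<Sum>d\<in>h ` A'. card {x\<in>Cv. x \<in> d})" using ev by simp
      also have "(\<Sum>d\<in>h ` A'. card {x\<in>Cv. x \<in> d}) = (\<Sum>e\<in>A'. if v \<in> e then 1 else 0)"
        unfolding sum.reindex[OF injA'] Cd o_def by (intro sum.cong refl class_card) (use A'A in auto)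
      also have "\<dots> = card {e\<in>A'. v \<in> e}" using finA' by (simp add: sum.If_cases Int_def)
      finally show ?thesis .
    qed
    have "A' \<noteq> {}"
    proof
      assume "A' = {}"
      then have "Z \<subseteq> F" using Z(1) ZA by (auto simp: X_def)
      then show False using r(4) Z by blast
    qed
    then obtain e where e: "e \<in> A'" by blast
    obtain u v where uv: "e = {u, v}" "u \<noteq> v" using A2 A'A e by (metis card_2_iff subsetD)
    \<comment> \<open>Even degree forces a second edge at each end of \<open>e\<close>. The two
      cannot coincide, since they would then be parallel to \<open>e\<close> in a simple
      graph.\<close>
    have other: "\<exists>f\<in>A'. w \<in> f \<and> f \<noteq> e" if "w \<in> e" for w
    proof (rule ccontr)
      assume "\<not> ?thesis"
      then have "{f\<in>A'. w \<in> f} = {e}" using that e by blast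
      then show False using par[of w] by simp
    qed
    obtain f1 f2 where f: "f1 \<in> A'" "u \<in> f1" "f1 \<noteq> e" "f2 \<in> A'" "v \<in> f2" "f2 \<noteq> e"
      using other[of u] other[of v] uv by auto
    have "f1 \<noteq> f2"
    proof
      assume "f1 = f2"
      then have "e \<subseteq> f1" using f uv by blast
      moreover have "card f1 = 2" "card e = 2" using A2 A'A f e by blast+
      ultimately have "e = f1" by (metis card.infinite card_subset_eq zero_neq_numeral)
      then show False using f by simp
    qed
    then have "card {e, f1, f2} = 3" using f by simp
    moreover have "card {e, f1, f2} \<le> card A'" using finA' e f by (intro card_mono) auto
    ultimately show ?thesis unfolding ZA card_image[OF injA'] by simp
  qed
  have "3 * (int (card T) - int (card (skeleton T)) + int (card X)) \<le> 2 * int (card (h ` A)) + 3"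
    by (rule euler_count[OF surf X _ three]) (auto simp: X_def)
  moreover have "int (card X) = int (card (\<Union>T)) - int (card V) + int (card A)"
    using cX r(3) dom by simp
  moreover have "card (h ` A) = card A" using inj by (rule card_image)
  ultimately show ?thesis by (simp add: euler_char_def)
qed

end

section \<open>Barycentric subdivision\<close>

lemma pseudosurfaceI:
  assumes "finite T" "T \<noteq> {}" "\<And>t. t \<in> T \<Longrightarrow> card t = 3"
    "\<And>e. e \<in> skeleton T \<Longrightarrow> card {t\<in>T. e \<subseteq> t} = 2"
    "\<And>U. \<lbrakk>U \<subseteq> T; U \<noteq> {}; \<And>e t t'. \<lbrakk>e \<in> skeleton T; t \<in> T; t' \<in> T; e \<subseteq> t; e \<subseteq> t'; t \<in> U\<rbrakk> \<Longrightarrow> t' \<in> U\<rbrakk>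
      \<Longrightarrow> T \<subseteq> U"
  shows "pseudosurface T"
  unfolding pseudosurface_def
proof (intro conjI ballI allI impI)
  fix U assume U: "U \<subseteq> T" "U \<noteq> {}"
    "\<forall>e\<in>skeleton T. \<forall>t\<in>T. \<forall>t'\<in>T. e \<subseteq> t \<longrightarrow> e \<subseteq> t' \<longrightarrow> t \<in> U \<longrightarrow> t' \<in> U"
  have "T \<subseteq> U"
  proof (rule assms(5)[OF U(1,2)])
    fix e t t' assume a: "e \<in> skeleton T" "t \<in> T" "t' \<in> T" "e \<subseteq> t" "e \<subseteq> t'" "t \<in> U"
    have "\<forall>t\<in>T. \<forall>t'\<in>T. e \<subseteq> t \<longrightarrow> e \<subseteq> t' \<longrightarrow> t \<in> U \<longrightarrow> t' \<in> U" using U(3) a(1) by (rule bspec)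
    then have "\<forall>t'\<in>T. e \<subseteq> t \<longrightarrow> e \<subseteq> t' \<longrightarrow> t \<in> U \<longrightarrow> t' \<in> U" using a(2) by (rule bspec)
    then have "e \<subseteq> t \<longrightarrow> e \<subseteq> t' \<longrightarrow> t \<in> U \<longrightarrow> t' \<in> U" using a(3) by (rule bspec)
    then show "t' \<in> U" using a(4-6) by (elim impE)
  qed
  then show "U = T" using U(1) by (intro subset_antisym)
qed (fact assms(1-4))+

text \<open>\<open>skeleton\<close> repeats \<open>complex_edges\<close> for an arbitrary vertex
  type, because the vertices of a barycentric subdivision are sets.\<close>

lemma complex_edges_eq_skeleton: "complex_edges T = skeleton T"
  by (simp add: complex_edges_def skeleton_def)

lemma euler_characteristic_eq: "euler_characteristic T = euler_char T"
  by (simp add: euler_characteristic_def euler_char_def complex_edges_eq_skeleton)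

text \<open>Connectivity of the dual graph needs both connectivity conditions: walking along the
  link of a vertex passes between any two triangles of its star across edges, and connectivity of
  the vertices then leads from star to star.\<close>

lemma closed_surface_pseudosurface:
  assumes "closed_surface_complex T"
  shows "pseudosurface T"
proof (rule pseudosurfaceI)
  note c = assms[unfolded closed_surface_complex_def complex_edges_eq_skeleton]
  show "finite T" "T \<noteq> {}" "\<And>t. t \<in> T \<Longrightarrow> card t = 3"
    "\<And>e. e \<in> skeleton T \<Longrightarrow> card {t\<in>T. e \<subseteq> t} = 2"
    using c by auto
  have link: "(x, y) \<in> {(a, b). {v, a, b} \<in> T}\<^sup>*" if "{v, x} \<in> skeleton T" "{v, y} \<in> skeleton T" for v x y
    using c that by simp
  have "\<forall>x\<in>\<Union>T. \<forall>y\<in>\<Union>T. (x, y) \<in> {(a, b). {a, b} \<in> skeleton T}\<^sup>*"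
    using c by (elim conjE)
  then have conn: "(x, y) \<in> {(a, b). {a, b} \<in> skeleton T}\<^sup>*" if "x \<in> \<Union>T" "y \<in> \<Union>T" for x y
    using that by metis
  have c3: "card t = 3" if "t \<in> T" for t using c that by simp
  fix U assume U: "U \<subseteq> T" "U \<noteq> {}" and
    closed: "\<And>e t t'. \<lbrakk>e \<in> skeleton T; t \<in> T; t' \<in> T; e \<subseteq> t; e \<subseteq> t'; t \<in> U\<rbrakk> \<Longrightarrow> t' \<in> U"
  have edge: "{a, b} \<in> skeleton T" if "t \<in> T" "a \<in> t" "b \<in> t" "a \<noteq> b" for a b t
    using that by (auto simp: skeleton_def)
  have neighbour: "\<exists>x. x \<in> t \<and> x \<noteq> v" if "t \<in> T" for t v
  proof (rule ccontr)
    assume "\<not> ?thesis"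
    then have "t \<subseteq> {v}" by auto
    then have "card t \<le> card {v}" by (intro card_mono) auto
    then show False using c3[OF that] by simp
  qed
  have star: "t' \<in> U" if t: "t \<in> U" "v \<in> t" and t': "t' \<in> T" "v \<in> t'" for t t' v
  proof -
    have tT: "t \<in> T" using t U by blast
    obtain x where x: "x \<in> t" "x \<noteq> v" using neighbour[OF tT] by blast
    obtain y where y: "y \<in> t'" "y \<noteq> v" using neighbour[OF t'(1)] by blast
    have "{v, x} \<in> skeleton T" "{v, y} \<in> skeleton T"
      using edge[OF tT t(2) x(1)] edge[OF t'(1) t'(2) y(1)] x y by auto
    then have "(x, y) \<in> {(a, b). {v, a, b} \<in> T}\<^sup>*" by (rule link)
    \<comment> \<open>The invariant along the link walk concerns all triangles at the spoke
      \<open>{v, y}\<close>, so that the next triangle is included whichever side of the spoke it is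
      on.\<close>
    then have "\<forall>s\<in>T. {v, y} \<subseteq> s \<longrightarrow> s \<in> U"
    proof (induction rule: rtrancl_induct)
      case base
      show ?case
        using closed[of "{v, x}" t] edge[OF tT t(2) x(1)] x t tT by auto
    next
      case (step a b)
      then have ab: "{v, a, b} \<in> T" by simp
      then have U': "{v, a, b} \<in> U" using step.IH by auto
      have "v \<noteq> b" using c3[OF ab] by (auto simp: card_insert_if split: if_splits)
      then have "{v, b} \<in> skeleton T" using edge[OF ab, of v b] by simp
      then show ?case using closed[of "{v, b}" "{v, a, b}"] ab U' by auto
    qed
    then show "t' \<in> U" using t' y by simp
  qed
  obtain t0 where t0: "t0 \<in> U" using U(2) by blast
  then obtain x where x: "x \<in> t0" using neighbour U(1) by blast
  show "T \<subseteq> U"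
  proof
    fix t assume t: "t \<in> T"
    then obtain y where y: "y \<in> t" using neighbour by blast
    have "(x, y) \<in> {(a, b). {a, b} \<in> skeleton T}\<^sup>*"
      by (rule conn) (use x y t t0 U(1) in auto)
    then have "\<forall>s\<in>T. y \<in> s \<longrightarrow> s \<in> U"
    proof (induction rule: rtrancl_induct)
      case base
      show ?case using star[OF t0 x] by blast
    next
      case (step a b)
      then have "{a, b} \<in> skeleton T" by simp
      then obtain s where "s \<in> T" "a \<in> s" "b \<in> s" by (auto simp: skeleton_def)
      moreover from this have "s \<in> U" using step.IH by simp
      ultimately show ?case using star[of s b] by simp
    qed
    then show "t \<in> U" using t y by simp
  qed
qed

section \<open>Relabelling of vertices\<close>

lemma card_image_Collect:
  assumes "inj_on g A" "S = g ` A"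
  shows "card S = card A"
  using assms by (simp add: card_image)

lemma
  fixes f :: "'a \<Rightarrow> 'b"
  assumes T: "pseudosurface T" and f: "inj_on f (\<Union>T)"
  shows skeleton_image: "skeleton ((`) f ` T) = (`) f ` skeleton T"
    and pseudosurface_image: "pseudosurface ((`) f ` T)"
    and euler_char_image: "euler_char ((`) f ` T) = euler_char T"
proof -
  note D = pseudosurfaceD[OF T]
  have injP: "inj_on ((`) f) (Pow (\<Union>T))" using f by (rule inj_on_image_Pow)
  have cf: "card (f ` e) = card e" if "e \<subseteq> t" "t \<in> T" for e t
    by (rule card_image, rule inj_on_subset[OF f]) (use that in auto)
  have sub: "f ` e \<subseteq> f ` t \<longleftrightarrow> e \<subseteq> t" if "e \<subseteq> \<Union>T" "t \<in> T" for e t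
    using inj_on_image_subset_iff[OF f that(1), of t] that(2) by blast
  have skU: "e \<subseteq> \<Union>T" if "e \<in> skeleton T" for e using that by (auto simp: skeleton_def)
  show sk: "skeleton ((`) f ` T) = (`) f ` skeleton T"
  proof
    show "skeleton ((`) f ` T) \<subseteq> (`) f ` skeleton T"
    proof
      fix e assume "e \<in> skeleton ((`) f ` T)"
      then obtain t where t: "card e = 2" "t \<in> T" "e \<subseteq> f ` t" by (auto simp: skeleton_def)
      then obtain d where d: "d \<subseteq> t" "e = f ` d" by (auto simp: subset_image_iff)
      then have "d \<in> skeleton T" using t cf[OF d(1)] by (auto simp: skeleton_def)
      then show "e \<in> (`) f ` skeleton T" using d by blast
    qed
    show "(`) f ` skeleton T \<subseteq> skeleton ((`) f ` T)"
    proof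
      fix e assume "e \<in> (`) f ` skeleton T"
      then obtain d t where d: "e = f ` d" "card d = 2" "d \<subseteq> t" "t \<in> T" by (auto simp: skeleton_def)
      then have "card e = 2" "e \<subseteq> f ` t" using cf[OF d(3,4)] by auto
      then show "e \<in> skeleton ((`) f ` T)" using d(4) by (auto simp: skeleton_def)
    qed
  qed
  have injT: "inj_on ((`) f) T" by (rule inj_on_subset[OF injP]) auto
  have injS: "inj_on ((`) f) (skeleton T)" by (rule inj_on_subset[OF injP]) (use skU in auto)
  show "pseudosurface ((`) f ` T)"
  proof (rule pseudosurfaceI)
    show "finite ((`) f ` T)" "(`) f ` T \<noteq> {}" using D(1,2) by auto
    show "card t = 3" if "t \<in> (`) f ` T" for t using that cf[OF subset_refl] D(3) by auto
    show "card {t \<in> (`) f ` T. e \<subseteq> t} = 2" if "e \<in> skeleton ((`) f ` T)" for e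
    proof -
      obtain d where d: "d \<in> skeleton T" "e = f ` d" using \<open>e \<in> _\<close> unfolding sk by blast
      have "{t \<in> (`) f ` T. e \<subseteq> t} = (`) f ` {t\<in>T. d \<subseteq> t}"
        unfolding d(2) using sub[OF skU[OF d(1)]] by auto
      then have "card {t \<in> (`) f ` T. e \<subseteq> t} = card {t\<in>T. d \<subseteq> t}"
        by (rule card_image_Collect[rotated]) (rule inj_on_subset[OF injT], blast)
      then show ?thesis using D(5)[OF d(1)] by simp
    qed
    fix U assume U: "U \<subseteq> (`) f ` T" "U \<noteq> {}" and closed: "\<And>e t t'. \<lbrakk>e \<in> skeleton ((`) f ` T);
      t \<in> (`) f ` T; t' \<in> (`) f ` T; e \<subseteq> t; e \<subseteq> t'; t \<in> U\<rbrakk> \<Longrightarrow> t' \<in> U"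
    define U0 where "U0 = {t\<in>T. f ` t \<in> U}"
    have "U0 = T"
    proof (rule pseudosurface_connected[OF T])
      show "U0 \<subseteq> T" "U0 \<noteq> {}" using U by (auto simp: U0_def)
      fix e t t' assume e: "e \<in> skeleton T" "t \<in> T" "t' \<in> T" "e \<subseteq> t" "e \<subseteq> t'" "t \<in> U0"
      have "f ` t' \<in> U"
      proof (rule closed[of "f ` e" "f ` t"])
        show "f ` e \<in> skeleton ((`) f ` T)" unfolding sk using e(1) by simp
        show "f ` t \<in> U" using e(6) by (simp add: U0_def)
      qed (use e in \<open>auto intro: image_mono\<close>)
      then show "t' \<in> U0" using e(3) by (simp add: U0_def)
    qed
    then show "(`) f ` T \<subseteq> U" by (auto simp: U0_def)
  qed
  have "\<Union>((`) f ` T) = f ` \<Union>T" by blast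
  then show "euler_char ((`) f ` T) = euler_char T"
    unfolding euler_char_def sk using card_image[OF f] card_image[OF injT] card_image[OF injS] by simp
qed

text \<open>A full flag of vertex, edge and triangle. The barycentre of a face is represented by the
  face itself, so cardinalities 1, 2 and 3 tell the kinds of new vertices apart.\<close>

definition flag_triangle :: "'a \<Rightarrow> 'a \<Rightarrow> 'a set \<Rightarrow> 'a set set" where
  "flag_triangle a b t = {{a}, {a, b}, t}"

definition barycentric :: "'a set set \<Rightarrow> 'a set set set" where
  "barycentric T = {flag_triangle a b t |a b t. t \<in> T \<and> a \<in> t \<and> b \<in> t \<and> a \<noteq> b}"

lemma flag_triangle_mem:
  assumes "a \<noteq> b" "card t = 3"
  shows "{x} \<in> flag_triangle a b t \<longleftrightarrow> x = a"
    and "card e = 2 \<Longrightarrow> e \<in> flag_triangle a b t \<longleftrightarrow> e = {a, b}"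
    and "card u = 3 \<Longrightarrow> u \<in> flag_triangle a b t \<longleftrightarrow> u = t"
    and "card (flag_triangle a b t) = 3"
proof -
  have ne: "{a} \<noteq> {a, b}" "{a} \<noteq> t" "{a, b} \<noteq> t" using assms by auto
  show "{x} \<in> flag_triangle a b t \<longleftrightarrow> x = a" using assms by (auto simp: flag_triangle_def)
  show "e \<in> flag_triangle a b t \<longleftrightarrow> e = {a, b}" if "card e = 2"
    using assms that by (auto simp: flag_triangle_def)
  show "u \<in> flag_triangle a b t \<longleftrightarrow> u = t" if "card u = 3"
    using assms that by (auto simp: flag_triangle_def)
  show "card (flag_triangle a b t) = 3" using ne by (simp add: flag_triangle_def)
qed

lemma flag_triangle_inject:
  assumes "a \<noteq> b" "card t = 3" "a' \<noteq> b'" "card t' = 3" "flag_triangle a b t = flag_triangle a' b' t'"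
  shows "a = a' \<and> b = b' \<and> t = t'"
proof -
  have "{a} \<in> flag_triangle a' b' t'" "{a, b} \<in> flag_triangle a' b' t'" "t \<in> flag_triangle a' b' t'"
    unfolding assms(5)[symmetric] by (simp_all add: flag_triangle_def)
  moreover have "card {a, b} = 2" using assms(1) by simp
  ultimately have "a = a'" "{a, b} = {a', b'}" "t = t'"
    using flag_triangle_mem[OF assms(3,4)] assms(2) by metis+
  then show ?thesis using assms(1,3) by (auto simp: doubleton_eq_iff)
qed

lemma barycentricE:
  assumes "s \<in> barycentric T"
  obtains a b t where "s = flag_triangle a b t" "t \<in> T" "a \<in> t" "b \<in> t" "a \<noteq> b"
  using assms unfolding barycentric_def by blast

lemma barycentric_Union:
  assumes T: "pseudosurface T"
  shows "\<Union>(barycentric T) = (\<lambda>a. {a}) ` \<Union>T \<union> skeleton T \<union> T"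
proof
  show "\<Union>(barycentric T) \<subseteq> (\<lambda>a. {a}) ` \<Union>T \<union> skeleton T \<union> T"
    by (auto simp: barycentric_def flag_triangle_def skeleton_def)
  have other: "\<exists>a b. a \<in> t \<and> b \<in> t \<and> a \<noteq> b \<and> (x \<in> t \<longrightarrow> a = x)" if "t \<in> T" for t x
  proof -
    have "card t = 3" by (rule pseudosurfaceD(3)[OF T that])
    then obtain p q r where "t = {p, q, r}" "p \<noteq> q" "p \<noteq> r" "q \<noteq> r" by (auto simp: card_3_iff)
    then show ?thesis by auto
  qed
  have "{x} \<in> \<Union>(barycentric T)" if tx: "t \<in> T" "x \<in> t" for t x
  proof -
    obtain a b where ab: "a \<in> t" "b \<in> t" "a \<noteq> b" "x \<in> t \<longrightarrow> a = x" using other[OF tx(1)] by metis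
    have "flag_triangle x b t \<in> barycentric T" using ab tx by (auto simp: barycentric_def)
    then show ?thesis by (rule UnionI) (simp add: flag_triangle_def)
  qed
  moreover have "e \<in> \<Union>(barycentric T)" if "e \<in> skeleton T" for e
  proof -
    obtain a b t where e: "e = {a, b}" "a \<noteq> b" "t \<in> T" "e \<subseteq> t"
      using \<open>e \<in> _\<close> by (auto simp: skeleton_def card_2_iff)
    then have "flag_triangle a b t \<in> barycentric T" by (auto simp: barycentric_def)
    then show ?thesis by (rule UnionI) (simp add: flag_triangle_def e)
  qed
  moreover have "t \<in> \<Union>(barycentric T)" if t: "t \<in> T" for t
  proof -
    obtain a b where ab: "a \<in> t" "b \<in> t" "a \<noteq> b" using other[OF t] by metis
    have "flag_triangle a b t \<in> barycentric T" using ab t by (auto simp: barycentric_def)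
    then show ?thesis by (rule UnionI) (simp add: flag_triangle_def)
  qed
  ultimately show "(\<lambda>a. {a}) ` \<Union>T \<union> skeleton T \<union> T \<subseteq> \<Union>(barycentric T)" by auto
qed

lemma card_barycentric:
  assumes T: "pseudosurface T"
  shows "card (barycentric T) = 6 * card T"
proof -
  note D = pseudosurfaceD[OF T]
  define P where "P = Sigma T (\<lambda>t. Sigma t (\<lambda>a. t - {a}))"
  have "barycentric T = (\<lambda>(t, a, b). flag_triangle a b t) ` P"
    by (force simp: barycentric_def P_def image_iff)
  moreover have "inj_on (\<lambda>(t, a, b). flag_triangle a b t) P"
  proof (rule inj_onI)
    fix p p' assume p: "p \<in> P" "p' \<in> P"
      "(\<lambda>(t, a, b). flag_triangle a b t) p = (\<lambda>(t, a, b). flag_triangle a b t) p'"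
    obtain t a b t' a' b' where "p = (t, a, b)" "p' = (t', a', b')" by (cases p, cases p')
    then show "p = p'"
      using p flag_triangle_inject[of a b t a' b' t'] D(3) by (auto simp: P_def)
  qed
  ultimately have "card (barycentric T) = card P" by (simp add: card_image)
  also have "\<dots> = (\<Sum>t\<in>T. card (Sigma t (\<lambda>a. t - {a})))"
    unfolding P_def using D(1,4) by (intro card_SigmaI) auto
  also have "\<dots> = (\<Sum>t\<in>T. 6)"
  proof (rule sum.cong[OF refl])
    fix t assume t: "t \<in> T"
    have "card (Sigma t (\<lambda>a. t - {a})) = (\<Sum>a\<in>t. card (t - {a}))"
      using D(4)[OF t] by (intro card_SigmaI) auto
    also have "\<dots> = (\<Sum>a\<in>t. 2)"
      using D(3)[OF t] D(4)[OF t] by (intro sum.cong refl) simp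
    finally show "card (Sigma t (\<lambda>a. t - {a})) = 6" using D(3)[OF t] by simp
  qed
  finally show ?thesis by simp
qed

lemma skeleton_barycentricE:
  assumes T: "pseudosurface T" and e: "e \<in> skeleton (barycentric T)"
  obtains (vertex_edge) a b t where "e = {{a}, {a, b}}" "t \<in> T" "a \<in> t" "b \<in> t" "a \<noteq> b"
    | (vertex_triangle) a b t where "e = {{a}, t}" "t \<in> T" "a \<in> t" "b \<in> t" "a \<noteq> b"
    | (edge_triangle) a b t where "e = {{a, b}, t}" "t \<in> T" "a \<in> t" "b \<in> t" "a \<noteq> b"
proof -
  obtain a b t where s: "t \<in> T" "a \<in> t" "b \<in> t" "a \<noteq> b" "e \<subseteq> {{a}, {a, b}, t}"
    using e by (auto simp: skeleton_def barycentric_def flag_triangle_def)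
  obtain x y where xy: "e = {x, y}" "x \<noteq> y" using e by (auto simp: skeleton_def card_2_iff)
  have two_of_three: "{x, y} = {p, q} \<or> {x, y} = {p, r} \<or> {x, y} = {q, r}"
    if "x \<in> {p, q, r}" "y \<in> {p, q, r}" "x \<noteq> y" for p q r
    using that unfolding insert_iff empty_iff by (elim disjE) (simp_all add: insert_commute)
  have "e = {{a}, {a, b}} \<or> e = {{a}, t} \<or> e = {{a, b}, t}"
    unfolding xy(1) by (rule two_of_three) (use s(5) xy in simp_all)
  then show thesis using that s(1-4) by blast
qed

text \<open>An edge of the subdivision is a flag with one member missing, and each kind can be
  completed in two ways: by the two triangles at an edge, the two edges of a triangle at a vertex,
  or the two ends of an edge. Changing one member at a time connects the six flags of a triangle
  (\<open>swap\<close>, \<open>turn\<close>) and leads to adjacent triangles (\<open>cross\<close>),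
  so connectivity descends from \<open>T\<close>.\<close>

lemma pseudosurface_barycentric:
  assumes T: "pseudosurface T"
  shows "pseudosurface (barycentric T)"
proof (rule pseudosurfaceI)
  note D = pseudosurfaceD[OF T]
  have mem: "flag_triangle a b t \<in> barycentric T" if "t \<in> T" "a \<in> t" "b \<in> t" "a \<noteq> b" for a b t
    using that by (auto simp: barycentric_def)
  show "finite (barycentric T)"
    using card_barycentric[OF T] D(1,2) by (intro card_ge_0_finite) (simp add: card_gt_0_iff)
  show "barycentric T \<noteq> {}"
    using card_barycentric[OF T] D(1,2) by auto
  show "card s = 3" if "s \<in> barycentric T" for s
    using that flag_triangle_mem(4) D(3) by (metis barycentricE)
  show "card {s \<in> barycentric T. e \<subseteq> s} = 2" if e: "e \<in> skeleton (barycentric T)" for e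
    using T e
  proof (cases rule: skeleton_barycentricE)
    case (vertex_edge a b t)
    have "{s \<in> barycentric T. e \<subseteq> s} = flag_triangle a b ` {t\<in>T. {a, b} \<subseteq> t}"
    proof
      show "{s \<in> barycentric T. e \<subseteq> s} \<subseteq> flag_triangle a b ` {t\<in>T. {a, b} \<subseteq> t}"
      proof
        fix s assume s: "s \<in> {s \<in> barycentric T. e \<subseteq> s}"
        then have "s \<in> barycentric T" by simp
        then obtain a' b' t' where s': "s = flag_triangle a' b' t'" "t' \<in> T" "a' \<in> t'" "b' \<in> t'" "a' \<noteq> b'"
          by (rule barycentricE)
        have "{a} \<in> s" "{a, b} \<in> s" using s vertex_edge by auto
        then have "a = a'" "{a, b} = {a', b'}"
          using flag_triangle_mem(1,2)[OF s'(5) D(3)[OF s'(2)]] s'(1) vertex_edge(5) by auto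
        then have "a = a'" "b = b'" by (auto simp: doubleton_eq_iff)
        then show "s \<in> flag_triangle a b ` {t\<in>T. {a, b} \<subseteq> t}" using s' by auto
      qed
      show "flag_triangle a b ` {t\<in>T. {a, b} \<subseteq> t} \<subseteq> {s \<in> barycentric T. e \<subseteq> s}"
        using vertex_edge mem by (auto simp: flag_triangle_def)
    qed
    moreover have "inj_on (flag_triangle a b) {t\<in>T. {a, b} \<subseteq> t}"
    proof (rule inj_onI)
      fix t1 t2 assume "t1 \<in> {t\<in>T. {a, b} \<subseteq> t}" "t2 \<in> {t\<in>T. {a, b} \<subseteq> t}"
        "flag_triangle a b t1 = flag_triangle a b t2"
      then show "t1 = t2"
        using flag_triangle_inject[OF vertex_edge(5) D(3) vertex_edge(5) D(3), of t1 t2] by simp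
    qed
    ultimately have "card {s \<in> barycentric T. e \<subseteq> s} = card {t\<in>T. {a, b} \<subseteq> t}"
      by (simp add: card_image)
    then show ?thesis using D(5)[of "{a, b}"] vertex_edge by (auto simp: skeleton_def)
  next
    case (vertex_triangle a b t)
    have "{s \<in> barycentric T. e \<subseteq> s} = (\<lambda>c. flag_triangle a c t) ` (t - {a})"
    proof
      show "{s \<in> barycentric T. e \<subseteq> s} \<subseteq> (\<lambda>c. flag_triangle a c t) ` (t - {a})"
      proof
        fix s assume s: "s \<in> {s \<in> barycentric T. e \<subseteq> s}"
        then have "s \<in> barycentric T" by simp
        then obtain a' b' t' where s': "s = flag_triangle a' b' t'" "t' \<in> T" "a' \<in> t'" "b' \<in> t'" "a' \<noteq> b'"
          by (rule barycentricE)
        have "{a} \<in> s" "t \<in> s" using s vertex_triangle by auto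
        then have "a = a'" "t = t'"
          using flag_triangle_mem(1,3)[OF s'(5) D(3)[OF s'(2)]] s'(1) D(3)[OF vertex_triangle(2)] by auto
        then show "s \<in> (\<lambda>c. flag_triangle a c t) ` (t - {a})" using s' by auto
      qed
      show "(\<lambda>c. flag_triangle a c t) ` (t - {a}) \<subseteq> {s \<in> barycentric T. e \<subseteq> s}"
        using vertex_triangle mem by (auto simp: flag_triangle_def)
    qed
    moreover have "inj_on (\<lambda>c. flag_triangle a c t) (t - {a})"
    proof (rule inj_onI)
      fix c d assume "c \<in> t - {a}" "d \<in> t - {a}" "flag_triangle a c t = flag_triangle a d t"
      then show "c = d"
        using flag_triangle_inject[of a c t a d t] D(3)[OF vertex_triangle(2)] by auto
    qed
    ultimately have "card {s \<in> barycentric T. e \<subseteq> s} = card (t - {a})"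
      by (simp add: card_image)
    then show ?thesis using D(3,4)[OF vertex_triangle(2)] vertex_triangle by simp
  next
    case (edge_triangle a b t)
    have "{s \<in> barycentric T. e \<subseteq> s} = {flag_triangle a b t, flag_triangle b a t}"
    proof
      show "{s \<in> barycentric T. e \<subseteq> s} \<subseteq> {flag_triangle a b t, flag_triangle b a t}"
      proof
        fix s assume s: "s \<in> {s \<in> barycentric T. e \<subseteq> s}"
        then have "s \<in> barycentric T" by simp
        then obtain a' b' t' where s': "s = flag_triangle a' b' t'" "t' \<in> T" "a' \<in> t'" "b' \<in> t'" "a' \<noteq> b'"
          by (rule barycentricE)
        have "{a, b} \<in> s" "t \<in> s" using s edge_triangle by auto
        then have "{a, b} = {a', b'}" "t = t'"
          using flag_triangle_mem(2,3)[OF s'(5) D(3)[OF s'(2)]] s'(1) D(3)[OF edge_triangle(2)]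
            edge_triangle(5) by auto
        then show "s \<in> {flag_triangle a b t, flag_triangle b a t}"
          using s'(1) by (auto simp: doubleton_eq_iff)
      qed
      show "{flag_triangle a b t, flag_triangle b a t} \<subseteq> {s \<in> barycentric T. e \<subseteq> s}"
        using edge_triangle mem[of t a b] mem[of t b a] by (auto simp: flag_triangle_def insert_commute)
    qed
    moreover have "flag_triangle a b t \<noteq> flag_triangle b a t"
      using flag_triangle_inject[of a b t b a t] edge_triangle(2,5) D(3) by metis
    ultimately show ?thesis by simp
  qed
  fix U assume U: "U \<subseteq> barycentric T" "U \<noteq> {}" and closed: "\<And>e s s'. \<lbrakk>e \<in> skeleton (barycentric T);
    s \<in> barycentric T; s' \<in> barycentric T; e \<subseteq> s; e \<subseteq> s'; s \<in> U\<rbrakk> \<Longrightarrow> s' \<in> U"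
  have step: "s' \<in> U" if "s \<in> U" "s' \<in> barycentric T" "x \<in> s" "y \<in> s" "x \<in> s'" "y \<in> s'" "x \<noteq> y" for s s' x y
    by (rule closed[of "{x, y}" s]) (use that U(1) in \<open>auto simp: skeleton_def\<close>)
  have swap: "flag_triangle b a t \<in> U" if "flag_triangle a b t \<in> U" "t \<in> T" "a \<in> t" "b \<in> t" "a \<noteq> b" for a b t
  proof (rule step[OF that(1), of _ "{a, b}" t])
    show "{a, b} \<noteq> t" using that(5) D(3)[OF that(2)] by auto
  qed (use that mem[of t b a] in \<open>auto simp: flag_triangle_def insert_commute\<close>)
  have turn: "flag_triangle a c t \<in> U"
    if "flag_triangle a b t \<in> U" "t \<in> T" "a \<in> t" "c \<in> t" "a \<noteq> c" for a b c t
  proof (rule step[OF that(1), of _ "{a}" t])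
    show "{a} \<noteq> t" using D(3)[OF that(2)] by auto
  qed (use that mem in \<open>auto simp: flag_triangle_def\<close>)
  have cross: "flag_triangle a b t' \<in> U"
    if "flag_triangle a b t \<in> U" "t' \<in> T" "a \<in> t'" "b \<in> t'" "a \<noteq> b" for a b t t'
    by (rule step[OF that(1), of _ "{a}" "{a, b}"]) (use that mem in \<open>auto simp: flag_triangle_def\<close>)
  have whole: "flag_triangle x y t \<in> U"
    if "flag_triangle a b t \<in> U" "t \<in> T" "a \<in> t" "x \<in> t" "y \<in> t" "x \<noteq> y" for a b x y t
  proof (cases "x = a")
    case True
    then show ?thesis using turn that by simp
  next
    case False
    then have "flag_triangle a x t \<in> U" using turn[OF that(1-4)] by simp
    then have "flag_triangle x a t \<in> U" using swap that False by simp
    then show ?thesis using turn that by simp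
  qed
  define U0 where "U0 = {t\<in>T. \<exists>a\<in>t. \<exists>b. flag_triangle a b t \<in> U}"
  have "U0 = T"
  proof (rule pseudosurface_connected[OF T])
    show "U0 \<subseteq> T" by (auto simp: U0_def)
    obtain s where "s \<in> U" using U(2) by blast
    moreover from this obtain a b t where "s = flag_triangle a b t" "t \<in> T" "a \<in> t"
      using U(1) by (meson barycentricE subsetD)
    ultimately have "t \<in> U0" by (auto simp: U0_def)
    then show "U0 \<noteq> {}" by blast
    fix e t t' assume e: "e \<in> skeleton T" "t \<in> T" "t' \<in> T" "e \<subseteq> t" "e \<subseteq> t'" "t \<in> U0"
    obtain x y where xy: "e = {x, y}" "x \<noteq> y" using e(1) by (auto simp: skeleton_def card_2_iff)
    obtain a b where "a \<in> t" "flag_triangle a b t \<in> U" using e(6) by (auto simp: U0_def)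
    then have "flag_triangle x y t \<in> U" using whole e(2,4) xy by simp
    then have "flag_triangle x y t' \<in> U" using cross e(3,5) xy by simp
    then show "t' \<in> U0" using e(3,5) xy by (auto simp: U0_def)
  qed
  show "barycentric T \<subseteq> U"
  proof
    fix s assume "s \<in> barycentric T"
    then obtain a b t where s: "s = flag_triangle a b t" "t \<in> T" "a \<in> t" "b \<in> t" "a \<noteq> b"
      by (rule barycentricE)
    then have "t \<in> U0" using \<open>U0 = T\<close> by simp
    then obtain x y where "x \<in> t" "flag_triangle x y t \<in> U" by (auto simp: U0_def)
    then show "s \<in> U" using whole s by simp
  qed
qed

text \<open>With V, E, F for \<open>T\<close>, the subdivision has V + E + F vertices, 9 F edges and
  6 F triangles; V + E + F - 9 F + 6 F equals V - E + F because 2 E = 3 F.\<close>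

lemma euler_char_barycentric:
  assumes T: "pseudosurface T"
  shows "euler_char (barycentric T) = euler_char T"
proof -
  note D = pseudosurfaceD[OF T]
  have "card ((\<lambda>a. {a}) ` \<Union>T \<union> skeleton T \<union> T) = card (\<Union>T) + card (skeleton T) + card T"
  proof -
    have d1: "((\<lambda>a. {a}) ` \<Union>T \<union> skeleton T) \<inter> T = {}"
      using D(3) by (fastforce simp: skeleton_def)
    have d2: "(\<lambda>a. {a}) ` \<Union>T \<inter> skeleton T = {}"
      by (auto simp: skeleton_def)
    have "card ((\<lambda>a. {a}) ` \<Union>T) = card (\<Union>T)" by (intro card_image inj_onI) simp
    then show ?thesis
      using D(1,6,7) d1 d2 by (simp only: card_Un_disjoint finite_UnI finite_imageI)
  qed
  then have "card (\<Union>(barycentric T)) = card (\<Union>T) + card (skeleton T) + card T"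
    by (simp only: barycentric_Union[OF T])
  moreover have "2 * card (skeleton (barycentric T)) = 3 * card (barycentric T)"
    by (rule skeleton_card_eq[OF pseudosurface_barycentric[OF T]])
  moreover note card_barycentric[OF T] skeleton_card_eq[OF T]
  ultimately show ?thesis unfolding euler_char_def by linarith
qed

text \<open>\<open>f x\<close> are barycentric coordinates of \<open>x\<close> with respect to \<open>T\<close>, with the vertex \<open>w\<close> placed at
  \<open>P w\<close>, and \<open>m\<close> bounds the mesh. Only this continuous map into the realization of \<open>T\<close> is needed,
  not its inverse.\<close>

definition coordinates :: "(nat \<Rightarrow> real) set \<Rightarrow> 'w set set \<Rightarrow> ((nat \<Rightarrow> real) \<Rightarrow> 'w \<Rightarrow> real) \<Rightarrow>
    ('w \<Rightarrow> nat \<Rightarrow> real) \<Rightarrow> real \<Rightarrow> bool" where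
  "coordinates X T f P m \<longleftrightarrow>
     (\<forall>w. continuous_on X (\<lambda>x. f x w)) \<and>
     (\<forall>x\<in>X. (\<forall>w. 0 \<le> f x w) \<and> (\<exists>t\<in>T. (\<forall>w. w \<notin> t \<longrightarrow> f x w = 0) \<and> (\<Sum>w\<in>t. f x w) = 1 \<and>
        (\<forall>i. x i = (\<Sum>w\<in>t. f x w * P w i)))) \<and>
     (\<forall>t\<in>T. \<forall>a\<in>t. \<forall>b\<in>t. \<forall>i. \<bar>P a i - P b i\<bar> \<le> m)"

lemma coordinatesD:
  assumes "coordinates X T f P m"
  shows "\<And>w. continuous_on X (\<lambda>x. f x w)"
    "\<And>x w. x \<in> X \<Longrightarrow> 0 \<le> f x w"
    "\<And>t a b i. t \<in> T \<Longrightarrow> a \<in> t \<Longrightarrow> b \<in> t \<Longrightarrow> \<bar>P a i - P b i\<bar> \<le> m"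
proof -
  note c1 = assms[unfolded coordinates_def]
  note c2 = c1[THEN conjunct2]
  show "continuous_on X (\<lambda>x. f x w)" for w using c1[THEN conjunct1] by (rule spec)
  show "0 \<le> f x w" if "x \<in> X" for x w using c2[THEN conjunct1] that by simp
  show "\<bar>P a i - P b i\<bar> \<le> m" if "t \<in> T" "a \<in> t" "b \<in> t" for t a b i
    using c2[THEN conjunct2] that by simp
qed

lemma coordinatesE:
  assumes "coordinates X T f P m" "x \<in> X"
  obtains t where "t \<in> T" "\<forall>w. w \<notin> t \<longrightarrow> f x w = 0" "(\<Sum>w\<in>t. f x w) = 1"
    "\<forall>i. x i = (\<Sum>w\<in>t. f x w * P w i)"
proof -
  have "\<exists>t\<in>T. (\<forall>w. w \<notin> t \<longrightarrow> f x w = 0) \<and> (\<Sum>w\<in>t. f x w) = 1 \<and>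
        (\<forall>i. x i = (\<Sum>w\<in>t. f x w * P w i))"
    using assms(1)[unfolded coordinates_def, THEN conjunct2, THEN conjunct1] assms(2) by simp
  then show thesis by (elim bexE conjE) (rule that)
qed

lemma continuous_on_Min_image:
  fixes f :: "'x::topological_space \<Rightarrow> 'w \<Rightarrow> real"
  assumes "finite A" "A \<noteq> {}" "\<And>w. continuous_on X (\<lambda>x. f x w)"
  shows "continuous_on X (\<lambda>x. Min (f x ` A))"
  using assms(1,2)
proof (induction A rule: finite_ne_induct)
  case (singleton a)
  then show ?case using assms(3) by simp
next
  case (insert a A)
  then show ?case using assms(3) by (simp add: continuous_on_min)
qed

lemma continuous_on_Max_image:
  fixes f :: "'x::topological_space \<Rightarrow> 'w \<Rightarrow> real"
  assumes "finite A" "\<And>w. continuous_on X (\<lambda>x. f x w)"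
  shows "continuous_on X (\<lambda>x. Max (insert 0 (f x ` A)))"
  using assms(1)
proof (induction A)
  case empty
  then show ?case by simp
next
  case (insert a A)
  have "Max (insert 0 (f x ` insert a A)) = max (f x a) (Max (insert 0 (f x ` A)))" for x
    using insert.hyps(1) by (subst image_insert, subst insert_commute, subst Max_insert) auto
  then show ?case using assms(2) insert.IH by (simp add: continuous_on_max)
qed

text \<open>The coordinate of the barycentre of \<open>\<sigma>\<close> in the subdivision, read off from the coordinates \<open>g\<close>
  of the original complex.\<close>

definition bary_coord :: "'w set set \<Rightarrow> ('w \<Rightarrow> real) \<Rightarrow> 'w set \<Rightarrow> real" where
  "bary_coord T g \<sigma> = (if \<sigma> \<noteq> {} \<and> (\<exists>t\<in>T. \<sigma> \<subseteq> t)
     then real (card \<sigma>) * max 0 (Min (g ` \<sigma>) - Max (insert 0 (g ` (\<Union>T - \<sigma>)))) else 0)"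

lemma bary_coord_nonneg: "0 \<le> bary_coord T g \<sigma>"
  by (simp add: bary_coord_def)

text \<open>The coordinate is positive only if every vertex of the face strictly exceeds 0 and every
  coordinate outside the face; one vertex failing this makes the truncated gap vanish.\<close>

lemma bary_coord_eq_0:
  assumes T: "pseudosurface T" and "i \<in> \<sigma>" "g i \<le> 0 \<or> (\<exists>j\<in>\<Union>T - \<sigma>. g i \<le> g j)"
  shows "bary_coord T g \<sigma> = 0"
proof (cases "\<sigma> \<noteq> {} \<and> (\<exists>t\<in>T. \<sigma> \<subseteq> t)")
  case False
  then show ?thesis by (auto simp: bary_coord_def)
next
  case True
  note D = pseudosurfaceD[OF T]
  have "finite \<sigma>" using True D(4) finite_subset by metis
  then have "Min (g ` \<sigma>) \<le> g i" using assms(2) by simp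
  moreover have fin: "finite (insert 0 (g ` (\<Union>T - \<sigma>)))" using D(6) by simp
  have "g i \<le> Max (insert 0 (g ` (\<Union>T - \<sigma>)))"
    using assms(3)
  proof
    assume "g i \<le> 0"
    also have "0 \<le> Max (insert 0 (g ` (\<Union>T - \<sigma>)))" using fin by (intro Max_ge) auto
    finally show ?thesis .
  next
    assume "\<exists>j\<in>\<Union>T - \<sigma>. g i \<le> g j"
    then obtain j where j: "j \<in> \<Union>T - \<sigma>" "g i \<le> g j" by (elim bexE)
    note j(2)
    also have "g j \<le> Max (insert 0 (g ` (\<Union>T - \<sigma>)))" using fin j(1) by (intro Max_ge) simp_all
    finally show ?thesis .
  qed
  ultimately show ?thesis by (simp add: bary_coord_def)
qed

lemma bary_coord_value:
  assumes T: "pseudosurface T" and t: "t \<in> T" "\<sigma> \<subseteq> t" "i \<in> \<sigma>"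
    and min: "\<And>j. j \<in> \<sigma> \<Longrightarrow> g i \<le> g j"
    and max: "y = 0 \<or> (\<exists>j\<in>\<Union>T - \<sigma>. y = g j)" "\<And>j. j \<in> \<Union>T - \<sigma> \<Longrightarrow> g j \<le> y"
    and y: "0 \<le> y" "y \<le> g i"
  shows "bary_coord T g \<sigma> = real (card \<sigma>) * (g i - y)"
proof -
  note D = pseudosurfaceD[OF T]
  have "finite \<sigma>" using t(1,2) D(4) finite_subset by metis
  then have "Min (g ` \<sigma>) = g i" using min t(3) by (intro Min_eqI) auto
  moreover have "Max (insert 0 (g ` (\<Union>T - \<sigma>))) = y"
    using D(6) max y(1) by (intro Max_eqI) auto
  moreover have "\<sigma> \<noteq> {} \<and> (\<exists>t\<in>T. \<sigma> \<subseteq> t)" using t by auto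
  ultimately show ?thesis using y by (simp add: bary_coord_def)
qed

lemma sorted_three:
  fixes g :: "'w \<Rightarrow> real"
  assumes "card t = 3"
  obtains a b c where "t = {a, b, c}" "a \<noteq> b" "a \<noteq> c" "b \<noteq> c" "g b \<le> g a" "g c \<le> g b"
proof -
  obtain p q r where t: "t = {p, q, r}" "p \<noteq> q" "p \<noteq> r" "q \<noteq> r" using assms by (auto simp: card_3_iff)
  have perms: "t = {p, r, q}" "t = {q, p, r}" "t = {q, r, p}" "t = {r, p, q}" "t = {r, q, p}"
    using t(1) by auto
  consider "g q \<le> g p" "g r \<le> g q" | "g r \<le> g p" "g q \<le> g r" | "g p \<le> g q" "g r \<le> g p"
    | "g r \<le> g q" "g p \<le> g r" | "g p \<le> g r" "g q \<le> g p" | "g q \<le> g r" "g p \<le> g q"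
    by linarith
  then show thesis
  proof cases
    case 1 then show thesis using that[of p q r] t by simp
  next
    case 2 then show thesis using that[of p r q] t perms(1) by simp
  next
    case 3 then show thesis using that[of q p r] t perms(2) by simp
  next
    case 4 then show thesis using that[of q r p] t perms(3) by simp
  next
    case 5 then show thesis using that[of r p q] t perms(4) by simp
  next
    case 6 then show thesis using that[of r q p] t perms(5) by simp
  qed
qed

definition barycentre :: "('w \<Rightarrow> nat \<Rightarrow> real) \<Rightarrow> 'w set \<Rightarrow> nat \<Rightarrow> real" where
  "barycentre P \<sigma> i = (\<Sum>w\<in>\<sigma>. P w i) / real (card \<sigma>)"

text \<open>Summation by parts: for coordinates \<open>\<alpha> \<ge> \<beta> \<ge> \<gamma>\<close>
  at \<open>a\<close>, \<open>b\<close>, \<open>c\<close> the point is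
  \<open>\<alpha> - \<beta>\<close> times \<open>a\<close>, plus
  \<open>2 * (\<beta> - \<gamma>)\<close> times the midpoint of \<open>a\<close> and
  \<open>b\<close>, plus \<open>3 * \<gamma>\<close> times the centroid. Each weight is the size of
  a face times the gap between its least coordinate and the largest one outside, which is the
  formula of \<open>bary_coord\<close>; written with Min and Max it is visibly continuous across
  triangles.\<close>

lemma coordinates_barycentric:
  assumes T: "pseudosurface T" and f: "coordinates X T f P m"
  shows "coordinates X (barycentric T) (\<lambda>x. bary_coord T (f x)) (barycentre P) (2 / 3 * m)"
  unfolding coordinates_def
proof (intro conjI allI ballI)
  note D = pseudosurfaceD[OF T]
  note fD = coordinatesD[OF f]
  show "continuous_on X (\<lambda>x. bary_coord T (f x) \<sigma>)" for \<sigma>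
  proof (cases "\<sigma> \<noteq> {} \<and> (\<exists>t\<in>T. \<sigma> \<subseteq> t)")
    case True
    then have "finite \<sigma>" "\<sigma> \<noteq> {}" using D(4) finite_subset by metis+
    then have "continuous_on X (\<lambda>x. Min (f x ` \<sigma>))"
      by (rule continuous_on_Min_image) (rule fD(1))
    moreover have "continuous_on X (\<lambda>x. Max (insert 0 (f x ` (\<Union>T - \<sigma>))))"
      by (rule continuous_on_Max_image) (use D(6) fD(1) in auto)
    ultimately show ?thesis
      unfolding bary_coord_def if_P[OF True] by (intro continuous_intros continuous_on_max)
  next
    case False
    show ?thesis unfolding bary_coord_def if_not_P[OF False] by simp
  qed
  show "0 \<le> bary_coord T (f x) \<sigma>" for x \<sigma> by (rule bary_coord_nonneg)
  show "\<exists>s\<in>barycentric T. (\<forall>\<sigma>. \<sigma> \<notin> s \<longrightarrow> bary_coord T (f x) \<sigma> = 0) \<and>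
      (\<Sum>\<sigma>\<in>s. bary_coord T (f x) \<sigma>) = 1 \<and>
      (\<forall>i. x i = (\<Sum>\<sigma>\<in>s. bary_coord T (f x) \<sigma> * barycentre P \<sigma> i))" if x: "x \<in> X" for x
  proof -
    obtain t where t': "t \<in> T" "\<forall>w. w \<notin> t \<longrightarrow> f x w = 0" "(\<Sum>w\<in>t. f x w) = 1"
      "\<forall>i. x i = (\<Sum>w\<in>t. f x w * P w i)"
      by (rule coordinatesE[OF f x])
    note t = t'(1) t'(2)[rule_format] t'(3) t'(4)[rule_format]
    obtain a b c where abc: "t = {a, b, c}" "a \<noteq> b" "a \<noteq> c" "b \<noteq> c" "f x b \<le> f x a" "f x c \<le> f x b"
      by (rule sorted_three[OF D(3)[OF t(1)], of "f x"])
    have c0: "0 \<le> f x c" by (rule fD(2)[OF x])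
    have tU: "a \<in> \<Union>T" "b \<in> \<Union>T" "c \<in> \<Union>T" using t(1) abc(1) by auto
    have out: "f x j = 0" if "j \<noteq> a" "j \<noteq> b" "j \<noteq> c" for j
      by (rule t(2)) (use abc(1) that in simp)
    have v1: "bary_coord T (f x) {a} = f x a - f x b"
    proof -
      have "bary_coord T (f x) {a} = real (card {a}) * (f x a - f x b)"
      proof (rule bary_coord_value[OF T t(1)])
        show "f x b = 0 \<or> (\<exists>j\<in>\<Union>T - {a}. f x b = f x j)" using tU(2) abc(2) by blast
        show "f x j \<le> f x b" if "j \<in> \<Union>T - {a}" for j
          using out[of j] that abc(5,6) c0 by (cases "j = b"; cases "j = c") auto
      qed (use abc c0 in auto)
      then show ?thesis by simp
    qed
    have v2: "bary_coord T (f x) {a, b} = 2 * (f x b - f x c)"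
    proof -
      have "bary_coord T (f x) {a, b} = real (card {a, b}) * (f x b - f x c)"
      proof (rule bary_coord_value[OF T t(1)])
        show "f x c = 0 \<or> (\<exists>j\<in>\<Union>T - {a, b}. f x c = f x j)" using tU(3) abc(3,4) by blast
        show "f x j \<le> f x c" if "j \<in> \<Union>T - {a, b}" for j
          using out[of j] that c0 by (cases "j = c") auto
      qed (use abc c0 in auto)
      then show ?thesis using abc(2) by simp
    qed
    have v3: "bary_coord T (f x) t = 3 * f x c"
    proof -
      have "bary_coord T (f x) t = real (card t) * (f x c - 0)"
      proof (rule bary_coord_value[OF T t(1)])
        show "f x j \<le> 0" if "j \<in> \<Union>T - t" for j using t(2)[of j] that by simp
      qed (use abc c0 in auto)
      then show ?thesis using D(3)[OF t(1)] by simp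
    qed
    have s: "flag_triangle a b t \<in> barycentric T" using t(1) abc(1,2) by (auto simp: barycentric_def)
    \<comment> \<open>A nonempty face off the flag leaves \<open>t\<close>, or omits
      \<open>a\<close>, or is \<open>{a, c}\<close>; each time some member has coordinate 0 or one
      no larger than a coordinate outside.\<close>
    have zero: "bary_coord T (f x) \<sigma> = 0" if \<sigma>: "\<sigma> \<notin> flag_triangle a b t" for \<sigma>
    proof (cases "\<sigma> = {}")
      case True then show ?thesis by (simp add: bary_coord_def)
    next
      case ne: False
      show ?thesis
      proof (cases "\<sigma> \<subseteq> t")
        case False
        then obtain w where "w \<in> \<sigma>" "w \<notin> t" by blast
        then show ?thesis using bary_coord_eq_0[OF T, of w \<sigma> "f x"] t(2)[of w] by simp
      next
        case True
        have ns: "\<sigma> \<noteq> {a}" "\<sigma> \<noteq> {a, b}" "\<sigma> \<noteq> t" using \<sigma> by (simp_all add: flag_triangle_def)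
        show ?thesis
        proof (cases "a \<in> \<sigma>")
          case False
          obtain w where w: "w \<in> \<sigma>" using ne by blast
          then have "w \<in> t" using True by blast
          then have "f x w \<le> f x a" using abc(1,5,6) by auto
          then have "\<exists>j\<in>\<Union>T - \<sigma>. f x w \<le> f x j" using tU(1) False by (intro bexI[of _ a]) auto
          then show ?thesis using bary_coord_eq_0[OF T w, of "f x"] by simp
        next
          case a: True
          have "b \<notin> \<sigma>" "c \<in> \<sigma>" using True a ns abc(1) by blast+
          then have "\<exists>j\<in>\<Union>T - \<sigma>. f x c \<le> f x j" using tU(2) abc(6) by (intro bexI[of _ b]) auto
          then show ?thesis using bary_coord_eq_0[OF T \<open>c \<in> \<sigma>\<close>, of "f x"] by simp
        qed
      qed
    qed
    have ne: "{a} \<noteq> {a, b}" "{a} \<noteq> t" "{a, b} \<noteq> t" using abc by auto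
    have sum: "(\<Sum>\<sigma>\<in>flag_triangle a b t. h \<sigma>) = h {a} + h {a, b} + h t" for h :: "'a set \<Rightarrow> real"
      unfolding flag_triangle_def using ne by (simp add: add.assoc)
    have "f x a + f x b + f x c = 1" using t(3) abc(1-4) by simp
    then have sum1: "(\<Sum>\<sigma>\<in>flag_triangle a b t. bary_coord T (f x) \<sigma>) = 1"
      unfolding sum v1 v2 v3 by simp
    have pos: "x i = (\<Sum>\<sigma>\<in>flag_triangle a b t. bary_coord T (f x) \<sigma> * barycentre P \<sigma> i)" for i
    proof -
      have bc: "barycentre P {a} i = P a i" "barycentre P {a, b} i = (P a i + P b i) / 2"
        "barycentre P t i = (P a i + P b i + P c i) / 3"
        using abc(1-4) by (simp_all add: barycentre_def)
      have xi: "x i = f x a * P a i + f x b * P b i + f x c * P c i"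
        by (subst t(4)) (simp add: abc(1-4))
      show ?thesis unfolding sum v1 v2 v3 bc by (subst xi) (simp add: field_simps)
    qed
    show ?thesis using s zero sum1 pos by (intro bexI[of _ "flag_triangle a b t"]) auto
  qed
  show "\<bar>barycentre P \<sigma> i - barycentre P \<tau> i\<bar> \<le> 2 / 3 * m"
    if "s \<in> barycentric T" "\<sigma> \<in> s" "\<tau> \<in> s" for s \<sigma> \<tau> i
    using that(1)
  proof (rule barycentricE)
    fix a b t assume s: "s = flag_triangle a b t" and t: "t \<in> T" "a \<in> t" "b \<in> t" "a \<noteq> b"
    obtain c where abc: "t = {a, b, c}" "a \<noteq> c" "b \<noteq> c"
    proof -
      have "card (t - {a, b}) = 1" using D(3,4)[OF t(1)] t by (simp add: card_Diff_subset)
      then obtain c where "t - {a, b} = {c}" by (auto simp: card_1_singleton_iff)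
      then have "t = {a, b, c}" "a \<noteq> c" "b \<noteq> c" using t by auto
      then show thesis by (rule that)
    qed
    have b1: "barycentre P {a} i = P a i" "barycentre P {a, b} i = (P a i + P b i) / 2"
      "barycentre P t i = (P a i + P b i + P c i) / 3"
      using abc t(4) by (simp_all add: barycentre_def)
    have "c \<in> t" using abc(1) by simp
    then have d: "\<bar>P a i - P b i\<bar> \<le> m" "\<bar>P a i - P c i\<bar> \<le> m" "\<bar>P b i - P c i\<bar> \<le> m"
      using fD(3)[OF t(1)] t(2,3) by simp_all
    \<comment> \<open>The factor 2/3 comes from a vertex and the centroid, whose difference is a
      third of the sum of two side vectors; the other two pairs give 1/2 and 1/3.\<close>
    have e: "\<bar>P a i - (P a i + P b i) / 2\<bar> \<le> 2 / 3 * m"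
      "\<bar>P a i - (P a i + P b i + P c i) / 3\<bar> \<le> 2 / 3 * m"
      "\<bar>(P a i + P b i) / 2 - (P a i + P b i + P c i) / 3\<bar> \<le> 2 / 3 * m" "0 \<le> m"
      using d unfolding abs_le_iff by (auto simp: field_simps)
    have "\<sigma> = {a} \<or> \<sigma> = {a, b} \<or> \<sigma> = t" "\<tau> = {a} \<or> \<tau> = {a, b} \<or> \<tau> = t"
      using that(2,3) unfolding s flag_triangle_def by simp_all
    then show ?thesis
      using e[folded b1] by (elim disjE) (simp_all add: abs_minus_commute)
  qed
qed

lemma coordinates_image:
  fixes r :: "'a \<Rightarrow> 'b"
  assumes T: "pseudosurface T" and f: "coordinates X T f P m" and r: "inj_on r (\<Union>T)"
  shows "coordinates X ((`) r ` T)
    (\<lambda>x w. if w \<in> r ` \<Union>T then f x (inv_into (\<Union>T) r w) else 0) (\<lambda>w. P (inv_into (\<Union>T) r w)) m"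
    (is "coordinates X _ ?f ?P m")
  unfolding coordinates_def
proof (intro conjI allI ballI)
  note fD = coordinatesD[OF f]
  have inv: "inv_into (\<Union>T) r (r v) = v" if "t \<in> T" "v \<in> t" for t v
    using r that by (intro inv_into_f_f) auto
  show "continuous_on X (\<lambda>x. ?f x w)" for w
    by (cases "w \<in> r ` \<Union>T") (simp_all add: fD(1))
  show "0 \<le> ?f x w" if "x \<in> X" for x w using fD(2)[OF that] by simp
  show "\<exists>t\<in>(`) r ` T. (\<forall>w. w \<notin> t \<longrightarrow> ?f x w = 0) \<and> (\<Sum>w\<in>t. ?f x w) = 1 \<and>
        (\<forall>i. x i = (\<Sum>w\<in>t. ?f x w * ?P w i))" if x: "x \<in> X" for x
  proof -
    obtain t where t': "t \<in> T" "\<forall>w. w \<notin> t \<longrightarrow> f x w = 0" "(\<Sum>w\<in>t. f x w) = 1"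
      "\<forall>i. x i = (\<Sum>w\<in>t. f x w * P w i)"
      by (rule coordinatesE[OF f x])
    note t = t'(1) t'(2)[rule_format] t'(3) t'(4)[rule_format]
    have inj: "inj_on r t" by (rule inj_on_subset[OF r]) (use t(1) in auto)
    have fr: "?f x (r v) = f x v" "?P (r v) = P v" if "v \<in> t" for v
      using inv[OF t(1) that] that t(1) by auto
    have z: "?f x w = 0" if w: "w \<notin> r ` t" for w
    proof (cases "w \<in> r ` \<Union>T")
      case True
      then obtain s v where v: "s \<in> T" "v \<in> s" "w = r v" by auto
      then have "v \<notin> t" using w by auto
      then show ?thesis using t(2) inv[OF v(1,2)] v(3) True by simp
    qed simp
    have "(\<Sum>w\<in>r ` t. ?f x w) = (\<Sum>v\<in>t. f x v)"
      using fr(1) by (simp only: sum.reindex[OF inj] o_def cong: sum.cong)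
    moreover have "(\<Sum>w\<in>r ` t. ?f x w * ?P w i) = (\<Sum>v\<in>t. f x v * P v i)" for i
      using fr by (simp only: sum.reindex[OF inj] o_def cong: sum.cong)
    ultimately show ?thesis
      using t z by (intro bexI[of _ "r ` t"]) simp_all
  qed
  show "\<bar>?P a i - ?P b i\<bar> \<le> m" if sab: "s \<in> (`) r ` T" "a \<in> s" "b \<in> s" for s a b i
  proof -
    obtain t a' b' where t: "t \<in> T" "a = r a'" "b = r b'" "a' \<in> t" "b' \<in> t"
      using sab by blast
    then show ?thesis using fD(3)[OF t(1,4,5)] inv[OF t(1,4)] inv[OF t(1,5)] by simp
  qed
qed

text \<open>\<open>set_encode\<close> renames the new vertices, which are finite sets of numbers, by
  numbers again, so that subdivision can be iterated within one type.\<close>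

lemma subdivide:
  fixes T :: "nat set set"
  assumes T: "pseudosurface T" and f: "coordinates X T f P m"
  shows "\<exists>(T'::nat set set) f' P'. pseudosurface T' \<and> euler_char T' = euler_char T \<and>
    coordinates X T' f' P' (2 / 3 * m)"
proof -
  note T1 = pseudosurface_barycentric[OF T]
  have "finite \<sigma>" if "\<sigma> \<in> \<Union>(barycentric T)" for \<sigma>
    using that pseudosurfaceD(4)[OF T] by (auto simp: barycentric_def flag_triangle_def)
  then have inj: "inj_on set_encode (\<Union>(barycentric T))"
    by (intro inj_on_subset[OF inj_on_set_encode]) auto
  show ?thesis
    using pseudosurface_image[OF T1 inj] euler_char_image[OF T1 inj] euler_char_barycentric[OF T]
      coordinates_image[OF T1 coordinates_barycentric[OF T f] inj]
    by (intro exI conjI) (assumption | simp)+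
qed

lemma coordinates_polyhedron:
  "coordinates (polyhedron T) T (\<lambda>x. x) (\<lambda>w i. if i = w then 1 else 0) 1"
  unfolding coordinates_def
proof (intro conjI allI ballI)
  show "continuous_on (polyhedron T) (\<lambda>x. x w)" for w
    by (rule continuous_on_product_coordinates[THEN continuous_on_subset]) simp
  show "0 \<le> x w" if "x \<in> polyhedron T" for x w using that by (simp add: polyhedron_def)
  show "\<exists>t\<in>T. (\<forall>w. w \<notin> t \<longrightarrow> x w = 0) \<and> (\<Sum>w\<in>t. x w) = 1 \<and>
      (\<forall>i. x i = (\<Sum>w\<in>t. x w * (if i = w then 1 else 0)))" if x: "x \<in> polyhedron T" for x
  proof -
    obtain t where t: "t \<in> T" "\<forall>v. v \<notin> t \<longrightarrow> x v = 0" "(\<Sum>v\<in>t. x v) = 1"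
      using x by (auto simp: polyhedron_def)
    have fin: "finite t"
    proof (rule ccontr)
      assume "infinite t" then show False using t(3) by simp
    qed
    have xi: "x i = (\<Sum>w\<in>t. x w * (if i = w then 1 else 0))" for i
    proof -
      have "(\<Sum>w\<in>t. x w * (if i = w then 1 else 0)) = (\<Sum>w\<in>t. if i = w then x w else 0)"
        by (intro sum.cong) auto
      also have "\<dots> = (if i \<in> t then x i else 0)" using fin by (rule sum.delta')
      also have "\<dots> = x i" using t(2) by simp
      finally show ?thesis by simp
    qed
    show ?thesis by (intro bexI[OF _ t(1)] conjI t(2,3) allI xi)
  qed
qed auto

text \<open>The space stays \<open>polyhedron T\<close> throughout; only the complex and the
  coordinate maps on that space change.\<close>

lemma fine_coordinates:
  fixes T :: "nat set set"
  assumes T: "pseudosurface T" and "0 < \<epsilon>"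
  shows "\<exists>(T'::nat set set) f P m. pseudosurface T' \<and> euler_char T' = euler_char T \<and>
    coordinates (polyhedron T) T' f P m \<and> m < \<epsilon>"
proof -
  have "\<exists>(T'::nat set set) f P. pseudosurface T' \<and> euler_char T' = euler_char T \<and>
    coordinates (polyhedron T) T' f P ((2 / 3) ^ n)" for n
  proof (induction n)
    case 0
    show ?case using T coordinates_polyhedron[of T] by auto
  next
    case (Suc n)
    then obtain T' :: "nat set set" and f P where IH: "pseudosurface T'" "euler_char T' = euler_char T"
      "coordinates (polyhedron T) T' f P ((2 / 3) ^ n)" by (elim exE conjE)
    show ?case using subdivide[OF IH(1,3)] IH(2) by simp
  qed
  moreover obtain n where "(2 / 3 :: real) ^ n < \<epsilon>"
    using real_arch_pow_inv[OF assms(2), of "2 / 3"] by auto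
  ultimately show ?thesis by metis
qed

text \<open>A point with positive coordinate at \<open>w\<close> is a convex combination of
  positions of vertices sharing a triangle with \<open>w\<close>, hence within \<open>m\<close> of
  \<open>P w\<close> in each coordinate.\<close>

lemma coordinates_near:
  assumes f: "coordinates X T f P m" and x: "x \<in> X" "y \<in> X" and w: "0 < f x w" "0 < f y w"
  shows "\<bar>x i - y i\<bar> \<le> 2 * m"
proof -
  have "\<bar>z i - P w i\<bar> \<le> m" if z: "z \<in> X" and w: "0 < f z w" for z
  proof -
    obtain t where t': "t \<in> T" "\<forall>w. w \<notin> t \<longrightarrow> f z w = 0" "(\<Sum>w\<in>t. f z w) = 1"
      "\<forall>i. z i = (\<Sum>w\<in>t. f z w * P w i)"
      by (rule coordinatesE[OF f z])
    note t = t'(1) t'(2)[rule_format] t'(3) t'(4)[rule_format]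
    have "w \<in> t" using t(2)[of w] w by auto
    have "z i - P w i = (\<Sum>v\<in>t. f z v * P v i) - (\<Sum>v\<in>t. f z v) * P w i"
      by (simp only: t(3) t(4)[of i, symmetric] mult_1)
    also have "\<dots> = (\<Sum>v\<in>t. f z v * (P v i - P w i))"
      by (simp add: sum_distrib_right sum_subtractf right_diff_distrib)
    finally have "\<bar>z i - P w i\<bar> = \<bar>\<Sum>v\<in>t. f z v * (P v i - P w i)\<bar>" by simp
    also have "\<dots> \<le> (\<Sum>v\<in>t. \<bar>f z v * (P v i - P w i)\<bar>)" by (rule sum_abs)
    also have "\<dots> \<le> (\<Sum>v\<in>t. f z v * m)"
    proof (rule sum_mono)
      fix v assume v: "v \<in> t"
      show "\<bar>f z v * (P v i - P w i)\<bar> \<le> f z v * m"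
        using coordinatesD(3)[OF f t(1) v \<open>w \<in> t\<close>, of i] coordinatesD(2)[OF f z, of v]
        by (simp add: abs_mult mult_left_mono)
    qed
    also have "\<dots> = m" by (simp only: sum_distrib_right[symmetric] t(3) mult_1)
    finally show ?thesis .
  qed
  from this[OF x(1) w(1)] this[OF x(2) w(2)] show ?thesis by linarith
qed

text \<open>The vertices whose open star \<open>{x. 0 < f x w}\<close> meets \<open>C\<close>; this
  is the combinatorial shadow of \<open>C\<close> in the subdivision.\<close>

definition cells_meeting :: "'w set set \<Rightarrow> ((nat \<Rightarrow> real) \<Rightarrow> 'w \<Rightarrow> real) \<Rightarrow> (nat \<Rightarrow> real) set \<Rightarrow> 'w set" where
  "cells_meeting T f C = {w\<in>\<Union>T. \<exists>x\<in>C. 0 < f x w}"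

lemma cells_meeting_point:
  assumes f: "coordinates X T f P m" and x: "x \<in> X" "x \<in> C"
  shows "\<exists>w\<in>cells_meeting T f C. 0 < f x w"
proof -
  obtain t where t: "t \<in> T" "(\<Sum>w\<in>t. f x w) = 1"
    by (rule coordinatesE[OF f x(1)])
  have "\<exists>w\<in>t. 0 < f x w"
  proof (rule ccontr)
    assume "\<not> ?thesis"
    then have "(\<Sum>w\<in>t. f x w) \<le> 0" by (intro sum_nonpos) (simp add: not_less)
    then show False using t(2) by simp
  qed
  then show ?thesis using t(1) x(2) by (auto simp: cells_meeting_def)
qed

text \<open>Open stars are relatively open and cover \<open>C\<close>. If those from
  \<open>Y\<close> and those from the remaining vertices had no common point, they would disconnect
  \<open>C\<close>; a common point has two positive coordinates, and the two vertices share a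
  triangle.\<close>

lemma linked_cells_meeting:
  assumes f: "coordinates X T f P m" and C: "C \<subseteq> X" "connected C"
  shows "linked (skeleton T) (cells_meeting T f C)"
  unfolding linked_def
proof (intro allI impI)
  fix Y assume Y: "Y \<subseteq> cells_meeting T f C" "Y \<noteq> {}" "Y \<noteq> cells_meeting T f C"
  define S where "S = (\<lambda>Z. C \<inter> (\<Union>w\<in>Z. {x\<in>C. 0 < f x w}))"
  let ?Z = "cells_meeting T f C - Y"
  have op: "openin (top_of_set C) (S Z)" for Z
  proof -
    have "openin (top_of_set C) {x\<in>C. 0 < f x w}" for w
    proof -
      have "continuous_on C (\<lambda>x. f x w)" using coordinatesD(1)[OF f] C(1) by (rule continuous_on_subset)
      then have "openin (top_of_set C) (C \<inter> (\<lambda>x. f x w) -` {0<..})"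
        by (rule continuous_openin_preimage_gen) simp
      also have "C \<inter> (\<lambda>x. f x w) -` {0<..} = {x\<in>C. 0 < f x w}" by auto
      finally show ?thesis .
    qed
    then show ?thesis unfolding S_def by (intro openin_Int openin_Union) auto
  qed
  have cover: "C \<subseteq> S Y \<union> S ?Z"
  proof
    fix x assume x: "x \<in> C"
    then obtain w where "w \<in> cells_meeting T f C" "0 < f x w"
      using cells_meeting_point[OF f _ x] C(1) by blast
    then show "x \<in> S Y \<union> S ?Z" using x by (auto simp: S_def)
  qed
  have ne: "S Z \<noteq> {}" if Z: "Z \<subseteq> cells_meeting T f C" "Z \<noteq> {}" for Z
  proof -
    obtain w where w: "w \<in> Z" using Z(2) by blast
    then have "w \<in> cells_meeting T f C" using Z(1) by blast
    then show ?thesis using w by (auto simp: S_def cells_meeting_def)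
  qed
  have "?Z \<noteq> {}" using Y by blast
  then have neZ: "S ?Z \<noteq> {}" by (intro ne) auto
  have "S Y \<inter> S ?Z \<noteq> {}"
  proof
    assume "S Y \<inter> S ?Z = {}"
    then have "\<not> connected C"
      unfolding connected_openin using op[of Y] op[of ?Z] cover ne[OF Y(1,2)] neZ by metis
    then show False using C(2) by simp
  qed
  then obtain x v w where xw: "x \<in> C" "v \<in> Y" "w \<in> ?Z" "0 < f x v" "0 < f x w" by (auto simp: S_def)
  have xX: "x \<in> X" using xw(1) C(1) by blast
  obtain t where t': "t \<in> T" "\<forall>w. w \<notin> t \<longrightarrow> f x w = 0"
    by (rule coordinatesE[OF f xX])
  note t = t'(1) t'(2)[rule_format]
  have "v \<in> t" "w \<in> t" using t(2)[of v] t(2)[of w] xw(4,5) by auto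
  moreover have "v \<noteq> w" using xw(2,3) by auto
  ultimately have "{w, v} \<in> skeleton T" using t(1) by (auto simp: skeleton_def)
  then show "\<exists>x\<in>cells_meeting T f C - Y. \<exists>y\<in>Y. {x, y} \<in> skeleton T" using xw(2,3) by blast
qed

section \<open>Topological embeddings\<close>

text \<open>With \<open>K = \<Union>T\<close> this separates points of \<open>polyhedron T\<close>,
  because all other coordinates vanish there. It is a finite sum, so bounds on single coordinates
  turn directly into bounds on distances.\<close>

definition l1_dist :: "nat set \<Rightarrow> (nat \<Rightarrow> real) \<Rightarrow> (nat \<Rightarrow> real) \<Rightarrow> real" where
  "l1_dist K x y = (\<Sum>i\<in>K. \<bar>x i - y i\<bar>)"

lemma l1_dist_commute: "l1_dist K x y = l1_dist K y x"
  by (simp add: l1_dist_def abs_minus_commute)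

lemma l1_dist_triangle: "l1_dist K x z \<le> l1_dist K x y + l1_dist K y z"
  unfolding l1_dist_def sum.distrib[symmetric] by (rule sum_mono) simp

lemma l1_dist_refl: "l1_dist K x x = 0"
  by (simp add: l1_dist_def)

lemma l1_dist_nonneg: "0 \<le> l1_dist K x y"
  by (simp add: l1_dist_def sum_nonneg)

lemma coordinate_le_l1_dist:
  assumes "finite K" "i \<in> K"
  shows "\<bar>x i - y i\<bar> \<le> l1_dist K x y"
  unfolding l1_dist_def using assms by (intro member_le_sum) auto

lemma continuous_on_coordinate:
  fixes f :: "'b::topological_space \<Rightarrow> nat \<Rightarrow> real"
  assumes "continuous_on S f"
  shows "continuous_on S (\<lambda>z. f z i)"
proof -
  have "continuous_on (f ` S) (\<lambda>x. x i)"
    by (rule continuous_on_subset[OF continuous_on_product_coordinates]) simp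
  then show ?thesis using continuous_on_compose[OF assms] by (simp add: o_def)
qed

lemma continuous_on_l1_dist:
  fixes f g :: "'b::topological_space \<Rightarrow> nat \<Rightarrow> real"
  assumes "continuous_on S f" "continuous_on S g"
  shows "continuous_on S (\<lambda>z. l1_dist K (f z) (g z))"
  unfolding l1_dist_def
  by (intro continuous_on_sum continuous_on_rabs continuous_on_diff
      continuous_on_coordinate[OF assms(1)] continuous_on_coordinate[OF assms(2)])

lemma polyhedron_eq_0:
  assumes "x \<in> polyhedron T" "i \<notin> \<Union>T"
  shows "x i = 0"
  using assms by (auto simp: polyhedron_def)

lemma l1_dist_pos:
  assumes K: "finite (\<Union>T)" and x: "x \<in> polyhedron T" "y \<in> polyhedron T" "x \<noteq> y"
  shows "0 < l1_dist (\<Union>T) x y"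
proof -
  obtain i where i: "x i \<noteq> y i" using x(3) by (auto simp: fun_eq_iff)
  then have "i \<in> \<Union>T" using polyhedron_eq_0[OF x(1), of i] polyhedron_eq_0[OF x(2), of i] by force
  then have "\<bar>x i - y i\<bar> \<le> l1_dist (\<Union>T) x y" by (rule coordinate_le_l1_dist[OF K])
  then show ?thesis using i by linarith
qed

lemma compact_apart:
  assumes K: "finite (\<Union>T)" and A: "compact A" "A \<subseteq> polyhedron T" and B: "compact B" "B \<subseteq> polyhedron T"
    and disj: "A \<inter> B = {}"
  shows "\<exists>r>0. \<forall>x\<in>A. \<forall>y\<in>B. r \<le> l1_dist (\<Union>T) x y"
proof (cases "A \<times> B = {}")
  case True
  then show ?thesis by (intro exI[of _ 1]) auto
next
  case False
  have "continuous_on (A \<times> B) (\<lambda>z. l1_dist (\<Union>T) (fst z) (snd z))"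
    by (intro continuous_on_l1_dist continuous_on_fst continuous_on_snd continuous_on_id)
  then obtain z where z: "z \<in> A \<times> B"
    "\<forall>z'\<in>A \<times> B. l1_dist (\<Union>T) (fst z) (snd z) \<le> l1_dist (\<Union>T) (fst z') (snd z')"
    using continuous_attains_inf[OF compact_Times[OF A(1) B(1)] False] by blast
  have "0 < l1_dist (\<Union>T) (fst z) (snd z)"
    by (rule l1_dist_pos[OF K]) (use z(1) A(2) B(2) disj in auto)
  then show ?thesis using z(2) by (intro exI[of _ "l1_dist (\<Union>T) (fst z) (snd z)"]) auto
qed

lemma common_radius:
  fixes Q :: "'i \<Rightarrow> real \<Rightarrow> bool"
  assumes "finite I" "\<And>i. i \<in> I \<Longrightarrow> \<exists>r>0. Q i r"
    and mono: "\<And>i r r'. Q i r \<Longrightarrow> 0 < r' \<Longrightarrow> r' \<le> r \<Longrightarrow> Q i r'"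
  shows "\<exists>r>0. \<forall>i\<in>I. Q i r"
  using assms(1,2)
proof (induction I)
  case empty
  show ?case by (intro exI[of _ 1]) simp
next
  case (insert i I)
  obtain r where r: "0 < r" "\<forall>i\<in>I. Q i r" using insert.IH insert.prems by auto
  obtain r' where r': "0 < r'" "Q i r'" using insert.prems by auto
  have "\<forall>j\<in>insert i I. Q j (min r r')"
    using mono[of _ r "min r r'"] mono[of i r' "min r r'"] r r' by simp
  then show ?case using r(1) r'(1) by (intro exI[of _ "min r r'"]) simp
qed

text \<open>Near \<open>x0\<close> every point lies in a closed cell that also contains \<open>x0\<close>, so that the ball is
  star-shaped.\<close>

lemma connected_small_ball:
  assumes K: "finite (\<Union>T)" and x0: "x0 \<in> polyhedron T"
    and r: "\<And>i. 0 < x0 i \<Longrightarrow> r < x0 i"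
  shows "connected {x\<in>polyhedron T. l1_dist (\<Union>T) x0 x \<le> r}" (is "connected ?C")
proof (cases "?C = {}")
  case True
  then show ?thesis by (simp only: connected_empty)
next
  case False
  then have r0: "0 \<le> r" using l1_dist_nonneg order_trans by blast
  have nn: "0 \<le> x0 i" for i using x0 by (simp add: polyhedron_def)
  have seg: "\<exists>S. connected S \<and> S \<subseteq> ?C \<and> x0 \<in> S \<and> x \<in> S" if "x \<in> ?C" for x
  proof -
    have xC: "x \<in> polyhedron T" "l1_dist (\<Union>T) x0 x \<le> r" using that by simp_all
    have nnx: "0 \<le> x i" for i using xC(1) by (simp add: polyhedron_def)
    obtain t where t: "t \<in> T" "\<forall>v. v \<notin> t \<longrightarrow> x v = 0" "(\<Sum>v\<in>t. x v) = 1"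
      using xC(1) by (auto simp: polyhedron_def)
    obtain t0 where t0: "t0 \<in> T" "\<forall>v. v \<notin> t0 \<longrightarrow> x0 v = 0" "(\<Sum>v\<in>t0. x0 v) = 1"
      using x0 by (auto simp: polyhedron_def)
    \<comment> \<open>As \<open>r\<close> is below every positive coordinate of \<open>x0\<close>,
      such a coordinate cannot drop to 0 within the ball; so the cell of \<open>x\<close> also
      carries \<open>x0\<close>.\<close>
    have x0t: "x0 v = 0" if v: "v \<notin> t" for v
    proof (rule ccontr)
      assume "x0 v \<noteq> 0"
      then have pos: "0 < x0 v" using nn[of v] by simp
      then have "v \<in> \<Union>T" using polyhedron_eq_0[OF x0, of v] by force
      then have "\<bar>x0 v - x v\<bar> \<le> r" using coordinate_le_l1_dist[OF K, of v x0 x] xC(2) by linarith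
      moreover have "x v = 0" using t(2) v by simp
      ultimately show False using r[OF pos] pos by simp
    qed
    have "(\<Sum>v\<in>t. x0 v) = (\<Sum>v\<in>\<Union>T. x0 v)"
      using K t(1) x0t by (intro sum.mono_neutral_left) auto
    also have "\<dots> = (\<Sum>v\<in>t0. x0 v)"
      using K t0(1,2) by (intro sum.mono_neutral_right) auto
    finally have sum0: "(\<Sum>v\<in>t. x0 v) = 1" using t0(3) by simp
    define h where "h = (\<lambda>s::real. \<lambda>i. (1 - s) * x0 i + s * x i)"
    have "continuous_on {0..1} h"
      unfolding h_def by (intro continuous_on_coordinatewise_then_product continuous_intros)
    then have "connected (h ` {0..1})" by (intro connected_continuous_image) auto
    moreover have "h s \<in> ?C" if s: "s \<in> {0..1}" for s
    proof -
      have "0 \<le> h s v" for v using s nn[of v] nnx[of v] by (simp add: h_def)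
      moreover have "\<forall>v. v \<notin> t \<longrightarrow> h s v = 0" using t(2) x0t by (simp add: h_def)
      moreover have "(\<Sum>v\<in>t. h s v) = (1 - s) * (\<Sum>v\<in>t. x0 v) + s * (\<Sum>v\<in>t. x v)"
        by (simp add: h_def sum.distrib sum_distrib_left)
      then have "(\<Sum>v\<in>t. h s v) = 1" using t(3) sum0 by simp
      ultimately have "h s \<in> polyhedron T" using t(1) by (auto simp: polyhedron_def)
      moreover have "x0 i - h s i = s * (x0 i - x i)" for i by (simp add: h_def algebra_simps)
      then have "l1_dist (\<Union>T) x0 (h s) = s * l1_dist (\<Union>T) x0 x"
        unfolding l1_dist_def using s by (simp add: abs_mult sum_distrib_left)
      then have "l1_dist (\<Union>T) x0 (h s) \<le> 1 * l1_dist (\<Union>T) x0 x"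
        using s l1_dist_nonneg[of "\<Union>T" x0 x] by (simp add: mult_left_le_one_le)
      ultimately show ?thesis using xC(2) by simp
    qed
    moreover have "h 0 = x0" "h 1 = x" by (simp_all add: h_def)
    then have "x0 \<in> h ` {0..1}" "x \<in> h ` {0..1}" by (metis atLeastAtMost_iff image_eqI order_refl zero_le_one)+
    ultimately show ?thesis by blast
  qed
  define \<S> where "\<S> = {S. connected S \<and> S \<subseteq> ?C \<and> x0 \<in> S}"
  have "connected (\<Union>\<S>)"
  proof (rule connected_Union)
    show "connected S" if "S \<in> \<S>" for S using that by (simp add: \<S>_def)
    have "x0 \<in> \<Inter>\<S>" by (rule InterI) (simp add: \<S>_def)
    then show "\<Inter>\<S> \<noteq> {}" by (metis empty_iff)
  qed
  moreover have "\<Union>\<S> = ?C"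
  proof
    show "\<Union>\<S> \<subseteq> ?C" by (rule Union_least) (simp add: \<S>_def)
    show "?C \<subseteq> \<Union>\<S>"
    proof
      fix x assume "x \<in> ?C"
      from seg[OF this] obtain S where "connected S" "S \<subseteq> ?C" "x0 \<in> S" "x \<in> S"
        by (elim exE conjE)
      then have "S \<in> \<S>" unfolding \<S>_def by (intro CollectI conjI)
      then show "x \<in> \<Union>\<S>" using \<open>x \<in> S\<close> by (rule UnionI)
    qed
  qed
  ultimately show ?thesis by (simp only:)
qed

text \<open>A shared vertex would give points of \<open>C\<close> and \<open>D\<close> at most
  \<open>2 * m\<close> apart in each coordinate, contradicting the gap
  \<open>\<eta>\<close>.\<close>

lemma cells_meeting_disjoint:
  assumes f: "coordinates (polyhedron T) T' f P m" and CD: "C \<subseteq> polyhedron T" "D \<subseteq> polyhedron T"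
    and apart: "\<And>x y. x \<in> C \<Longrightarrow> y \<in> D \<Longrightarrow> \<eta> \<le> l1_dist K x y"
    and m: "real (card K) * (2 * m) < \<eta>"
    and w: "w \<in> cells_meeting T' f C" "w \<in> cells_meeting T' f D"
  shows False
proof -
  obtain x y where xy: "x \<in> C" "0 < f x w" "y \<in> D" "0 < f y w"
    using w by (auto simp: cells_meeting_def)
  have "l1_dist K x y \<le> (\<Sum>i\<in>K. 2 * m)"
    unfolding l1_dist_def
    by (rule sum_mono) (rule coordinates_near[OF f _ _ xy(2,4)], use xy CD in auto)
  then show False using apart[OF xy(1,3)] m by simp
qed

text \<open>The arcs may be wild near their ends. The branch set of a vertex \<open>w\<close> comes from a small ball \<open>C w\<close>
  around \<open>p w\<close> which swallows the ends of the arcs; of each arc only a compact middle part \<open>M e\<close> joining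
  two such balls is kept, and a subdivision fine compared to the distances between these sets
  turns them into a minor model.\<close>

lemma sparse_arcs:
  fixes T :: "nat set set" and W :: "'v set" and p :: "'v \<Rightarrow> nat \<Rightarrow> real"
    and \<alpha> :: "'v set \<Rightarrow> real \<Rightarrow> nat \<Rightarrow> real"
  assumes T: "pseudosurface T" and W: "finite W" "W \<noteq> {}"
    and A_W: "\<And>e. e \<in> A \<Longrightarrow> e \<subseteq> W" and A2: "\<And>e. e \<in> A \<Longrightarrow> card e = 2"
    and p: "\<And>w. w \<in> W \<Longrightarrow> p w \<in> polyhedron T" and p_inj: "inj_on p W"
    and \<alpha>_cont: "\<And>e. e \<in> A \<Longrightarrow> continuous_on {0..1} (\<alpha> e)"
    and \<alpha>_X: "\<And>e. e \<in> A \<Longrightarrow> \<alpha> e ` {0..1} \<subseteq> polyhedron T"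
    and \<alpha>_ends: "\<And>e. e \<in> A \<Longrightarrow> {\<alpha> e 0, \<alpha> e 1} = p ` e"
    and \<alpha>_p: "\<And>e. e \<in> A \<Longrightarrow> \<alpha> e ` {0<..<1} \<inter> p ` W = {}"
    and \<alpha>_disj: "\<And>e e'. \<lbrakk>e \<in> A; e' \<in> A; e \<noteq> e'\<rbrakk> \<Longrightarrow> \<alpha> e ` {0<..<1} \<inter> \<alpha> e' ` {0<..<1} = {}"
  shows "int (card A) \<le> 3 * int (card W) + 3 - 3 * euler_char T"
proof -
  define X where "X = polyhedron T"
  define K where "K = \<Union>T"
  have finK: "finite K" using pseudosurfaceD(6)[OF T] by (simp add: K_def)
  have finA: "finite A"
    by (rule finite_subset[of _ "Pow W"]) (use A_W W(1) in auto)
  let ?d = "l1_dist K"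
  \<comment> \<open>Factor 3: two balls of radius \<open>r\<close> around distinct vertices must
    still leave a gap of \<open>r\<close> between them.\<close>
  have "\<exists>r>0. \<forall>i\<in>W \<times> W. fst i \<noteq> snd i \<longrightarrow> 3 * r \<le> ?d (p (fst i)) (p (snd i))"
  proof (rule common_radius)
    show "finite (W \<times> W)" using W(1) by simp
    show "\<exists>r>0. fst i \<noteq> snd i \<longrightarrow> 3 * r \<le> ?d (p (fst i)) (p (snd i))" if "i \<in> W \<times> W" for i
    proof (cases "fst i = snd i")
      case True then show ?thesis by (intro exI[of _ 1]) simp
    next
      case False
      have i: "fst i \<in> W" "snd i \<in> W" using that by auto
      have "p (fst i) \<noteq> p (snd i)" using inj_onD[OF p_inj _ i] False by blast
      then have "0 < ?d (p (fst i)) (p (snd i))"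
        unfolding K_def using finK p[OF i(1)] p[OF i(2)] by (intro l1_dist_pos) (simp_all add: K_def)
      then show ?thesis by (intro exI[of _ "?d (p (fst i)) (p (snd i)) / 3"]) simp
    qed
  qed auto
  then obtain r1 where r1: "0 < r1" "\<And>u v. \<lbrakk>u \<in> W; v \<in> W; u \<noteq> v\<rbrakk> \<Longrightarrow> 3 * r1 \<le> ?d (p u) (p v)"
    by force
  \<comment> \<open>Factor 2: one ball of radius \<open>r\<close>, and a gap of \<open>r\<close> to
    every arc that does not end at its centre.\<close>
  have "\<exists>r>0. \<forall>i\<in>W \<times> A. fst i \<notin> snd i \<longrightarrow> (\<forall>s\<in>{0..1}. 2 * r \<le> ?d (p (fst i)) (\<alpha> (snd i) s))"
  proof (rule common_radius)
    show "finite (W \<times> A)" using W(1) finA by simp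
    show "\<exists>r>0. fst i \<notin> snd i \<longrightarrow> (\<forall>s\<in>{0..1}. 2 * r \<le> ?d (p (fst i)) (\<alpha> (snd i) s))"
      if "i \<in> W \<times> A" for i
    proof (cases "fst i \<in> snd i")
      case True then show ?thesis by (intro exI[of _ 1]) simp
    next
      case False
      have i: "fst i \<in> W" "snd i \<in> A" using that by auto
      have "p (fst i) \<notin> \<alpha> (snd i) ` {0..1}"
      proof
        assume "p (fst i) \<in> \<alpha> (snd i) ` {0..1}"
        then obtain s where s: "s \<in> {0..1}" "p (fst i) = \<alpha> (snd i) s" by (elim imageE)
        show False
        proof (cases "s = 0 \<or> s = 1")
          case True
          then have "p (fst i) \<in> p ` snd i" using \<alpha>_ends[OF i(2)] s(2) by auto
          then have "fst i \<in> snd i"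
            using inj_on_image_mem_iff[OF p_inj i(1) A_W[OF i(2)]] by simp
          then show False using False by simp
        next
          case False
          then have "s \<in> {0<..<1}" using s(1) by auto
          then show False using \<alpha>_p[OF i(2)] s(2) i(1) by blast
        qed
      qed
      moreover have "compact (\<alpha> (snd i) ` {0..1})"
        using \<alpha>_cont[OF i(2)] by (rule compact_continuous_image) simp
      ultimately obtain r where "0 < r" "\<forall>x\<in>{p (fst i)}. \<forall>y\<in>\<alpha> (snd i) ` {0..1}. r \<le> ?d x y"
        using compact_apart[of T "{p (fst i)}" "\<alpha> (snd i) ` {0..1}"] finK p[OF i(1)] \<alpha>_X[OF i(2)]
        unfolding K_def by auto
      then show ?thesis by (intro exI[of _ "r / 2"]) simp
    qed
    show "fst i \<notin> snd i \<longrightarrow> (\<forall>s\<in>{0..1}. 2 * r' \<le> ?d (p (fst i)) (\<alpha> (snd i) s))"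
      if "fst i \<notin> snd i \<longrightarrow> (\<forall>s\<in>{0..1}. 2 * r \<le> ?d (p (fst i)) (\<alpha> (snd i) s))" "r' \<le> r" for i r r'
      using that by fastforce
  qed
  then obtain r2 where r2: "0 < r2"
    "\<And>w e s. \<lbrakk>w \<in> W; e \<in> A; w \<notin> e; s \<in> {0..1}\<rbrakk> \<Longrightarrow> 2 * r2 \<le> ?d (p w) (\<alpha> e s)"
    by force
  \<comment> \<open>A radius below all positive coordinates of the centres, as
    \<open>connected_small_ball\<close> requires.\<close>
  have "\<exists>r>0. \<forall>i\<in>W \<times> K. 0 < p (fst i) (snd i) \<longrightarrow> r < p (fst i) (snd i)"
  proof (rule common_radius)
    show "finite (W \<times> K)" using W(1) finK by simp
    show "\<exists>r>0. 0 < p (fst i) (snd i) \<longrightarrow> r < p (fst i) (snd i)" for i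
      by (metis dense zero_less_one)
  qed auto
  then obtain r3 where r3: "0 < r3" "\<And>w i. \<lbrakk>w \<in> W; i \<in> K; 0 < p w i\<rbrakk> \<Longrightarrow> r3 < p w i"
    by force
  define r where "r = min r1 (min r2 r3)"
  have r: "0 < r" "r \<le> r1" "r \<le> r2" "r \<le> r3" using r1(1) r2(1) r3(1) by (auto simp: r_def)
  define C where "C = (\<lambda>w. {x\<in>X. ?d (p w) x \<le> r})"
  have C_conn: "connected (C w)" if w: "w \<in> W" for w
    unfolding C_def X_def K_def
  proof (rule connected_small_ball)
    show "r < p w i" if i: "0 < p w i" for i
    proof -
      have "i \<in> K" using i polyhedron_eq_0[OF p[OF w], of i] by (force simp: K_def)
      then show ?thesis using r3(2)[OF w _ i] r(4) by simp
    qed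
  qed (use finK p[OF w] in \<open>simp_all add: K_def\<close>)
  have CX: "C w \<subseteq> X" for w by (auto simp: C_def)
  have pC: "p w \<in> C w" if "w \<in> W" for w
    using p[OF that] r(1) by (simp add: C_def X_def l1_dist_refl)
  have C_apart: "r \<le> ?d x y" if uv: "u \<in> W" "v \<in> W" "u \<noteq> v" "x \<in> C u" "y \<in> C v" for u v x y
  proof -
    have "?d (p u) (p v) \<le> ?d (p u) x + (?d x y + ?d y (p v))"
      using l1_dist_triangle[of K "p u" "p v" x] l1_dist_triangle[of K x "p v" y] by linarith
    moreover have "?d (p u) x \<le> r" "?d y (p v) \<le> r"
      using uv(4,5) by (simp_all add: C_def l1_dist_commute)
    ultimately show ?thesis using r1(2)[OF uv(1-3)] r(2) by linarith
  qed
  have C\<alpha>_apart: "r \<le> ?d x (\<alpha> e s)" if h: "w \<in> W" "e \<in> A" "w \<notin> e" "x \<in> C w" "s \<in> {0..1}" for w e x s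
  proof -
    have "?d (p w) (\<alpha> e s) \<le> ?d (p w) x + ?d x (\<alpha> e s)" by (rule l1_dist_triangle)
    moreover have "?d (p w) x \<le> r" using h(4) by (simp add: C_def)
    ultimately show ?thesis using r2(2)[OF h(1,2,3,5)] r(3) by linarith
  qed
  \<comment> \<open>By continuity the arc is still inside the balls at times \<open>a\<close> and
    \<open>b\<close>. The piece between them is compact and avoids the ends, so even arcs with a
    common end have pieces at positive distance.\<close>
  have "\<exists>a b. 0 < a \<and> a < b \<and> b < 1 \<and> ?d (\<alpha> e 0) (\<alpha> e a) \<le> r \<and> ?d (\<alpha> e 1) (\<alpha> e b) \<le> r"
    if e: "e \<in> A" for e
  proof -
    have near: "\<exists>\<delta>>0. \<forall>s\<in>{0..1}. \<bar>s - s0\<bar> < \<delta> \<longrightarrow> ?d (\<alpha> e s0) (\<alpha> e s) \<le> r" if s0: "s0 \<in> {0..1}" for s0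
    proof -
      have "continuous_on {0..1} (\<lambda>s. ?d (\<alpha> e s0) (\<alpha> e s))"
        by (intro continuous_on_l1_dist \<alpha>_cont[OF e] continuous_on_const)
      then obtain \<delta> where "\<delta> > 0" "\<forall>s\<in>{0..1}. dist s s0 < \<delta> \<longrightarrow>
          dist (?d (\<alpha> e s0) (\<alpha> e s)) (?d (\<alpha> e s0) (\<alpha> e s0)) < r"
        using s0 r(1) unfolding continuous_on_iff by metis
      then show ?thesis
        using l1_dist_nonneg by (intro exI[of _ \<delta>]) (auto simp: dist_real_def l1_dist_refl)
    qed
    obtain \<delta>0 where d0: "\<delta>0 > 0" "\<forall>s\<in>{0..1}. \<bar>s - 0\<bar> < \<delta>0 \<longrightarrow> ?d (\<alpha> e 0) (\<alpha> e s) \<le> r"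
      using near[of 0] by auto
    obtain \<delta>1 where d1: "\<delta>1 > 0" "\<forall>s\<in>{0..1}. \<bar>s - 1\<bar> < \<delta>1 \<longrightarrow> ?d (\<alpha> e 1) (\<alpha> e s) \<le> r"
      using near[of 1] by auto
    define a where "a = min (\<delta>0 / 2) (1 / 3)"
    define b where "b = 1 - min (\<delta>1 / 2) (1 / 3)"
    have "0 < a" "a \<le> 1 / 3" "a < \<delta>0" using d0(1) by (auto simp: a_def)
    moreover have "b < 1" "2 / 3 \<le> b" "1 - b < \<delta>1" using d1(1) by (auto simp: b_def)
    moreover have "?d (\<alpha> e 0) (\<alpha> e a) \<le> r" using d0(2) calculation by simp
    moreover have "?d (\<alpha> e 1) (\<alpha> e b) \<le> r" using d1(2) calculation by simp
    ultimately show ?thesis by (intro exI[of _ a] exI[of _ b]) simp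
  qed
  then obtain a b where ab: "\<And>e. e \<in> A \<Longrightarrow> 0 < a e" "\<And>e. e \<in> A \<Longrightarrow> a e < b e" "\<And>e. e \<in> A \<Longrightarrow> b e < 1"
    "\<And>e. e \<in> A \<Longrightarrow> ?d (\<alpha> e 0) (\<alpha> e (a e)) \<le> r" "\<And>e. e \<in> A \<Longrightarrow> ?d (\<alpha> e 1) (\<alpha> e (b e)) \<le> r"
    by metis
  define M where "M = (\<lambda>e. \<alpha> e ` {a e..b e})"
  have ab01: "{a e..b e} \<subseteq> {0<..<1}" "{a e..b e} \<subseteq> {0..1}" if "e \<in> A" for e
    using ab(1)[OF that] ab(3)[OF that] by auto
  have M_cont: "continuous_on {a e..b e} (\<alpha> e)" if "e \<in> A" for e
    using \<alpha>_cont[OF that] ab01(2)[OF that] by (rule continuous_on_subset)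
  have M_conn: "connected (M e)" and M_comp: "compact (M e)" if "e \<in> A" for e
    unfolding M_def using M_cont[OF that]
    by (auto intro: connected_continuous_image compact_continuous_image)
  have MX: "M e \<subseteq> X" if "e \<in> A" for e
    unfolding M_def X_def using \<alpha>_X[OF that] ab01(2)[OF that] by (meson image_mono order_trans)
  have M_disj: "M e \<inter> M e' = {}" if "e \<in> A" "e' \<in> A" "e \<noteq> e'" for e e'
  proof -
    have "M e \<subseteq> \<alpha> e ` {0<..<1}" "M e' \<subseteq> \<alpha> e' ` {0<..<1}"
      unfolding M_def by (intro image_mono ab01(1) that)+
    then show ?thesis using \<alpha>_disj[OF that] by blast
  qed
  have M_C: "M e \<inter> C w \<noteq> {}" if e: "e \<in> A" and w: "w \<in> e" for e w
  proof -
    have "p w = \<alpha> e 0 \<or> p w = \<alpha> e 1" using \<alpha>_ends[OF e] w by blast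
    then have "\<exists>s\<in>{a e..b e}. ?d (p w) (\<alpha> e s) \<le> r"
    proof
      assume "p w = \<alpha> e 0"
      then show ?thesis using ab(2,4)[OF e] by (intro bexI[of _ "a e"]) auto
    next
      assume "p w = \<alpha> e 1"
      then show ?thesis using ab(2,5)[OF e] by (intro bexI[of _ "b e"]) auto
    qed
    then obtain s where s: "s \<in> {a e..b e}" "?d (p w) (\<alpha> e s) \<le> r" by (elim bexE)
    then have "\<alpha> e s \<in> M e" by (simp add: M_def)
    moreover from this have "\<alpha> e s \<in> C w" using s(2) MX[OF e] by (auto simp: C_def)
    ultimately show ?thesis by blast
  qed
  have "\<exists>q>0. \<forall>i\<in>A \<times> A. fst i \<noteq> snd i \<longrightarrow> (\<forall>x\<in>M (fst i). \<forall>y\<in>M (snd i). q \<le> ?d x y)"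
  proof (rule common_radius)
    show "finite (A \<times> A)" using finA by simp
    show "\<exists>q>0. fst i \<noteq> snd i \<longrightarrow> (\<forall>x\<in>M (fst i). \<forall>y\<in>M (snd i). q \<le> ?d x y)" if "i \<in> A \<times> A" for i
    proof (cases "fst i = snd i")
      case True then show ?thesis by (intro exI[of _ 1]) simp
    next
      case False
      have i: "fst i \<in> A" "snd i \<in> A" using that by auto
      have "\<exists>q>0. \<forall>x\<in>M (fst i). \<forall>y\<in>M (snd i). q \<le> ?d x y"
        unfolding K_def
        by (rule compact_apart)
          (use finK M_comp[OF i(1)] M_comp[OF i(2)] MX[OF i(1)] MX[OF i(2)] M_disj[OF i False] in
            \<open>simp_all add: K_def X_def\<close>)
      then show ?thesis by auto
    qed
    show "fst i \<noteq> snd i \<longrightarrow> (\<forall>x\<in>M (fst i). \<forall>y\<in>M (snd i). q' \<le> ?d x y)"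
      if "fst i \<noteq> snd i \<longrightarrow> (\<forall>x\<in>M (fst i). \<forall>y\<in>M (snd i). q \<le> ?d x y)" "q' \<le> q" for i q q'
      using that by (meson order_trans)
  qed
  then obtain q where q: "0 < q"
    "\<And>e e' x y. \<lbrakk>e \<in> A; e' \<in> A; e \<noteq> e'; x \<in> M e; y \<in> M e'\<rbrakk> \<Longrightarrow> q \<le> ?d x y"
    by force
  define \<eta> where "\<eta> = min r q"
  have \<eta>: "0 < \<eta>" "\<eta> \<le> r" "\<eta> \<le> q" using r(1) q(1) by (auto simp: \<eta>_def)
  \<comment> \<open>Summing \<open>2 * m\<close> over the coordinates in \<open>K\<close> must stay
    below \<open>\<eta>\<close>; the added 1 keeps the denominator positive.\<close>
  have "0 < \<eta> / (2 * real (card K) + 1)" using \<eta>(1) by simp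
  then obtain T' :: "nat set set" and f P m where T': "pseudosurface T'" "euler_char T' = euler_char T"
    "coordinates X T' f P m" "m < \<eta> / (2 * real (card K) + 1)"
    using fine_coordinates[OF T] unfolding X_def by metis
  have m: "real (card K) * (2 * m) < \<eta>"
  proof (cases "m \<le> 0")
    case True
    then have "real (card K) * (2 * m) \<le> 0" by (intro mult_nonneg_nonpos) auto
    then show ?thesis using \<eta>(1) by (rule le_less_trans)
  next
    case False
    have "m * (2 * real (card K) + 1) < \<eta>" using T'(4) by (simp add: pos_less_divide_eq)
    then show ?thesis using False by (simp add: algebra_simps)
  qed
  note f = T'(3)[unfolded X_def]
  let ?N = "cells_meeting T' f"
  note dis = cells_meeting_disjoint[OF f _ _ _ m]
  have ends_W: "w \<in> W" if "e \<in> A" "w \<in> e" for e w using A_W that by blast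
  interpret minor_model T' W A "\<lambda>w. ?N (C w)" "\<lambda>e. ?N (M e)"
  proof
    show "pseudosurface T'" "finite W" "W \<noteq> {}" using T' W by simp_all
    show "e \<subseteq> W" "card e = 2" if "e \<in> A" for e using A_W A2 that by simp_all
    show "?N (C w) \<subseteq> \<Union>T'" "?N (M e) \<subseteq> \<Union>T'" for w e by (auto simp: cells_meeting_def)
    show "?N (C w) \<noteq> {}" if "w \<in> W" for w
      using cells_meeting_point[OF T'(3) _ pC[OF that]] p[OF that] by (auto simp: X_def)
    show "linked (skeleton T') (?N (C w))" if "w \<in> W" for w
      by (rule linked_cells_meeting[OF T'(3) CX C_conn[OF that]])
    show "linked (skeleton T') (?N (M e))" if "e \<in> A" for e
      by (rule linked_cells_meeting[OF T'(3) MX[OF that] M_conn[OF that]])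
    show "u = v" if "u \<in> W" "v \<in> W" "x \<in> ?N (C u)" "x \<in> ?N (C v)" for u v x
    proof (rule ccontr)
      assume ne: "u \<noteq> v"
      show False
        by (rule dis[OF _ _ _ that(3,4)])
          (rule CX[unfolded X_def] order_trans[OF \<eta>(2) C_apart[OF that(1,2) ne]] | assumption)+
    qed
    show "e = e'" if "e \<in> A" "e' \<in> A" "x \<in> ?N (M e)" "x \<in> ?N (M e')" for e e' x
    proof (rule ccontr)
      assume ne: "e \<noteq> e'"
      show False
        by (rule dis[OF _ _ _ that(3,4)])
          (rule MX[OF that(1), unfolded X_def] MX[OF that(2), unfolded X_def]
            order_trans[OF \<eta>(3) q(2)[OF that(1,2) ne]] | assumption)+
    qed
    show "w \<in> e" if "w \<in> W" "e \<in> A" "x \<in> ?N (C w)" "x \<in> ?N (M e)" for w e x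
    proof (rule ccontr)
      assume ne: "w \<notin> e"
      have ap: "\<eta> \<le> ?d y z" if "y \<in> C w" "z \<in> M e" for y z
      proof -
        have "M e \<subseteq> \<alpha> e ` {0..1}" unfolding M_def by (intro image_mono ab01(2) \<open>e \<in> A\<close>)
        then have "z \<in> \<alpha> e ` {0..1}" using \<open>z \<in> M e\<close> by (rule subsetD)
        then obtain s where s: "s \<in> {0..1}" "z = \<alpha> e s" by (elim imageE)
        then show ?thesis
          using C\<alpha>_apart[OF \<open>w \<in> W\<close> \<open>e \<in> A\<close> ne \<open>y \<in> C w\<close> s(1)] \<eta>(2) by simp
      qed
      show False
        by (rule dis[OF CX[unfolded X_def] MX[OF that(2), unfolded X_def] ap that(3,4)])
    qed
    show "?N (C w) \<inter> ?N (M e) \<noteq> {}" if "e \<in> A" "w \<in> e" for e w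
    proof -
      obtain y where y: "y \<in> M e" "y \<in> C w" using M_C[OF \<open>e \<in> A\<close> \<open>w \<in> e\<close>] by blast
      then have "y \<in> X" using CX by blast
      then obtain z where "z \<in> ?N (M e)" "0 < f y z"
        using cells_meeting_point[OF T'(3) _ y(1)] by blast
      then have "z \<in> ?N (C w)" "z \<in> ?N (M e)" using y(2) by (auto simp: cells_meeting_def)
      then show ?thesis by blast
    qed
  qed
  show ?thesis using edge_bound T'(2) by simp
qed

lemma embedding_on_compose:
  assumes emb: "embedding_on G S p \<gamma>" and G: "multigraph G" and h: "continuous_map S S' h"
    and inj: "inj_on h (topspace S)"
  shows "embedding_on G S' (h \<circ> p) (\<lambda>e. h \<circ> \<gamma> e)"
proof -
  note E = emb[unfolded embedding_on_def]
  have pS: "p ` verts G \<subseteq> topspace S" and p_inj: "inj_on p (verts G)" using E by simp_all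
  have edge: "pathin S (\<gamma> e)" "inj_on (\<gamma> e) {0..1}" "{\<gamma> e 0, \<gamma> e 1} = p ` ends G e"
    "\<gamma> e ` {0<..<1} \<inter> p ` verts G = {}" if "e \<in> edges G" for e
    using E that by simp_all
  have disj: "\<gamma> e ` {0<..<1} \<inter> \<gamma> f ` {0<..<1} = {}" if "e \<in> edges G" "f \<in> edges G" "e \<noteq> f" for e f
    using E that by simp
  have \<gamma>S: "\<gamma> e ` {0..1} \<subseteq> topspace S" if "e \<in> edges G" for e
    using edge(1)[OF that] continuous_map_image_subset_topspace[of "top_of_set {0..1}" S "\<gamma> e"]
    by (simp add: pathin_def)
  have \<gamma>S': "\<gamma> e ` {0<..<1} \<subseteq> topspace S" if "e \<in> edges G" for e
    using \<gamma>S[OF that] by (force simp: image_subset_iff)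
  have image_Int: "h ` X \<inter> h ` Y = {}" if "X \<subseteq> topspace S" "Y \<subseteq> topspace S" "X \<inter> Y = {}" for X Y
    using inj_on_image_Int[OF inj that(1,2)] that(3) by simp
  show ?thesis
    unfolding embedding_on_def
  proof (intro conjI ballI impI)
    show "(h \<circ> p) ` verts G \<subseteq> topspace S'"
      using pS continuous_map_image_subset_topspace[OF h] by (auto simp: image_subset_iff)
    show "inj_on (h \<circ> p) (verts G)" using p_inj inj_on_subset[OF inj pS] by (rule comp_inj_on)
    fix e assume e: "e \<in> edges G"
    show "pathin S' (h \<circ> \<gamma> e)" using edge(1)[OF e] h by (rule pathin_compose)
    show "inj_on (h \<circ> \<gamma> e) {0..1}"
      using edge(2)[OF e] inj_on_subset[OF inj \<gamma>S[OF e]] by (rule comp_inj_on)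
    show "{(h \<circ> \<gamma> e) 0, (h \<circ> \<gamma> e) 1} = (h \<circ> p) ` ends G e"
      unfolding image_comp[symmetric] edge(3)[OF e, symmetric] by simp
    show "(h \<circ> \<gamma> e) ` {0<..<1} \<inter> (h \<circ> p) ` verts G = {}"
      unfolding image_comp[symmetric] by (rule image_Int[OF \<gamma>S'[OF e] pS edge(4)[OF e]])
    fix f assume f: "f \<in> edges G" "e \<noteq> f"
    show "(h \<circ> \<gamma> e) ` {0<..<1} \<inter> (h \<circ> \<gamma> f) ` {0<..<1} = {}"
      unfolding image_comp[symmetric]
      by (rule image_Int[OF \<gamma>S'[OF e] \<gamma>S'[OF f(1)] disj[OF e f]])
  qed
qed

text \<open>One arc from each class of parallel edges embeds the simple graph on \<open>W\<close>.
  With \<open>euler_char T = 2 - g\<close> the bound from \<open>sparse_arcs\<close> is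
  \<open>3 * card W + 3 * g - 3\<close>, and the empty \<open>W\<close> is separate because a minor
  model needs a vertex.\<close>

lemma embeddable_sparse:
  assumes G: "multigraph G" and S: "surface_of_euler_genus S g" and emb: "embeddable_on G S"
    and W: "W \<subseteq> verts G"
  shows "card {e\<in>ends G ` edges G. e \<subseteq> W} \<le> 3 * card W + 3 * g"
proof (cases "W = {}")
  case True
  have "{e\<in>ends G ` edges G. e \<subseteq> W} = {}"
    using G True by (fastforce simp: multigraph_def)
  then show ?thesis by (simp only: card.empty)
next
  case False
  obtain T where T: "closed_surface_complex T" "S homeomorphic_space (top_of_set (polyhedron T))"
    "int g = 2 - euler_characteristic T"
    using S by (auto simp: surface_of_euler_genus_def)
  obtain h h' where hh: "homeomorphic_maps S (top_of_set (polyhedron T)) h h'"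
    using T(2) by (auto simp: homeomorphic_space_def)
  have h: "continuous_map S (top_of_set (polyhedron T)) h" "inj_on h (topspace S)"
    using hh by (auto simp: homeomorphic_maps_def intro: inj_on_inverseI)
  obtain p0 \<gamma>0 where "embedding_on G S p0 \<gamma>0" using emb by (auto simp: embeddable_on_def)
  from embedding_on_compose[OF this G h]
  obtain p \<gamma> where emb': "embedding_on G (top_of_set (polyhedron T)) p \<gamma>" by blast
  note E = emb'[unfolded embedding_on_def]
  have p: "p ` verts G \<subseteq> polyhedron T" and p_inj: "inj_on p (verts G)" using E by simp_all
  have edge: "pathin (top_of_set (polyhedron T)) (\<gamma> e)" "{\<gamma> e 0, \<gamma> e 1} = p ` ends G e"
    "\<gamma> e ` {0<..<1} \<inter> p ` verts G = {}" if "e \<in> edges G" for e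
    using E that by simp_all
  have disj: "\<gamma> e ` {0<..<1} \<inter> \<gamma> f ` {0<..<1} = {}" if "e \<in> edges G" "f \<in> edges G" "e \<noteq> f" for e f
    using E that by simp
  define A where "A = {e\<in>ends G ` edges G. e \<subseteq> W}"
  define \<epsilon> where "\<epsilon> = inv_into (edges G) (ends G)"
  have \<epsilon>: "\<epsilon> e \<in> edges G" "ends G (\<epsilon> e) = e" if "e \<in> A" for e
    using that by (auto simp: A_def \<epsilon>_def inv_into_into f_inv_into_f)
  have finW: "finite W" using G W by (auto simp: multigraph_def intro: finite_subset)
  have path: "continuous_on {0..1} (\<gamma> e)" "\<gamma> e ` {0..1} \<subseteq> polyhedron T" if "e \<in> edges G" for e
    using edge(1)[OF that] by (auto simp: pathin_def continuous_map_in_subtopology)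
  have "int (card A) \<le> 3 * int (card W) + 3 - 3 * euler_char T"
  proof (rule sparse_arcs[OF closed_surface_pseudosurface[OF T(1)] finW False, of A p "\<lambda>e. \<gamma> (\<epsilon> e)"])
    show "e \<subseteq> W" "card e = 2" if "e \<in> A" for e
      using that G by (auto simp: A_def multigraph_def)
    show "p w \<in> polyhedron T" if "w \<in> W" for w using that p W by blast
    show "inj_on p W" using p_inj W by (rule inj_on_subset)
    show "continuous_on {0..1} (\<gamma> (\<epsilon> e))" "\<gamma> (\<epsilon> e) ` {0..1} \<subseteq> polyhedron T" if "e \<in> A" for e
      using path[OF \<epsilon>(1)[OF that]] .
    show "{\<gamma> (\<epsilon> e) 0, \<gamma> (\<epsilon> e) 1} = p ` e" if "e \<in> A" for e
      using edge(2)[OF \<epsilon>(1)[OF that]] \<epsilon>(2)[OF that] by simp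
    show "\<gamma> (\<epsilon> e) ` {0<..<1} \<inter> p ` W = {}" if "e \<in> A" for e
      using edge(3)[OF \<epsilon>(1)[OF that]] W by blast
    show "\<gamma> (\<epsilon> e) ` {0<..<1} \<inter> \<gamma> (\<epsilon> e') ` {0<..<1} = {}" if "e \<in> A" "e' \<in> A" "e \<noteq> e'" for e e'
      by (rule disj[OF \<epsilon>(1)[OF that(1)] \<epsilon>(1)[OF that(2)]]) (use \<epsilon>(2) that in metis)
  qed
  then show ?thesis using T(3) unfolding A_def[symmetric] euler_characteristic_eq by linarith
qed

section \<open>Adapted colourings of sparse multigraphs\<close>

text \<open>Conditional expectations in place of randomness: the right side is the mean of the left
  over a uniform \<open>Z\<close>, since a colour of the list contributes 1 or 1/3 with mean 2/3.
  The weights \<open>x\<close> and \<open>y\<close> hold the factors from colours already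
  decided.\<close>

lemma balanced_split_potential:
  fixes x y :: "'v \<Rightarrow> real" and L :: "'v \<Rightarrow> 'c set"
  assumes "finite U" "finite V" "\<And>v. 0 \<le> x v" "\<And>v. 0 \<le> y v"
  shows "\<exists>Z\<subseteq>U. (\<Sum>v\<in>V. x v * (1/3) ^ card (L v \<inter> U \<inter> Z) + y v * (1/3) ^ card (L v \<inter> U - Z))
    \<le> (\<Sum>v\<in>V. (x v + y v) * (2/3) ^ card (L v \<inter> U))"
  using assms(1,3,4)
proof (induction U arbitrary: x y)
  case empty
  show ?case by simp
next
  case (insert u U)
  define w where "w = (\<lambda>v. if u \<in> L v then 1/3 else 1 :: real)"
  have w0: "0 \<le> w v" for v by (simp add: w_def)
  have cU: "card (L v \<inter> insert u U) = card (L v \<inter> U) + (if u \<in> L v then 1 else 0)" for v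
    using insert.hyps by (simp add: Int_insert_right)
  define R1 where "R1 = (\<Sum>v\<in>V. (x v * w v + y v) * (2/3) ^ card (L v \<inter> U))"
  define R2 where "R2 = (\<Sum>v\<in>V. (x v + y v * w v) * (2/3) ^ card (L v \<inter> U))"
  define R where "R = (\<Sum>v\<in>V. (x v + y v) * (2/3) ^ card (L v \<inter> insert u U))"
  \<comment> \<open>\<open>R1\<close> and \<open>R2\<close> are the means given that
    \<open>u\<close> is put into \<open>Z\<close> or left out; one of them is at most the overall
    mean \<open>R\<close>.\<close>
  have "R1 + R2 = 2 * R"
    unfolding R1_def R2_def R_def sum.distrib[symmetric] sum_distrib_left
    by (rule sum.cong) (simp_all add: cU w_def algebra_simps)
  then consider "R1 \<le> R" | "R2 \<le> R" by linarith
  then show ?case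
  proof cases
    case 1
    obtain Z where Z: "Z \<subseteq> U" "(\<Sum>v\<in>V. x v * w v * (1/3) ^ card (L v \<inter> U \<inter> Z) + y v * (1/3) ^ card (L v \<inter> U - Z)) \<le> R1"
      using insert.IH[of "\<lambda>v. x v * w v" y] insert.prems w0 unfolding R1_def by auto
    have c1: "card (L v \<inter> insert u U \<inter> insert u Z) = card (L v \<inter> U \<inter> Z) + (if u \<in> L v then 1 else 0)" for v
    proof -
      have "L v \<inter> insert u U \<inter> insert u Z = (if u \<in> L v then insert u (L v \<inter> U \<inter> Z) else L v \<inter> U \<inter> Z)"
        by auto
      then show ?thesis using insert.hyps by simp
    qed
    have c2: "L v \<inter> insert u U - insert u Z = L v \<inter> U - Z" for v using insert.hyps by auto
    have "(\<Sum>v\<in>V. x v * (1/3) ^ card (L v \<inter> insert u U \<inter> insert u Z) + y v * (1/3) ^ card (L v \<inter> insert u U - insert u Z))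
      = (\<Sum>v\<in>V. x v * w v * (1/3) ^ card (L v \<inter> U \<inter> Z) + y v * (1/3) ^ card (L v \<inter> U - Z))"
      unfolding c1 c2 by (rule sum.cong) (simp_all add: w_def)
    then show ?thesis using Z 1 by (intro exI[of _ "insert u Z"]) (auto simp: R_def)
  next
    case 2
    obtain Z where Z: "Z \<subseteq> U" "(\<Sum>v\<in>V. x v * (1/3) ^ card (L v \<inter> U \<inter> Z) + y v * w v * (1/3) ^ card (L v \<inter> U - Z)) \<le> R2"
      using insert.IH[of x "\<lambda>v. y v * w v"] insert.prems w0 unfolding R2_def by auto
    have c1: "card (L v \<inter> insert u U - Z) = card (L v \<inter> U - Z) + (if u \<in> L v then 1 else 0)" for v
    proof -
      have "L v \<inter> insert u U - Z = (if u \<in> L v then insert u (L v \<inter> U - Z) else L v \<inter> U - Z)"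
        using Z(1) insert.hyps by auto
      then show ?thesis using insert.hyps by simp
    qed
    have c2: "L v \<inter> insert u U \<inter> Z = L v \<inter> U \<inter> Z" for v using insert.hyps Z(1) by auto
    have "(\<Sum>v\<in>V. x v * (1/3) ^ card (L v \<inter> insert u U \<inter> Z) + y v * (1/3) ^ card (L v \<inter> insert u U - Z))
      = (\<Sum>v\<in>V. x v * (1/3) ^ card (L v \<inter> U \<inter> Z) + y v * w v * (1/3) ^ card (L v \<inter> U - Z))"
      unfolding c1 c2 by (rule sum.cong) (simp_all add: w_def)
    then show ?thesis using Z 2 by (intro exI[of _ Z]) (auto simp: R_def)
  qed
qed

text \<open>A vertex with fewer than \<open>q\<close> colours on one side would alone contribute
  more than \<open>(1/3) ^ q\<close> to the potential, so a potential below that value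
  suffices.\<close>

lemma balanced_split:
  fixes L :: "'v \<Rightarrow> 'c set"
  assumes V: "finite V" "2 * card V < 7 ^ q"
    and L: "\<And>v. v \<in> V \<Longrightarrow> finite (L v)" "\<And>v. v \<in> V \<Longrightarrow> card (L v) = 8 * q"
  shows "\<exists>Z. \<forall>v\<in>V. q \<le> card (L v \<inter> Z) \<and> q \<le> card (L v - Z)"
proof -
  define U where "U = (\<Union>v\<in>V. L v)"
  have finU: "finite U" using V(1) L(1) by (simp add: U_def)
  have LU: "L v \<inter> U = L v" if "v \<in> V" for v using that by (auto simp: U_def)
  obtain Z where Z: "Z \<subseteq> U" "(\<Sum>v\<in>V. 1 * (1/3 :: real) ^ card (L v \<inter> U \<inter> Z) + 1 * (1/3) ^ card (L v \<inter> U - Z))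
    \<le> (\<Sum>v\<in>V. (1 + 1) * (2/3) ^ card (L v \<inter> U))"
    using balanced_split_potential[OF finU V(1), of "\<lambda>_. 1" "\<lambda>_. 1" L] by auto
  have "(\<Sum>v\<in>V. (1/3 :: real) ^ card (L v \<inter> Z) + (1/3) ^ card (L v - Z))
      = (\<Sum>v\<in>V. 1 * (1/3 :: real) ^ card (L v \<inter> U \<inter> Z) + 1 * (1/3) ^ card (L v \<inter> U - Z))"
    by (rule sum.cong) (simp_all add: LU)
  also have "\<dots> \<le> (\<Sum>v\<in>V. 2 * (2/3) ^ (8 * q))"
    using Z(2) by (simp add: LU L(2))
  also have "\<dots> = real (2 * card V) * (2/3) ^ (8 * q)" by simp
  also have "\<dots> < real (7 ^ q) * (2/3) ^ (8 * q)"
    using V(2) by (intro mult_strict_right_mono) (simp_all only: of_nat_less_iff zero_less_power zero_less_divide_iff zero_less_numeral simp_thms)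
  also have "\<dots> = (7 * (2/3) ^ 8) ^ q"
    by (simp add: power_mult power_mult_distrib)
  \<comment> \<open>\<open>7 * (2/3) ^ 8 = 1792 / 6561 < 1/3\<close>; this couples the list size
    \<open>8 * q\<close> with the bound \<open>7 ^ q\<close> on the number of vertices.\<close>
  also have "\<dots> \<le> (1/3) ^ q" by (rule power_mono) (simp_all add: power_divide)
  finally have small: "(\<Sum>v\<in>V. (1/3 :: real) ^ card (L v \<inter> Z) + (1/3) ^ card (L v - Z)) < (1/3) ^ q" .
  have "q \<le> card (L v \<inter> Z) \<and> q \<le> card (L v - Z)" if v: "v \<in> V" for v
  proof -
    have "(1/3 :: real) ^ card (L v \<inter> Z) + (1/3) ^ card (L v - Z)
        \<le> (\<Sum>v\<in>V. (1/3) ^ card (L v \<inter> Z) + (1/3) ^ card (L v - Z))"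
      using V(1) v by (intro member_le_sum) auto
    then have le: "(1/3 :: real) ^ card (L v \<inter> Z) + (1/3) ^ card (L v - Z) < (1/3) ^ q"
      using small by linarith
    moreover have "0 \<le> (1/3 :: real) ^ card (L v \<inter> Z)" "0 \<le> (1/3 :: real) ^ card (L v - Z)" by simp_all
    ultimately have "(1/3 :: real) ^ card (L v \<inter> Z) < (1/3) ^ q" "(1/3 :: real) ^ card (L v - Z) < (1/3) ^ q"
      by linarith+
    then show ?thesis by (simp add: power_strict_decreasing_iff)
  qed
  then show ?thesis by blast
qed

text \<open>A class of parallel edges becomes one edge of a simple graph carrying the set of all its
  labels. Only edges inside \<open>W\<close> count, so the notion restricts to induced
  subgraphs.\<close>

definition avoids :: "'v set set \<Rightarrow> ('v set \<Rightarrow> 'c set) \<Rightarrow> 'v set \<Rightarrow> ('v \<Rightarrow> 'c) \<Rightarrow> bool" where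
  "avoids A lab W c \<longleftrightarrow> (\<forall>e\<in>A. e \<subseteq> W \<longrightarrow> (\<forall>a\<in>lab e. \<exists>v\<in>e. c v \<noteq> a))"

lemma avoidsD: "\<lbrakk>avoids A lab W c; e \<in> A; e \<subseteq> W; a \<in> lab e\<rbrakk> \<Longrightarrow> \<exists>v\<in>e. c v \<noteq> a"
  unfolding avoids_def by (drule (1) bspec) simp

text \<open>Rosenfeld's counting argument: inductively, adding a vertex multiplies the number of
  colourings by at least \<open>q / 2\<close>.\<close>

lemma bounded_degree_colouring:
  fixes L :: "'v \<Rightarrow> 'c set"
  assumes V: "finite V" and A2: "\<And>e. e \<in> A \<Longrightarrow> card e = 2"
    and lab: "\<And>e. e \<in> A \<Longrightarrow> finite (lab e)" "\<And>e. e \<in> A \<Longrightarrow> card (lab e) \<le> \<mu>"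
    and deg: "\<And>v. v \<in> V \<Longrightarrow> card {e\<in>A. v \<in> e \<and> e \<subseteq> V} \<le> \<Delta>"
    and L: "\<And>v. v \<in> V \<Longrightarrow> finite (L v)" "\<And>v. v \<in> V \<Longrightarrow> q \<le> card (L v)"
    and q: "0 < q" "4 * (\<Delta> * \<mu>) \<le> q\<^sup>2"
  shows "\<exists>c. (\<forall>v\<in>V. c v \<in> L v) \<and> avoids A lab V c"
proof -
  define Col where "Col = (\<lambda>W. {c \<in> PiE W L. avoids A lab W c})"
  have finCol: "finite (Col W)" if "W \<subseteq> V" for W
  proof -
    have "finite (PiE W L)" using that V L(1) by (intro finite_PiE) (auto intro: finite_subset)
    then show ?thesis by (simp add: Col_def)
  qed
  have grow: "q * card (Col W) \<le> 2 * card (Col (insert v W))" if "W \<subseteq> V" "v \<in> V - W" for W v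
    using finite_subset[OF that(1) V] that
  proof (induction W arbitrary: v rule: finite_psubset_induct)
    case (psubset W)
    have v: "v \<in> V" "v \<notin> W" and W: "W \<subseteq> V" using psubset.prems by auto
    \<comment> \<open>All extensions of good colourings of \<open>W\<close> by a list colour at
      \<open>v\<close>, at least \<open>q\<close> times as many; those with a conflict at
      \<open>v\<close> are subtracted below.\<close>
    define ext where "ext = (\<lambda>(c, a). c(v := a)) ` (Col W \<times> L v)"
    have inj: "inj_on (\<lambda>(c, a). c(v := a)) (Col W \<times> L v)"
    proof (rule inj_onI)
      fix p p' assume p: "p \<in> Col W \<times> L v" "p' \<in> Col W \<times> L v"
        "(\<lambda>(c, a). c(v := a)) p = (\<lambda>(c, a). c(v := a)) p'"
      obtain c a c' a' where eq: "p = (c, a)" "p' = (c', a')" by (cases p, cases p')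
      have cc: "c(v := a) = c'(v := a')" using p(3) eq by simp
      have "c v = undefined" "c' v = undefined"
        using p(1,2) eq v(2) by (auto simp: Col_def PiE_def extensional_def)
      then have "c x = c' x" for x using fun_cong[OF cc, of x] by (cases "x = v") auto
      moreover have "a = a'" using fun_cong[OF cc, of v] by simp
      ultimately show "p = p'" using eq by auto
    qed
    have card_ext: "card ext = card (Col W) * card (L v)"
      unfolding ext_def card_image[OF inj] by (rule card_cartesian_product)
    have extD: "c \<in> PiE (insert v W) L \<and> avoids A lab W c" if c: "c \<in> ext" for c
    proof -
      obtain c0 a where c0: "c0 \<in> Col W" "a \<in> L v" "c = c0(v := a)" using c by (auto simp: ext_def)
      have "c \<in> PiE (insert v W) L"
        unfolding c0(3) using c0(1,2) by (intro PiE_fun_upd) (auto simp: Col_def)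
      moreover have "avoids A lab W c"
        unfolding avoids_def
      proof (intro ballI impI)
        fix e b assume e: "e \<in> A" "e \<subseteq> W" "b \<in> lab e"
        then obtain x where x: "x \<in> e" "c0 x \<noteq> b"
          using c0(1) avoidsD[of A lab W c0 e b] by (auto simp: Col_def)
        then have "x \<noteq> v" using e(2) v(2) by blast
        then show "\<exists>x\<in>e. c x \<noteq> b" using x c0(3) by (intro bexI[of _ x]) simp_all
      qed
      ultimately show ?thesis ..
    qed
    define Ev where "Ev = {e\<in>A. v \<in> e \<and> e \<subseteq> insert v W}"
    have Ev_V: "Ev \<subseteq> {e\<in>A. v \<in> e \<and> e \<subseteq> V}" using v W by (auto simp: Ev_def)
    have "{e\<in>A. v \<in> e \<and> e \<subseteq> V} \<subseteq> Pow V" by auto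
    then have finE: "finite {e\<in>A. v \<in> e \<and> e \<subseteq> V}" by (rule finite_subset) (simp add: V)
    have finEv: "finite Ev" using Ev_V finE by (rule finite_subset)
    have cEv: "card Ev \<le> \<Delta>" using card_mono[OF finE Ev_V] deg[OF v(1)] by simp
    define J where "J = Sigma Ev lab"
    have EvA: "e \<in> A" if "e \<in> Ev" for e using that by (simp add: Ev_def)
    have finJ: "finite J" unfolding J_def using finEv lab(1) EvA by (intro finite_SigmaI) auto
    have "card J = (\<Sum>e\<in>Ev. card (lab e))"
      unfolding J_def using finEv lab(1) EvA by (intro card_SigmaI) auto
    also have "\<dots> \<le> (\<Sum>e\<in>Ev. \<mu>)" using lab(2) EvA by (intro sum_mono) auto
    also have "\<dots> \<le> \<Delta> * \<mu>" using cEv by simp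
    finally have cJ: "card J \<le> \<Delta> * \<mu>" .
    define bad where "bad = (\<lambda>(e, a). {c\<in>ext. \<forall>x\<in>e. c x = a})"
    have finext: "finite ext" unfolding ext_def using finCol[OF W] L(1)[OF v(1)] by simp
    \<comment> \<open>A conflict fixes the colours of both \<open>u\<close> and \<open>v\<close> to
      \<open>a\<close>, so a bad extension is determined on \<open>W - {u}\<close>. By induction,
      putting \<open>u\<close> back multiplies the number of colourings by at least
      \<open>q / 2\<close>, which bounds the bad extensions by \<open>2 / q\<close> times the
      colourings of \<open>W\<close>.\<close>
    have bad_le: "q * card (bad j) \<le> 2 * card (Col W)" if j: "j \<in> J" for j
    proof -
      obtain e a where ea: "j = (e, a)" "e \<in> Ev" "a \<in> lab e" using j by (auto simp: J_def)
      have e: "e \<in> A" "v \<in> e" "e \<subseteq> insert v W" using ea(2) by (auto simp: Ev_def)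
      obtain u where u: "e = {u, v}" "u \<noteq> v" using A2[OF e(1)] e(2) by (auto simp: card_2_iff)
      have uW: "u \<in> W" using u e(3) by auto
      let ?W' = "W - {u}"
      have "card (bad j) \<le> card (Col ?W')"
      proof (rule card_inj_on_le)
        show "inj_on (\<lambda>c. restrict c ?W') (bad j)"
        proof (rule inj_onI)
          fix c c' assume c: "c \<in> bad j" "c' \<in> bad j" "restrict c ?W' = restrict c' ?W'"
          have c1: "c \<in> ext" "c u = a" "c v = a" and c2: "c' \<in> ext" "c' u = a" "c' v = a"
            using c(1,2) ea(1) u(1) by (auto simp: bad_def)
          have ex: "c \<in> PiE (insert v W) L" "c' \<in> PiE (insert v W) L"
            using extD[OF c1(1)] extD[OF c2(1)] by simp_all
          show "c = c'"
          proof (rule PiE_ext[OF ex])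
            fix x assume "x \<in> insert v W"
            then consider "x = v" | "x = u" | "x \<in> ?W'" by auto
            then show "c x = c' x"
            proof cases
              case 3
              then show ?thesis using fun_cong[OF c(3), of x] by simp
            qed (use c1 c2 in auto)
          qed
        qed
        show "(\<lambda>c. restrict c ?W') ` bad j \<subseteq> Col ?W'"
        proof
          fix d assume "d \<in> (\<lambda>c. restrict c ?W') ` bad j"
          then obtain c where c: "c \<in> bad j" "d = restrict c ?W'" by (elim imageE)
          have "c \<in> ext" using c(1) ea(1) by (simp add: bad_def)
          note cD = extD[OF this]
          have "d \<in> PiE ?W' L" using cD c(2) by (auto simp: PiE_iff)
          moreover have "avoids A lab ?W' d"
            unfolding avoids_def
          proof (intro ballI impI)
            fix e b assume e: "e \<in> A" "e \<subseteq> ?W'" "b \<in> lab e"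
            then have "e \<subseteq> W" by blast
            then obtain x where x: "x \<in> e" "c x \<noteq> b"
              using cD e(1,3) avoidsD[of A lab W c e b] by auto
            have "d x = c x" using x(1) e(2) c(2) by auto
            then show "\<exists>x\<in>e. d x \<noteq> b" using x by (intro bexI[of _ x]) simp_all
          qed
          ultimately show "d \<in> Col ?W'" by (simp add: Col_def)
        qed
        show "finite (Col ?W')" using W by (intro finCol) blast
      qed
      moreover have "q * card (Col ?W') \<le> 2 * card (Col (insert u ?W'))"
        by (rule psubset.IH) (use uW W in auto)
      moreover have "insert u ?W' = W" using uW by blast
      ultimately show ?thesis by (metis mult_le_mono2 order_trans)
    qed
    have cover: "ext \<subseteq> Col (insert v W) \<union> (\<Union>j\<in>J. bad j)"
    proof
      fix c assume c: "c \<in> ext"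
      show "c \<in> Col (insert v W) \<union> (\<Union>j\<in>J. bad j)"
      proof (cases "c \<in> (\<Union>j\<in>J. bad j)")
        case True then show ?thesis by blast
      next
        case False
        have "avoids A lab (insert v W) c"
          unfolding avoids_def
        proof (intro ballI impI)
          fix e b assume e: "e \<in> A" "e \<subseteq> insert v W" "b \<in> lab e"
          show "\<exists>x\<in>e. c x \<noteq> b"
          proof (cases "v \<in> e")
            case True
            then have "(e, b) \<in> J" using e by (simp add: J_def Ev_def)
            then have "c \<notin> bad (e, b)" using False by blast
            then show ?thesis using c by (simp add: bad_def)
          next
            case False
            then have "e \<subseteq> W" using e(2) by blast
            then show ?thesis using extD[OF c] e(1,3) avoidsD[of A lab W c e b] by simp
          qed
        qed
        then show ?thesis using extD[OF c] by (simp add: Col_def)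
      qed
    qed
    have fin1: "finite (Col (insert v W))" using v W by (intro finCol) auto
    have finbad: "finite (bad j)" for j using finext by (cases j) (simp add: bad_def)
    have "card ext \<le> card (Col (insert v W)) + (\<Sum>j\<in>J. card (bad j))"
    proof -
      have "card ext \<le> card (Col (insert v W) \<union> (\<Union>j\<in>J. bad j))"
        using fin1 finJ finbad cover by (intro card_mono) auto
      also have "\<dots> \<le> card (Col (insert v W)) + card (\<Union>j\<in>J. bad j)" by (rule card_Un_le)
      also have "card (\<Union>j\<in>J. bad j) \<le> (\<Sum>j\<in>J. card (bad j))" using finJ by (rule card_UN_le)
      finally show ?thesis by simp
    qed
    then have "q * card ext \<le> q * (card (Col (insert v W)) + (\<Sum>j\<in>J. card (bad j)))"
      by (rule mult_le_mono2)
    also have "\<dots> = q * card (Col (insert v W)) + (\<Sum>j\<in>J. q * card (bad j))"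
      by (simp add: sum_distrib_left distrib_left)
    also have "\<dots> \<le> q * card (Col (insert v W)) + (\<Sum>j\<in>J. 2 * card (Col W))"
      by (intro add_left_mono sum_mono bad_le)
    also have "\<dots> \<le> q * card (Col (insert v W)) + (\<Delta> * \<mu>) * (2 * card (Col W))"
      using mult_le_mono1[OF cJ, of "2 * card (Col W)"] by simp
    finally have 1: "q * card ext \<le> q * card (Col (insert v W)) + (\<Delta> * \<mu>) * (2 * card (Col W))" .
    have "q * (card (Col W) * q) \<le> q * card ext"
      unfolding card_ext using L(2)[OF v(1)] by (intro mult_le_mono order_refl)
    from order_trans[OF this 1] have 2: "q\<^sup>2 * card (Col W) \<le> q * card (Col (insert v W)) + (\<Delta> * \<mu>) * (2 * card (Col W))"
      by (simp add: power2_eq_square mult.commute mult.left_commute)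
    \<comment> \<open>By \<open>4 * (\<Delta> * \<mu>) \<le> q\<^sup>2\<close> the conflicts cost at
      most half of the extensions, which leaves the factor \<open>q / 2\<close>.\<close>
    have "4 * (\<Delta> * \<mu>) * card (Col W) \<le> q\<^sup>2 * card (Col W)" using q(2) by (rule mult_le_mono1)
    then have "q\<^sup>2 * card (Col W) \<le> 2 * (q * card (Col (insert v W)))" using 2 by linarith
    then have "q * (q * card (Col W)) \<le> q * (2 * card (Col (insert v W)))"
      by (simp add: power2_eq_square mult.assoc mult.left_commute)
    then show ?case using q(1) by simp
  qed
  have "0 < card (Col W)" if "W \<subseteq> V" for W
    using finite_subset[OF that V] that
  proof (induction W)
    case empty
    have "(\<lambda>_. undefined) \<in> Col {}" using A2 by (fastforce simp: Col_def avoids_def)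
    then show ?case using finCol[of "{}"] by (auto simp: card_gt_0_iff)
  next
    case (insert v W)
    then have "0 < q * card (Col W)" using q(1) by simp
    also have "\<dots> \<le> 2 * card (Col (insert v W))" by (rule grow) (use insert in auto)
    finally show ?case by simp
  qed
  then have "Col V \<noteq> {}" by (metis card.empty less_irrefl order_refl)
  then obtain c where "c \<in> Col V" by blast
  then show ?thesis by (intro exI[of _ c]) (auto simp: Col_def)
qed

section \<open>From bounded degree to sparse graphs\<close>

lemma double_fourth_power_less: "16 \<le> q \<Longrightarrow> 2 * q ^ 4 < (7::nat) ^ q"
proof (induction q rule: nat_induct_at_least)
  case base
  show ?case by simp
next
  case (Suc q)
  have "2 * q + 1 \<le> q * q"
  proof -
    have "2 * q + 1 \<le> 16 * q" using Suc.hyps by simp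
    also have "\<dots> \<le> q * q" using Suc.hyps by (rule mult_le_mono1)
    finally show ?thesis .
  qed
  then have "(Suc q)\<^sup>2 \<le> 2 * q\<^sup>2" by (simp add: power2_eq_square)
  then have "((Suc q)\<^sup>2)\<^sup>2 \<le> (2 * q\<^sup>2)\<^sup>2" by (rule power_mono) simp
  then have "(Suc q) ^ 4 \<le> 4 * q ^ 4" by (simp add: power_mult_distrib flip: power_mult)
  then have "2 * (Suc q) ^ 4 \<le> 4 * (2 * q ^ 4)" by simp
  also have "\<dots> < 7 * 7 ^ q" using Suc.IH by simp
  finally show ?case by simp
qed

lemma sum_degrees:
  assumes "finite W" "\<And>e. e \<in> A \<Longrightarrow> card e = 2"
  shows "(\<Sum>v\<in>W. card {e\<in>A. v \<in> e \<and> e \<subseteq> W}) = 2 * card {e\<in>A. e \<subseteq> W}"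
proof -
  have fin: "finite {e\<in>A. e \<subseteq> W}"
    by (rule finite_subset[of _ "Pow W"]) (use assms(1) in auto)
  have "(\<Sum>v\<in>W. card {e\<in>{e\<in>A. e \<subseteq> W}. v \<in> e}) = (\<Sum>e\<in>{e\<in>A. e \<subseteq> W}. card {v\<in>W. v \<in> e})"
    by (rule sum_multicount_gen) (use fin assms(1) in auto)
  also have "\<dots> = (\<Sum>e\<in>{e\<in>A. e \<subseteq> W}. 2)"
  proof (rule sum.cong[OF refl])
    fix e assume e: "e \<in> {e\<in>A. e \<subseteq> W}"
    then have "{v\<in>W. v \<in> e} = e" by blast
    then show "card {v\<in>W. v \<in> e} = 2" using e assms(2) by simp
  qed
  also have "{e\<in>{e\<in>A. e \<subseteq> W}. v \<in> e} = {e\<in>A. v \<in> e \<and> e \<subseteq> W}" for v by blast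
  ultimately show ?thesis by simp
qed

lemma degree_le_card:
  assumes "finite H" "\<And>e. e \<in> A \<Longrightarrow> card e = 2"
  shows "card {e\<in>A. v \<in> e \<and> e \<subseteq> H} \<le> card H"
proof -
  have "{e\<in>A. v \<in> e \<and> e \<subseteq> H} \<subseteq> (\<lambda>u. {v, u}) ` H"
  proof
    fix e assume "e \<in> {e\<in>A. v \<in> e \<and> e \<subseteq> H}"
    then have e: "e \<in> A" "v \<in> e" "e \<subseteq> H" by auto
    then obtain u where "e = {v, u}" using assms(2)[OF e(1)] by (auto simp: card_2_iff)
    then show "e \<in> (\<lambda>u. {v, u}) ` H" using e(3) by auto
  qed
  then have "card {e\<in>A. v \<in> e \<and> e \<subseteq> H} \<le> card ((\<lambda>u. {v, u}) ` H)"
    using assms(1) by (intro card_mono) auto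
  also have "\<dots> \<le> card H" using assms(1) by (rule card_image_le)
  finally show ?thesis .
qed

text \<open>The high-degree vertices receive colours from \<open>Z\<close> and the others from outside \<open>Z\<close>, so that
  edges between the two classes never matter.\<close>

lemma dense_part_colouring:
  fixes L :: "'v \<Rightarrow> 'c set" and q s g \<mu> :: nat
  assumes W: "finite W" and A2: "\<And>e. e \<in> A \<Longrightarrow> card e = 2"
    and lab: "\<And>e. e \<in> A \<Longrightarrow> finite (lab e)" "\<And>e. e \<in> A \<Longrightarrow> card (lab e) \<le> \<mu>"
    and sparse: "card {e\<in>A. e \<subseteq> W} \<le> 3 * card W + 3 * g"
    and L: "\<And>v. v \<in> W \<Longrightarrow> finite (L v)" "\<And>v. v \<in> W \<Longrightarrow> card (L v) = 8 * q"
    and deg: "\<And>v. v \<in> W \<Longrightarrow> 8 * q \<le> card {e\<in>A. v \<in> e \<and> e \<subseteq> W}"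
    and q: "16 \<le> q" "48 * (s * \<mu>) \<le> q\<^sup>2" and s: "1 \<le> s" "g \<le> s\<^sup>2" and \<mu>: "1 \<le> \<mu>"
  shows "\<exists>c. (\<forall>v\<in>W. c v \<in> L v) \<and> avoids A lab W c"
proof -
  let ?d = "\<lambda>v. card {e\<in>A. v \<in> e \<and> e \<subseteq> W}"
  have sumd: "(\<Sum>v\<in>W. ?d v) = 2 * card {e\<in>A. e \<subseteq> W}" using W A2 by (rule sum_degrees)
  \<comment> \<open>128 is \<open>8 * 16\<close>, the least possible value of \<open>8 * q\<close>.
    Minimum degree 128 against at most \<open>3 * card W + 3 * g\<close> edges leaves
    \<open>122 * card W \<le> 6 * g\<close>.\<close>
  have "(\<Sum>v\<in>W. 128) \<le> (\<Sum>v\<in>W. ?d v)"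
    by (rule sum_mono) (use deg q(1) in \<open>fastforce intro: order_trans\<close>)
  then have "128 * card W \<le> 2 * card {e\<in>A. e \<subseteq> W}" using sumd by simp
  then have n: "card W \<le> g" and m: "card {e\<in>A. e \<subseteq> W} \<le> 6 * g" using sparse by linarith+
  define H where "H = {v\<in>W. s \<le> ?d v}"
  have HW: "H \<subseteq> W" and finH: "finite H" using W by (auto simp: H_def)
  have "card H * s = (\<Sum>v\<in>H. s)" by simp
  also have "\<dots> \<le> (\<Sum>v\<in>H. ?d v)" by (rule sum_mono) (simp add: H_def)
  also have "\<dots> \<le> (\<Sum>v\<in>W. ?d v)" using W HW by (intro sum_mono2) auto
  also have "\<dots> \<le> 12 * s\<^sup>2" unfolding sumd using m s(2) by linarith
  finally have "card H * s \<le> (12 * s) * s" by (simp add: power2_eq_square)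
  then have cH: "card H \<le> 12 * s" using s(1) by simp
  \<comment> \<open>The polynomial bound on the number of vertices, at most \<open>g\<close>, that
    \<open>7 ^ q\<close> absorbs.\<close>
  have "g \<le> q ^ 4"
  proof -
    have "s \<le> 48 * (s * \<mu>)" using \<mu> by (cases \<mu>) simp_all
    then have "s \<le> q\<^sup>2" using q(2) by (rule order_trans)
    then have "s\<^sup>2 \<le> (q\<^sup>2)\<^sup>2" by (rule power_mono) simp
    also have "\<dots> = q ^ 4" by (simp flip: power_mult)
    finally show ?thesis using s(2) by simp
  qed
  then have "2 * card W < 7 ^ q" using n double_fourth_power_less[OF q(1)] by linarith
  then obtain Z where Z: "\<forall>v\<in>W. q \<le> card (L v \<inter> Z) \<and> q \<le> card (L v - Z)"
    using balanced_split[where V = W and L = L and q = q] W L by blast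
  \<comment> \<open>Both classes have induced degree at most \<open>12 * s\<close>: in
    \<open>H\<close> by the number of its vertices, outside it even at most \<open>s\<close>. This
    is the origin of 48 as \<open>4 * 12\<close>.\<close>
  have q4: "4 * (12 * s * \<mu>) \<le> q\<^sup>2" using q(2) by simp
  have q0: "0 < q" using q(1) by simp
  have "\<exists>c. (\<forall>v\<in>H. c v \<in> L v \<inter> Z) \<and> avoids A lab H c"
  proof (rule bounded_degree_colouring[OF finH A2 lab _ _ _ q0 q4])
    show "card {e\<in>A. v \<in> e \<and> e \<subseteq> H} \<le> 12 * s" for v
      using degree_le_card[OF finH A2, of A v] cH by (rule order_trans)
    show "finite (L v \<inter> Z)" "q \<le> card (L v \<inter> Z)" if "v \<in> H" for v
      using that HW L(1) Z by auto
  qed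
  then obtain c1 where c1: "\<forall>v\<in>H. c1 v \<in> L v \<inter> Z" "avoids A lab H c1" by blast
  have "\<exists>c. (\<forall>v\<in>W - H. c v \<in> L v - Z) \<and> avoids A lab (W - H) c"
  proof (rule bounded_degree_colouring[OF _ A2 lab _ _ _ q0 q4])
    show "finite (W - H)" using W by simp
    show "card {e\<in>A. v \<in> e \<and> e \<subseteq> W - H} \<le> 12 * s" if v: "v \<in> W - H" for v
    proof -
      have "finite {e\<in>A. v \<in> e \<and> e \<subseteq> W}"
        by (rule finite_subset[of _ "Pow W"]) (use W in auto)
      then have "card {e\<in>A. v \<in> e \<and> e \<subseteq> W - H} \<le> ?d v" by (rule card_mono) blast
      also have "?d v \<le> s" using v unfolding H_def by (metis (mono_tags, lifting) DiffE linear mem_Collect_eq)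
      finally have "card {e\<in>A. v \<in> e \<and> e \<subseteq> W - H} \<le> s" .
      then show ?thesis by simp
    qed
    show "finite (L v - Z)" "q \<le> card (L v - Z)" if "v \<in> W - H" for v
      using that L(1) Z by auto
  qed
  then obtain c2 where c2: "\<forall>v\<in>W - H. c2 v \<in> L v - Z" "avoids A lab (W - H) c2" by blast
  define c where "c = (\<lambda>v. if v \<in> H then c1 v else c2 v)"
  have "avoids A lab W c"
    unfolding avoids_def
  proof (intro ballI impI)
    fix e a assume e: "e \<in> A" "e \<subseteq> W" "a \<in> lab e"
    show "\<exists>v\<in>e. c v \<noteq> a"
    proof (cases "e \<subseteq> H")
      case True
      then obtain v where "v \<in> e" "c1 v \<noteq> a" using avoidsD[OF c1(2) e(1) _ e(3)] by blast
      then show ?thesis using True by (intro bexI[of _ v]) (auto simp: c_def)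
    next
      case False
      then obtain v where v: "v \<in> e" "v \<notin> H" by blast
      show ?thesis
      proof (cases "e \<inter> H = {}")
        case True
        then have "e \<subseteq> W - H" using e(2) by blast
        then obtain u where "u \<in> e" "c2 u \<noteq> a" using avoidsD[OF c2(2) e(1) _ e(3)] by blast
        then show ?thesis using True by (intro bexI[of _ u]) (auto simp: c_def)
      next
        case False
        then obtain u where u: "u \<in> e" "u \<in> H" by blast
        have "c u \<in> Z" using u c1(1) by (simp add: c_def)
        moreover have "c v \<notin> Z" using v e(2) c2(1) by (auto simp: c_def)
        ultimately have "c u \<noteq> c v" by auto
        then show ?thesis using u(1) v(1) by metis
      qed
    qed
  qed
  moreover have "\<forall>v\<in>W. c v \<in> L v" using c1(1) c2(1) by (simp add: c_def)
  ultimately show ?thesis by blast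
qed

text \<open>A vertex with fewer than \<open>8 * q\<close> neighbours, coloured last, can differ from
  all of them, and then its edges are harmless whatever their labels. When no such vertex is left,
  \<open>dense_part_colouring\<close> applies.\<close>

lemma sparse_colouring:
  fixes L :: "'v \<Rightarrow> 'c set" and q s g \<mu> :: nat
  assumes V: "finite V" and A2: "\<And>e. e \<in> A \<Longrightarrow> card e = 2"
    and lab: "\<And>e. e \<in> A \<Longrightarrow> finite (lab e)" "\<And>e. e \<in> A \<Longrightarrow> card (lab e) \<le> \<mu>"
    and sparse: "\<And>W. W \<subseteq> V \<Longrightarrow> card {e\<in>A. e \<subseteq> W} \<le> 3 * card W + 3 * g"
    and L: "\<And>v. v \<in> V \<Longrightarrow> finite (L v)" "\<And>v. v \<in> V \<Longrightarrow> card (L v) = 8 * q"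
    and q: "16 \<le> q" "48 * (s * \<mu>) \<le> q\<^sup>2" and s: "1 \<le> s" "g \<le> s\<^sup>2" and \<mu>: "1 \<le> \<mu>"
  shows "W \<subseteq> V \<Longrightarrow> \<exists>c. (\<forall>v\<in>W. c v \<in> L v) \<and> avoids A lab W c"
proof (induction "card W" arbitrary: W rule: less_induct)
  case less
  have WV: "W \<subseteq> V" by (rule less.prems)
  then have finW: "finite W" using V by (rule finite_subset)
  show ?case
  proof (cases "\<forall>v\<in>W. 8 * q \<le> card {e\<in>A. v \<in> e \<and> e \<subseteq> W}")
    case True
    show ?thesis
      by (rule dense_part_colouring[OF finW A2 lab sparse[OF WV] _ _ _ q s \<mu>]) (use L WV True in auto)
  next
    case False
    then obtain v where v: "v \<in> W" "card {e\<in>A. v \<in> e \<and> e \<subseteq> W} < 8 * q" by auto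
    define E where "E = {e\<in>A. v \<in> e \<and> e \<subseteq> W}"
    have finE: "finite E" by (rule finite_subset[of _ "Pow W"]) (use finW in \<open>auto simp: E_def\<close>)
    have "card (W - {v}) < card W" using finW v(1) by (intro psubset_card_mono) auto
    then obtain c where c: "\<forall>u\<in>W - {v}. c u \<in> L u" "avoids A lab (W - {v}) c"
      using less.hyps[of "W - {v}"] WV by blast
    define F where "F = (\<Union>e\<in>E. c ` (e - {v}))"
    have "card F \<le> (\<Sum>e\<in>E. card (c ` (e - {v})))" unfolding F_def using finE by (rule card_UN_le)
    also have "\<dots> \<le> (\<Sum>e\<in>E. 1)"
    proof (rule sum_mono)
      fix e assume e: "e \<in> E"
      then have "card e = 2" "v \<in> e" using A2 by (simp_all add: E_def)
      then have "finite e" "card (e - {v}) = 1" by (simp_all add: card_ge_0_finite)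
      then show "card (c ` (e - {v})) \<le> 1" using card_image_le[of "e - {v}" c] by simp
    qed
    also have "\<dots> < 8 * q" using v(2) by (simp add: E_def)
    finally have cF: "card F < 8 * q" .
    have finF: "finite F"
      unfolding F_def
    proof (intro finite_UN_I finE finite_imageI)
      fix e assume "e \<in> E"
      then have "e \<subseteq> W" by (simp add: E_def)
      then show "finite (e - {v})" using finW by (auto intro: finite_subset)
    qed
    have "\<not> L v \<subseteq> F"
    proof
      assume "L v \<subseteq> F"
      then have "card (L v) \<le> card F" using finF by (intro card_mono)
      then show False using cF L(2) v(1) WV by auto
    qed
    then obtain a where a: "a \<in> L v" "a \<notin> F" by blast
    have "avoids A lab W (c(v := a))"
      unfolding avoids_def
    proof (intro ballI impI)
      fix e b assume e: "e \<in> A" "e \<subseteq> W" "b \<in> lab e"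
      show "\<exists>x\<in>e. (c(v := a)) x \<noteq> b"
      proof (cases "v \<in> e")
        case True
        obtain u where u: "e = {u, v}" "u \<noteq> v" using A2[OF e(1)] True by (auto simp: card_2_iff)
        have "e \<in> E" using e True by (simp add: E_def)
        then have "c u \<in> F" unfolding F_def using u by (intro UN_I) auto
        then have "c u \<noteq> a" using a(2) by auto
        then show ?thesis using u by auto
      next
        case False
        then have "e \<subseteq> W - {v}" using e(2) by blast
        then obtain x where "x \<in> e" "c x \<noteq> b" using avoidsD[OF c(2) e(1) _ e(3)] by blast
        then show ?thesis using False by (intro bexI[of _ x]) auto
      qed
    qed
    moreover have "\<forall>u\<in>W. (c(v := a)) u \<in> L u" using c(1) a(1) by simp
    ultimately show ?thesis by blast
  qed
qed

text \<open>Passage from the multigraph to its simple graph: \<open>lab e\<close> gathers the labels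
  of the edges parallel to \<open>e\<close>, so the multiplicity bounds its size.\<close>

lemma embeddable_adaptably_choosable:
  fixes G :: "('v, 'e) multigraph" and q s g :: nat
  assumes G: "multigraph G" and S: "surface_of_euler_genus S g" and emb: "embeddable_on G S"
    and \<mu>: "1 \<le> max_multiplicity G"
    and q: "16 \<le> q" "48 * (s * max_multiplicity G) \<le> q\<^sup>2" and s: "1 \<le> s" "g \<le> s\<^sup>2"
  shows "adaptably_choosable G (8 * q)"
  unfolding adaptably_choosable_def
proof (intro allI impI)
  fix L :: "'v \<Rightarrow> nat set" and l :: "'e \<Rightarrow> nat"
  assume L: "list_assignment G (8 * q) L"
  have fin: "finite (verts G)" "finite (edges G)" using G by (simp_all add: multigraph_def)
  define lab where "lab = (\<lambda>e. l ` {f\<in>edges G. ends G f = e})"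
  have "\<exists>c. (\<forall>v\<in>verts G. c v \<in> L v) \<and> avoids (ends G ` edges G) lab (verts G) c"
  proof (rule sparse_colouring[OF fin(1) _ _ _ embeddable_sparse[OF G S emb] _ _ q s \<mu> order_refl])
    show "card e = 2" if "e \<in> ends G ` edges G" for e
      using that G by (auto simp: multigraph_def)
    show "finite (lab e)" for e using fin by (simp add: lab_def)
    show "card (lab e) \<le> max_multiplicity G" if e: "e \<in> ends G ` edges G" for e
    proof -
      obtain f where f: "f \<in> edges G" "e = ends G f" using e by blast
      have "card (lab e) \<le> edge_multiplicity G f"
        unfolding lab_def edge_multiplicity_def f(2) using fin by (intro card_image_le) simp
      also have "\<dots> \<le> max_multiplicity G"
        unfolding max_multiplicity_def using fin f(1) by (intro Max_ge) auto
      finally show ?thesis .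
    qed
    show "finite (L v)" "card (L v) = 8 * q" if "v \<in> verts G" for v
      using L that by (simp_all add: list_assignment_def)
  qed
  then obtain c where c: "\<forall>v\<in>verts G. c v \<in> L v" "avoids (ends G ` edges G) lab (verts G) c" by blast
  have "adapted G l c"
    unfolding adapted_def
  proof (intro notI, elim bexE exE conjE)
    fix e u v assume e: "e \<in> edges G" "ends G e = {u, v}" "c u = l e" "c v = l e"
    have "ends G e \<subseteq> verts G" using G e(1) by (simp add: multigraph_def)
    moreover have "l e \<in> lab (ends G e)" using e(1) by (simp add: lab_def)
    ultimately obtain x where "x \<in> ends G e" "c x \<noteq> l e" using avoidsD[OF c(2)] e(1) by blast
    then show False using e by auto
  qed
  then show "\<exists>c. list_colouring G L c \<and> adapted G l c"
    using c(1) by (auto simp: list_colouring_def)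
qed

theorem theorem12:
  shows "\<exists>C3::real. C3 > 0 \<and>
    (\<forall>(G :: ('v, 'e) multigraph) (S :: 's topology) (g :: nat) (\<mu> :: nat).
       multigraph G \<longrightarrow> max_multiplicity G = \<mu> \<longrightarrow> \<mu> \<ge> 1 \<longrightarrow>
       surface_of_euler_genus S g \<longrightarrow> embeddable_on G S \<longrightarrow>
       real (ch_a G) \<le> C3 * sqrt (real \<mu>) * (real g + 1) powr (1/4))"
proof (intro exI[of _ 136] conjI allI impI)
  fix G :: "('v, 'e) multigraph" and S :: "'s topology" and g \<mu> :: nat
  assume G: "multigraph G" and \<mu>: "max_multiplicity G = \<mu>" "\<mu> \<ge> 1"
    and S: "surface_of_euler_genus S g" and emb: "embeddable_on G S"
  define x where "x = sqrt (real \<mu>) * (real g + 1) powr (1/4)"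
  define r where "r = sqrt (real g + 1)"
  have r1: "1 \<le> r" by (simp add: r_def)
  have "1 \<le> sqrt (real \<mu>)" using \<mu>(2) by simp
  moreover have "1 \<le> (real g + 1) powr (1/4)" by (rule ge_one_powr_ge_zero) simp_all
  ultimately have x1: "1 \<le> x" unfolding x_def by (metis mult_mono mult_1 zero_le_one order_trans)
  have "((real g + 1) powr (1/4))\<^sup>2 = r"
    by (simp add: r_def powr_half_sqrt[symmetric] power2_eq_square flip: powr_add)
  then have x2: "x\<^sup>2 = real \<mu> * r" by (simp add: x_def power_mult_distrib)
  \<comment> \<open>As \<open>1 \<le> x\<close>, rounding up costs at most one more
    \<open>x\<close>: \<open>q \<le> 17 * x\<close>, and \<open>8 * 17 = 136\<close>. The factor 16
    gives \<open>16 \<le> q\<close>, and \<open>s \<le> 2 * r\<close> makes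
    \<open>48 * (s * \<mu>)\<close> at most \<open>96 * x\<^sup>2\<close>, below
    \<open>(16 * x)\<^sup>2\<close>.\<close>
  define q where "q = nat \<lceil>16 * x\<rceil>"
  define s where "s = nat \<lceil>r\<rceil>"
  have q: "16 * x \<le> real q" "real q \<le> 17 * x" using x1 unfolding q_def by linarith+
  have s: "r \<le> real s" "real s \<le> 2 * r" using r1 unfolding s_def by linarith+
  have "adaptably_choosable G (8 * q)"
  proof (rule embeddable_adaptably_choosable[OF G S emb])
    show "1 \<le> max_multiplicity G" using \<mu> by simp
    show "16 \<le> q" using q(1) x1 by linarith
    show "1 \<le> s" using s(1) r1 by linarith
    have "real g \<le> r\<^sup>2" by (simp add: r_def)
    also have "\<dots> \<le> (real s)\<^sup>2" using s(1) r1 by (intro power_mono) auto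
    finally have "real g \<le> real (s\<^sup>2)" by simp
    then show "g \<le> s\<^sup>2" by (simp only: of_nat_le_iff)
    have "real (48 * (s * \<mu>)) = 48 * real \<mu> * real s" by simp
    also have "\<dots> \<le> 48 * real \<mu> * (2 * r)" using s(2) by (intro mult_left_mono) auto
    also have "\<dots> = 96 * x\<^sup>2" by (simp add: x2)
    also have "\<dots> \<le> (16 * x)\<^sup>2" by (simp add: power_mult_distrib)
    also have "\<dots> \<le> (real q)\<^sup>2" using q(1) x1 by (intro power_mono) auto
    finally have "real (48 * (s * \<mu>)) \<le> real (q\<^sup>2)" by simp
    then show "48 * (s * max_multiplicity G) \<le> q\<^sup>2" unfolding \<mu>(1) by (simp only: of_nat_le_iff)
  qed
  then have "ch_a G \<le> 8 * q" unfolding ch_a_def by (rule Least_le)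
  then have "real (ch_a G) \<le> real (8 * q)" by (simp only: of_nat_le_iff)
  also have "\<dots> \<le> 136 * x" using q(2) by simp
  finally show "real (ch_a G) \<le> 136 * sqrt (real \<mu>) * (real g + 1) powr (1/4)"
    by (simp add: x_def mult.assoc)
qed simp

end
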